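(* Let $\Gamma$ be a finite group of order $k\ge 2$. Let $D$ be an Eulerian digraph with an edge-labelling $w:E(D)\to\Gamma$ and with minimum and maximum common degrees $\delta$ and $\Delta>0$, respectively. Then $D$ contains at least $$\left\lfloor\frac{\delta^3}{4e^3k\Delta^2}\right\rfloor$$ pairwise vertex-disjoint zero-sum directed cycles, where $e$ is the base of the natural logarithm.
   Context: All digraphs are finite, nonempty, simple and loopless: for each ordered pair $(u,v)$ there is at most one edge from $u$ to $v$, there are no edges from a vertex to itself, and both opposite edges $uv$ and $vu$ may be present. A digraph is Eulerian if the outdegree $d^+(v)$ equals the indegree $d^-(v)$ for every vertex $v$ (connectivity is not required); the common degree is $d(v):=d^+(v)=d^-(v)$, and $\delta:=\min_v d(v)$, $\Delta:=\max_v d(v)$. A directed cycle $C=v_1v_2\cdots v_\ell v_1$ has distinct vertices $v_1,\dots,v_\ell$ and all displayed edges in $D$ (so $\ell\ge 2$); cycles differing by cyclic rotation are the same. $\Gamma$ is written multiplicatively with identity $1_\Gamma$ and need not be abelian. The ordered label product of $C$ is $w(C)=w(v_1v_2)w(v_2v_3)\cdots w(v_\ell v_1)$; $C$ is zero-sum if $w(C)=1_\Gamma$ (independent of the choice of initial vertex). *)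

theory Defs
  imports
    Complex_Main
    "HOL-Algebra.Group"
    "HOL-Algebra.Coset"
    "Graph_Theory.Digraph"
    "Graph_Theory.Arc_Walk"
begin

text \<open>
  The locale \<^locale>\<open>digraph\<close> provides finiteness, no loops and no parallel arcs; opposite
  arcs are allowed, while the null digraph has to be excluded explicitly.
\<close>

locale eulerian_digraph = digraph +
  assumes verts_nonempty: "verts G \<noteq> {}"
    and balanced: "v \<in> verts G \<Longrightarrow> out_degree G v = in_degree G v"

text \<open>
  Used for Eulerian digraphs only, where the out-degree is the common degree. In- and
  out-degree are cardinalities of arc sets, since there are no parallel arcs.
\<close>

definition min_degree :: "('a, 'b) pre_digraph \<Rightarrow> nat" where
  "min_degree G = Min (out_degree G ` verts G)"

definition max_degree :: "('a, 'b) pre_digraph \<Rightarrow> nat" where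
  "max_degree G = Max (out_degree G ` verts G)"

text \<open>
  A cycle is represented by the list of its arcs in order, starting at some vertex of the
  cycle (\<^const>\<open>pre_digraph.cycle\<close>); a loopless digraph has no cycles of length 1. 
  The vertices of a cycle are exactly the tails of its arcs.
\<close>

definition cycle_verts :: "('a, 'b) pre_digraph \<Rightarrow> 'b list \<Rightarrow> 'a set" where
  "cycle_verts G p = tail G ` set p"

lemma (in wf_digraph) cycle_verts_eq_awalk_verts:
  assumes "awalk u p u" and "p \<noteq> []"
  shows "cycle_verts G p = set (awalk_verts u p)"
proof -
  have "set (awalk_verts x p) = insert y (tail G ` set p)" if "cas x p y" for x y
    using that by (induction p arbitrary: x) auto
  moreover have "u \<in> tail G ` set p" "cas u p u"
    using assms by (cases p; auto simp: awalk_def)+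
  ultimately show ?thesis
    unfolding cycle_verts_def by blast
qed

definition label_product :: "('g, 'm) monoid_scheme \<Rightarrow> ('b \<Rightarrow> 'g) \<Rightarrow> 'b list \<Rightarrow> 'g" where
  "label_product \<Gamma> w p = foldr (\<lambda>x y. x \<otimes>\<^bsub>\<Gamma>\<^esub> y) (map w p) \<one>\<^bsub>\<Gamma>\<^esub>"

definition zero_sum_cycle ::
    "('g, 'm) monoid_scheme \<Rightarrow> ('a, 'b) pre_digraph \<Rightarrow> ('b \<Rightarrow> 'g) \<Rightarrow> 'b list \<Rightarrow> bool" where
  "zero_sum_cycle \<Gamma> G w p \<longleftrightarrow> pre_digraph.cycle G p \<and> label_product \<Gamma> w p = \<one>\<^bsub>\<Gamma>\<^esub>"

end

theory Submission
  imports
    "HOL-Analysis.Analysis"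
    "HOL-Combinatorics.Cycles"
    "HOL-Computational_Algebra.Fundamental_Theorem_Algebra"
    "Jordan_Normal_Form.Determinant"
    Defs
begin

text \<open>
  Suppose that fewer than \<open>r\<close> disjoint zero-sum cycles exist. Let \<open>p(\<zeta>)\<close> be the sum of
  \<open>a ^ |S| * \<zeta> ^ z(\<sigma>)\<close> over all permutations \<open>\<sigma>\<close> of vertex sets \<open>S\<close> that move along arcs, where
  \<open>z(\<sigma>) < r\<close> counts the zero-sum cycles of \<open>\<sigma>\<close>. As \<open>p\<close> has degree below \<open>r\<close>, the value \<open>p(1)\<close> is
  an alternating binomial combination of the values \<open>p(1 - jk)\<close>, \<open>1 \<le> j \<le> r\<close>. These are small:
  in the representation of \<open>\<Gamma>\<close> given by \<open>j\<close> regular representations minus a trivial one, the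
  trace at \<open>g\<close> is \<open>jk - 1\<close> or \<open>-1\<close> according to whether \<open>g\<close> is the identity, so
  \<open>p(1 - jk)\<close> is obtained by extracting coefficients from a determinant \<open>det(I - Y N)\<close>, which is
  estimated by Hadamard's inequality on a torus \<open>|y\<^sub>v| = \<rho>\<close>. On the other hand \<open>p(1)\<close> is a permanent-like sum of positive terms, and
  Gurvits' capacity method for stable polynomials shows that it is at least the product of
  \<open>(a d(v) / e) powr (d(v) / (\<Delta> + 1))\<close>. For \<open>a = e\<^sup>2 / \<delta>\<close> the two bounds contradict each other.
\<close>

section \<open>A capacity bound for stable polynomials\<close>

text \<open>The sum p(1) is a permanent, out of reach of determinant estimates. In det(I - Y N) a
  permutation has the sign (-1) ^ (number of its cycles), and summing over the indices of the
  representation gives each cycle the trace of its label product. For other cycles to count 1, the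
  trace must be -1 off the identity; subtracting a trivial representation achieves this, and
  zero-sum cycles then count 1 - jk. The value p(1) would need j = 0, a representation of dimension
  -1, so it is extrapolated from j = 1, ..., r.

  As there are no loops, N has zero diagonal and \<rho> enters Hadamard's bound only quadratically;
  extraction costs a factor quadratic in a / \<rho> per vertex. With the best \<rho>, the logarithm
  of the upper bound is, apart from 2 ^ r, proportional to a, while that of the lower bound is at
  least ln (a * \<delta>) - 1 times the number of arcs over \<Delta> + 1. The quotient (ln x - 1) /
  x is largest at x = e^2, whence the choice of a. The denominator \<Delta> + 1 leaves every vertex
  a positive share for being uncovered.\<close>

lemma poly_prod_mset: "poly (\<Prod>\<gamma>\<in>#A. f \<gamma>) s = (\<Prod>\<gamma>\<in>#A. poly (f \<gamma>) s)"
  by (induction A) auto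

lemma poly_map_poly_of_real:
  "poly (map_poly of_real q) (of_real s) = (of_real (poly q s) :: 'a :: {comm_ring_1, real_algebra_1})"
  by (induction q) (auto simp: map_poly_pCons)

text \<open>Normalising at 0 and not at the leading coefficient makes the linear coefficient,
  relative to the value at 0, the plain sum of the \<gamma>.\<close>

lemma complex_poly_factorization:
  fixes q :: "complex poly"
  assumes "poly q 0 \<noteq> 0"
  obtains A where "size A = degree q" "q = Polynomial.smult (poly q 0) (\<Prod>\<gamma>\<in>#A. [:1, \<gamma>:])"
    "\<And>\<gamma>. \<gamma> \<in># A \<Longrightarrow> \<gamma> \<noteq> 0 \<and> poly q (- inverse \<gamma>) = 0"
proof -
  have "q \<noteq> 0" using assms by auto
  from alg_closed_imp_factorization[OF this]
  obtain R where R: "size R = degree q" "q = Polynomial.smult (lead_coeff q) (\<Prod>x\<in>#R. [:-x, 1:])"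
    by (elim exE conjE)
  have lin: "poly [:-x, 1:] s = s - x" for x s :: complex by simp
  have ev: "poly q s = lead_coeff q * (\<Prod>x\<in>#R. s - x)" for s
    by (subst R(2)) (simp only: poly_smult poly_prod_mset lin)
  have root: "poly q x = 0" if "x \<in># R" for x
  proof -
    have "0 \<in># image_mset (\<lambda>y. x - y) R" using that by force
    then have "(\<Prod>y\<in>#R. x - y) = 0" by (simp only: prod_mset_zero_iff)
    then show ?thesis by (simp only: ev mult_zero_right)
  qed
  have nz: "x \<noteq> 0" if "x \<in># R" for x using root[OF that] assms by blast
  have fac: "(\<Prod>x\<in>#M. [:-x, 1:]) = Polynomial.smult (\<Prod>x\<in>#M. - x) (\<Prod>\<gamma>\<in>#image_mset (\<lambda>x. - inverse x) M. [:1, \<gamma>:])"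
    if "\<forall>x\<in>#M. x \<noteq> 0" for M :: "complex multiset"
    using that
  proof (induction M)
    case (add x M)
    have "[:-x, 1:] = Polynomial.smult (-x) [:1, - inverse x:]" using add.prems by simp
    moreover have "(\<Prod>x\<in>#M. [:-x, 1:]) = Polynomial.smult (\<Prod>x\<in>#M. - x) (\<Prod>\<gamma>\<in>#image_mset (\<lambda>x. - inverse x) M. [:1, \<gamma>:])"
      by (intro add.IH) (use add.prems in auto)
    ultimately show ?case
      by (simp only: image_mset_add_mset prod_mset.add_mset mult_smult_left mult_smult_right smult_smult mult.commute)
  qed simp
  let ?A = "image_mset (\<lambda>x. - inverse x) R"
  have p0: "poly q 0 = lead_coeff q * (\<Prod>x\<in>#R. - x)" by (simp only: ev diff_0)
  show ?thesis
  proof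
    show "size ?A = degree q" by (simp only: size_image_mset R(1))
    have "q = Polynomial.smult (lead_coeff q) (\<Prod>x\<in>#R. [:-x, 1:])" by (rule R(2))
    also have "(\<Prod>x\<in>#R. [:-x, 1:]) = Polynomial.smult (\<Prod>x\<in>#R. - x) (\<Prod>\<gamma>\<in>#?A. [:1, \<gamma>:])"
      using nz by (intro fac) blast
    finally show "q = Polynomial.smult (poly q 0) (\<Prod>\<gamma>\<in>#?A. [:1, \<gamma>:])"
      by (simp only: p0 smult_smult)
    show "\<gamma> \<noteq> 0 \<and> poly q (- inverse \<gamma>) = 0" if \<gamma>: "\<gamma> \<in># ?A" for \<gamma>
    proof -
      obtain x where "x \<in># R" "\<gamma> = - inverse x" using \<gamma> unfolding set_image_mset by blast
      then show ?thesis using nz[of x] root[of x] by simp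
    qed
  qed
qed

lemma coeff_1_prod_linear:
  "coeff (\<Prod>\<gamma>\<in>#A. [:1, \<gamma>:]) (Suc 0) = (sum_mset A :: 'a :: comm_ring_1)"
  "coeff (\<Prod>\<gamma>\<in>#A. [:1, \<gamma>:]) 0 = (1 :: 'a)"
  by (induction A) (auto simp: algebra_simps)

text \<open>The roots -1/\<gamma> lie in the open left half-plane and inversion preserves the right
  one, so the nonempty sum of the \<gamma> has positive real part.\<close>

lemma coeff_1_nonzero_of_stable:
  fixes q :: "complex poly"
  assumes stable: "\<And>s. Re s \<ge> 0 \<Longrightarrow> poly q s \<noteq> 0" and "degree q > 0"
  shows "coeff q (Suc 0) \<noteq> 0"
proof -
  obtain A where A: "size A = degree q" "q = Polynomial.smult (poly q 0) (\<Prod>\<gamma>\<in>#A. [:1, \<gamma>:])"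
    "\<And>\<gamma>. \<gamma> \<in># A \<Longrightarrow> \<gamma> \<noteq> 0 \<and> poly q (- inverse \<gamma>) = 0"
    using complex_poly_factorization stable[of 0] by (metis order.refl zero_complex.sel(1))
  have pos: "Re \<gamma> > 0" if "\<gamma> \<in># A" for \<gamma>
  proof -
    have "Re (inverse \<gamma>) > 0" using stable[of "- inverse \<gamma>"] A(3)[OF that] by force
    then show ?thesis by (simp add: zero_less_divide_iff not_sum_power2_lt_zero)
  qed
  have "(\<forall>\<gamma>\<in>#M. Re \<gamma> > 0) \<Longrightarrow> Re (sum_mset M) \<ge> 0 \<and> (M \<noteq> {#} \<longrightarrow> Re (sum_mset M) > 0)" for M
    by (induction M) auto
  moreover have "A \<noteq> {#}" using A(1) assms(2) by auto
  ultimately have "Re (sum_mset A) > 0" using pos by blast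
  then have "sum_mset A \<noteq> 0" by auto
  moreover have "poly q 0 \<noteq> 0" using stable[of 0] by simp
  moreover have "coeff q (Suc 0) = poly q 0 * sum_mset A"
    by (subst A(2)) (simp only: coeff_smult coeff_1_prod_linear)
  ultimately show ?thesis by (simp only: no_zero_divisors not_False_eq_True)
qed

text \<open>Each factor is 1 + s\<gamma> with \<gamma> > 0, hence at most exp(s\<gamma>), and the
  \<gamma> add up to the logarithmic derivative at 0.\<close>

lemma poly_le_exp_of_negative_roots:
  fixes q :: "real poly"
  assumes "poly q 0 > 0"
    and roots: "\<And>z. poly (map_poly complex_of_real q) z = 0 \<Longrightarrow> z \<in> \<real>\<^sub>\<le>\<^sub>0"
    and "s \<ge> 0"
  shows "poly q s \<le> poly q 0 * exp (s * coeff q (Suc 0) / poly q 0)"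
proof -
  let ?q = "map_poly complex_of_real q"
  have q0: "poly ?q 0 = of_real (poly q 0)" by (simp add: poly_0_coeff_0 coeff_map_poly)
  obtain A where A: "?q = Polynomial.smult (poly ?q 0) (\<Prod>\<gamma>\<in>#A. [:1, \<gamma>:])"
    "\<And>\<gamma>. \<gamma> \<in># A \<Longrightarrow> \<gamma> \<noteq> 0 \<and> poly ?q (- inverse \<gamma>) = 0"
    using complex_poly_factorization[of ?q] assms(1) q0 by (metis less_numeral_extra(3) of_real_eq_0_iff)
  have real: "\<gamma> = of_real (norm \<gamma>)" if "\<gamma> \<in># A" for \<gamma>
  proof -
    have "- inverse \<gamma> \<in> \<real>\<^sub>\<le>\<^sub>0" using roots A(2)[OF that] by blast
    then have "inverse \<gamma> \<in> \<real>\<^sub>\<ge>\<^sub>0" by (simp add: complex_nonpos_Reals_iff complex_nonneg_Reals_iff)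
    then obtain r where r: "inverse \<gamma> = of_real r" "r \<ge> 0" by (auto elim: nonneg_Reals_cases)
    then have "\<gamma> = of_real (inverse r)" by (metis inverse_inverse_eq of_real_inverse)
    then show ?thesis using r(2) by (simp add: norm_inverse)
  qed
  have "sum_mset A = of_real (\<Sum>\<gamma>\<in>#A. norm \<gamma>)"
  proof -
    have "(\<forall>\<gamma>\<in>#M. \<gamma> = of_real (norm \<gamma>)) \<Longrightarrow> sum_mset M = of_real (\<Sum>\<gamma>\<in>#M. norm \<gamma>)" for M :: "complex multiset"
      by (induction M) auto
    then show ?thesis using real by blast
  qed
  moreover have "coeff ?q (Suc 0) = poly ?q 0 * sum_mset A"
    by (subst A(1)) (simp only: coeff_smult coeff_1_prod_linear)
  moreover have "coeff ?q (Suc 0) = of_real (coeff q (Suc 0))" by (simp add: coeff_map_poly)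
  ultimately have "of_real (coeff q (Suc 0)) = complex_of_real (poly q 0 * (\<Sum>\<gamma>\<in>#A. norm \<gamma>))"
    by (simp only: q0 of_real_mult)
  then have c1: "coeff q (Suc 0) = poly q 0 * (\<Sum>\<gamma>\<in>#A. norm \<gamma>)"
    using of_real_eq_iff by blast
  define L where "L = (\<Sum>\<gamma>\<in>#A. norm \<gamma>)"
  have bd: "norm (\<Prod>\<gamma>\<in>#M. 1 + of_real s * \<gamma>) \<le> exp (s * (\<Sum>\<gamma>\<in>#M. norm \<gamma>))" for M :: "complex multiset"
  proof (induction M)
    case (add \<gamma> M)
    have "norm (1 + of_real s * \<gamma>) \<le> 1 + s * norm \<gamma>"
      using norm_triangle_ineq[of 1 "of_real s * \<gamma>"] assms(3) by (simp add: norm_mult)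
    also have "\<dots> \<le> exp (s * norm \<gamma>)" by (rule exp_ge_add_one_self)
    finally show ?case using add
      by (simp only: image_mset_add_mset prod_mset.add_mset sum_mset.add_mset norm_mult exp_add ring_distribs(1) mult_mono
          norm_ge_zero exp_ge_zero)
  qed auto
  have "of_real (poly q s) = poly ?q (of_real s)" by (simp add: poly_map_poly_of_real)
  also have "\<dots> = of_real (poly q 0) * (\<Prod>\<gamma>\<in>#A. 1 + of_real s * \<gamma>)"
    by (subst A(1)) (simp add: q0 poly_prod_mset)
  finally have "norm (complex_of_real (poly q s)) = poly q 0 * norm (\<Prod>\<gamma>\<in>#A. 1 + complex_of_real s * \<gamma>)"
    using assms(1) by (simp add: norm_mult)
  then have "poly q s \<le> poly q 0 * exp (s * L)"
    using mult_left_mono[OF bd[of A, folded L_def], of "poly q 0"] assms(1) abs_ge_self[of "poly q s"]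
    by (simp only: norm_of_real) linarith
  then show ?thesis using assms(1) by (simp add: c1[folded L_def])
qed

text \<open>Along the imaginary axis the imaginary part of a real polynomial vanishes at 0, where
  its derivative is the linear coefficient.\<close>

lemma Im_poly_imaginary_neg:
  fixes Q :: "real poly"
  assumes "coeff Q (Suc 0) < 0"
  obtains \<eta> where "\<eta> > 0" "Im (poly (map_poly complex_of_real Q) (\<i> * of_real \<eta>)) < 0"
proof -
  let ?Q = "map_poly complex_of_real Q"
  let ?F = "\<lambda>t. Im (poly ?Q (\<i> * of_real t))"
  have "((\<lambda>t. poly ?Q (\<i> * of_real t)) has_vector_derivative \<i> * poly (pderiv ?Q) 0) (at 0)"
    by (rule has_vector_derivative_eq_rhs[OF field_vector_diff_chain_at[where g = "poly ?Q" and g' = "poly (pderiv ?Q) 0", unfolded o_def]])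
      (auto intro!: derivative_eq_intros poly_DERIV simp: poly_DERIV)
  then have "(?F has_real_derivative Im (\<i> * poly (pderiv ?Q) 0)) (at 0)"
    by (simp add: has_vector_derivative_complex_iff)
  moreover have "Im (\<i> * poly (pderiv ?Q) 0) = coeff Q (Suc 0)"
    by (simp add: poly_0_coeff_0 coeff_pderiv coeff_map_poly)
  ultimately have "(?F has_real_derivative coeff Q (Suc 0)) (at 0)" by simp
  from DERIV_neg_dec_right[OF this assms] obtain d where "d > 0" "\<forall>h>0. h < d \<longrightarrow> ?F (0 + h) < ?F 0"
    by auto
  then have "?F (d / 2) < ?F 0" using \<open>d > 0\<close> by (metis add_0 field_sum_of_halves half_gt_zero less_add_same_cancel1)
  then show ?thesis using that[of "d/2"] \<open>d > 0\<close> by (simp add: poly_0_coeff_0 coeff_map_poly)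
qed

text \<open>The arguments are the two lowest coefficients of g and h when the generating polynomial
  is read as g(s) + t h(s). One well-chosen test point suffices.\<close>

lemma capacity_step_real:
  fixes \<alpha> \<kappa> g0 g1 h0 h1 :: real
  assumes \<alpha>: "0 < \<alpha>" "\<alpha> < 1" and "\<kappa> \<ge> 0"
    and pos: "g0 > 0" "g1 > 0" "h0 > 0" and h1: "g0 * h1 \<le> g1 * h0"
    and bound: "\<And>s t. s > 0 \<Longrightarrow> t > 0 \<Longrightarrow>
      \<kappa> * (s powr \<alpha> * t powr (1 - \<alpha>)) \<le> (g0 + t * h0) * exp (s * (g1 + t * h1) / (g0 + t * h0))"
  shows "\<kappa> * (\<alpha> powr \<alpha> * exp (- \<alpha>)) \<le> g1 + h0"
proof -
  \<comment> \<open>This \<open>t\<close> gives \<open>t * h0\<close> the share 1 - \<alpha> of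
    \<open>g0 + t * h0\<close>, and \<open>s\<close> then makes the exponent at most \<alpha>, once
    \<open>h1\<close> is removed by the inequality between the coefficients.\<close>
  define t where "t = g0 * (1 - \<alpha>) / (h0 * \<alpha>)"
  define s where "s = g0 * \<alpha> / g1"
  have st: "s > 0" "t > 0" using pos \<alpha> by (auto simp: s_def t_def)
  have A: "g0 + t * h0 = g0 / \<alpha>" using pos \<alpha> by (simp add: t_def field_simps)
  have "t * h1 = (1 - \<alpha>) / (h0 * \<alpha>) * (g0 * h1)" by (simp add: t_def)
  also have "\<dots> \<le> (1 - \<alpha>) / (h0 * \<alpha>) * (g1 * h0)" using \<alpha> pos h1 by (intro mult_left_mono) auto
  also have "\<dots> = (1 - \<alpha>) / \<alpha> * g1" using pos by simp
  finally have B: "g1 + t * h1 \<le> g1 / \<alpha>" using \<alpha> by (simp add: field_simps)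
  have "s * (g1 + t * h1) \<le> s * (g1 / \<alpha>)" using B st by (intro mult_left_mono) auto
  also have "\<dots> = g0" using pos \<alpha> by (simp add: s_def)
  finally have "s * (g1 + t * h1) / (g0 + t * h0) \<le> g0 / (g0 / \<alpha>)"
    unfolding A using pos \<alpha> by (intro divide_right_mono) auto
  then have E: "exp (s * (g1 + t * h1) / (g0 + t * h0)) \<le> exp \<alpha>" using pos by simp
  have "\<kappa> * (s powr \<alpha> * t powr (1 - \<alpha>)) \<le> g0 / \<alpha> * exp \<alpha>"
    using bound[OF st] mult_left_mono[OF E, of "g0 / \<alpha>"] pos \<alpha> unfolding A by auto
  moreover have key: "s powr \<alpha> * t powr (1 - \<alpha>) * ((g1 / \<alpha>) powr \<alpha> * (h0 / (1 - \<alpha>)) powr (1 - \<alpha>))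
      = g0 / \<alpha> * \<alpha> powr \<alpha>"
  proof -
    have "s powr \<alpha> * (g1 / \<alpha>) powr \<alpha> = g0 powr \<alpha>"
      using pos \<alpha> by (simp add: s_def powr_mult[symmetric] del: powr_mult)
    moreover have "t powr (1 - \<alpha>) * (h0 / (1 - \<alpha>)) powr (1 - \<alpha>) = (g0 / \<alpha>) powr (1 - \<alpha>)"
      using pos \<alpha> st by (subst powr_mult[symmetric]) (auto simp: t_def)
    moreover have "g0 powr \<alpha> * (g0 / \<alpha>) powr (1 - \<alpha>) = g0 / \<alpha> * \<alpha> powr \<alpha>"
    proof -
      have "(g0 / \<alpha>) powr (1 - \<alpha>) * (g0 / \<alpha>) powr \<alpha> = g0 / \<alpha>"
        using pos \<alpha> by (simp add: powr_add[symmetric])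
      then show ?thesis using pos \<alpha> by (simp add: powr_divide field_simps)
    qed
    ultimately show ?thesis by (metis (no_types, opaque_lifting) mult.assoc mult.left_commute)
  qed
  \<comment> \<open>Weighted AM-GM turns the product that matched the test point into the wanted
    sum.\<close>
  moreover have "(g1 / \<alpha>) powr \<alpha> * (h0 / (1 - \<alpha>)) powr (1 - \<alpha>) \<le> g1 + h0"
    using Youngs_inequality_0[of \<alpha> "1 - \<alpha>" "g1 / \<alpha>" "h0 / (1 - \<alpha>)"] \<alpha> pos by simp
  ultimately show ?thesis
  proof -
    let ?Y = "(g1 / \<alpha>) powr \<alpha> * (h0 / (1 - \<alpha>)) powr (1 - \<alpha>)"
    let ?X = "s powr \<alpha> * t powr (1 - \<alpha>)"
    assume 1: "\<kappa> * ?X \<le> g0 / \<alpha> * exp \<alpha>" and 2: "?X * ?Y = g0 / \<alpha> * \<alpha> powr \<alpha>" and 3: "?Y \<le> g1 + h0"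
    have "?Y > 0" using pos \<alpha> by simp
    then have "\<kappa> * (?X * ?Y) \<le> g0 / \<alpha> * exp \<alpha> * ?Y" using mult_right_mono[OF 1, of ?Y] by (simp add: mult.assoc)
    then have "g0 / \<alpha> * (\<kappa> * \<alpha> powr \<alpha>) \<le> g0 / \<alpha> * (exp \<alpha> * ?Y)" unfolding 2 by (simp add: mult_ac)
    moreover have "g0 / \<alpha> > 0" using pos \<alpha> by simp
    ultimately have "\<kappa> * \<alpha> powr \<alpha> \<le> exp \<alpha> * ?Y" using mult_le_cancel_left_pos by blast
    then have "\<kappa> * (\<alpha> powr \<alpha> * exp (- \<alpha>)) \<le> ?Y"
      by (simp add: exp_minus divide_simps mult_ac)
    then show ?thesis using 3 by simp
  qed
qed

text \<open>
  The index \<open>i\<close> stands for the monomial with exponents \<open>e i v\<close> of \<open>x\<^sub>v\<close> and \<open>b i v\<close> of \<open>z\<^sub>v\<close>.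
  Having separate variables \<open>x\<^sub>v\<close> (a vertex is entered) and \<open>z\<^sub>v\<close> (it is left uncovered) makes the
  loss in each elimination step \<open>\<alpha> powr \<alpha> * exp (- \<alpha>)\<close> instead of van der Waerden's \<open>exp (- 1)\<close>.
\<close>

definition gen :: "('i \<Rightarrow> real) \<Rightarrow> ('i \<Rightarrow> 'a \<Rightarrow> nat) \<Rightarrow> ('i \<Rightarrow> 'a \<Rightarrow> nat) \<Rightarrow> 'i set \<Rightarrow> 'a set \<Rightarrow>
    ('a \<Rightarrow> 'c::real_field) \<Rightarrow> ('a \<Rightarrow> 'c) \<Rightarrow> 'c" where
  "gen C e b I W x z = (\<Sum>i\<in>I. of_real (C i) * (\<Prod>v\<in>W. x v ^ e i v * z v ^ b i v))"

lemma gen_insert: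
  assumes "finite W" "v \<notin> W"
  shows "gen C e b I (insert v W) (x(v := s)) (z(v := t)) =
    (\<Sum>i\<in>I. of_real (C i) * (\<Prod>u\<in>W. x u ^ e i u * z u ^ b i u) * (s ^ e i v * t ^ b i v))"
proof -
  have "(\<Prod>u\<in>W. (x(v := s)) u ^ e i u * (z(v := t)) u ^ b i u) = (\<Prod>u\<in>W. x u ^ e i u * z u ^ b i u)" for i
    using assms(2) by (intro prod.cong) auto
  then show ?thesis using assms by (simp add: gen_def mult_ac)
qed

text \<open>\<open>homogeneous\<close> allows all variables to be rotated together.
  \<open>all_z\<close> and \<open>one_x\<close> provide monomials that survive elimination and keep
  the constant coefficient of h and the linear coefficient of g positive. In \<open>stable\<close>
  the half-planes are closed except for one strict x, because points such as x_v = z_v = 0 are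
  substituted later.\<close>

locale stable_family =
  fixes C :: "'i \<Rightarrow> real" and e b :: "'i \<Rightarrow> 'a \<Rightarrow> nat" and I :: "'i set" and W :: "'a set"
  assumes finite_I: "finite I" and finite_W: "finite W"
    and C_pos: "i \<in> I \<Longrightarrow> C i > 0"
    and b_le: "i \<in> I \<Longrightarrow> v \<in> W \<Longrightarrow> b i v \<le> 1"
    and homogeneous: "i \<in> I \<Longrightarrow> (\<Sum>v\<in>W. e i v + b i v) = card W"
    and all_z: "\<exists>i\<in>I. \<forall>v\<in>W. e i v = 0 \<and> b i v = 1"
    and one_x: "v \<in> W \<Longrightarrow> \<exists>i\<in>I. e i v = 1 \<and> b i v = 0 \<and> (\<forall>u\<in>W-{v}. e i u = 0 \<and> b i u = 1)"
    and stable: "(\<And>v. v \<in> W \<Longrightarrow> 0 \<le> Re (x v) \<and> 0 \<le> Re (z v)) \<Longrightarrow> (\<exists>v\<in>W. 0 < Re (x v)) \<Longrightarrow>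
        gen C e b I W x z \<noteq> 0"
begin

text \<open>By homogeneity \<omega> comes out as a power, so every half-plane bounded by a line
  through 0 serves as well as the right one.\<close>

lemma stable_rotated:
  assumes "\<And>v. v \<in> W \<Longrightarrow> 0 \<le> Re (\<omega> * x v) \<and> 0 \<le> Re (\<omega> * z v)" "\<exists>v\<in>W. 0 < Re (\<omega> * x v)"
  shows "gen C e b I W x z \<noteq> 0"
proof -
  have "(\<Prod>v\<in>W. (\<omega> * x v) ^ e i v * (\<omega> * z v) ^ b i v) =
      \<omega> ^ card W * (\<Prod>v\<in>W. x v ^ e i v * z v ^ b i v)" if "i \<in> I" for i
  proof -
    have "(\<Prod>v\<in>W. (\<omega> * x v) ^ e i v * (\<omega> * z v) ^ b i v) =
        (\<Prod>v\<in>W. \<omega> ^ (e i v + b i v) * (x v ^ e i v * z v ^ b i v))"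
      by (intro prod.cong refl) (simp add: power_mult_distrib power_add mult_ac)
    then show ?thesis by (simp add: prod.distrib power_sum[symmetric] homogeneous[OF that])
  qed
  then have "gen C e b I W (\<lambda>v. \<omega> * x v) (\<lambda>v. \<omega> * z v) = \<omega> ^ card W * gen C e b I W x z"
    by (simp add: gen_def sum_distrib_left mult_ac)
  moreover have "gen C e b I W (\<lambda>v. \<omega> * x v) (\<lambda>v. \<omega> * z v) \<noteq> 0"
    using assms by (intro stable) auto
  ultimately show ?thesis by auto
qed

text \<open>After setting x_v = z_v = s, the retained monomials form the linear coefficient of a
  polynomial in s without roots in the closed right half-plane.\<close>

lemma eliminate:
  assumes v: "v \<in> W"
  shows "stable_family C e b {i\<in>I. e i v + b i v = 1} (W - {v})"
proof -
  define W' where "W' = W - {v}"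
  define I' where "I' = {i\<in>I. e i v + b i v = 1}"
  have W: "W = insert v W'" "v \<notin> W'" "finite W'" using v finite_W by (auto simp: W'_def)
  have "stable_family C e b I' W'"
  proof
    show "finite I'" "finite W'" using finite_I W by (auto simp: I'_def)
    show "C i > 0" if "i \<in> I'" for i using that C_pos by (auto simp: I'_def)
    show "b i u \<le> 1" if "i \<in> I'" "u \<in> W'" for i u using that b_le W by (auto simp: I'_def)
    show "(\<Sum>v\<in>W'. e i v + b i v) = card W'" if "i \<in> I'" for i
      using that homogeneous[of i] W by (simp add: I'_def)
    show "\<exists>i\<in>I'. \<forall>v\<in>W'. e i v = 0 \<and> b i v = 1"
      using all_z W by (force simp: I'_def)
    show "\<exists>i\<in>I'. e i u = 1 \<and> b i u = 0 \<and> (\<forall>y\<in>W'-{u}. e i y = 0 \<and> b i y = 1)" if u: "u \<in> W'" for u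
    proof -
      obtain i where i: "i \<in> I" "e i u = 1" "b i u = 0" "\<forall>y\<in>W-{u}. e i y = 0 \<and> b i y = 1"
        using one_x[of u] u W by auto
      have "v \<in> W - {u}" using u W by auto
      then have "i \<in> I'" using i by (auto simp: I'_def)
      then show ?thesis using i W by blast
    qed
    fix x z :: "'a \<Rightarrow> complex"
    assume xz: "\<And>v. v \<in> W' \<Longrightarrow> 0 \<le> Re (x v) \<and> 0 \<le> Re (z v)" "\<exists>v\<in>W'. 0 < Re (x v)"
    define K where "K i = of_real (C i) * (\<Prod>u\<in>W'. x u ^ e i u * z u ^ b i u)" for i
    define q where "q = (\<Sum>i\<in>I. monom (K i) (e i v + b i v))"
    have q: "poly q s = gen C e b I W (x(v := s)) (z(v := s))" for s
      unfolding W(1) gen_insert[OF W(3,2)] by (simp add: q_def K_def poly_sum poly_monom power_add mult_ac)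
    have cq: "coeff q n = (\<Sum>i\<in>{i\<in>I. e i v + b i v = n}. K i)" for n
      using finite_I by (simp add: q_def coeff_sum sum.inter_filter)
    have nz: "poly q s \<noteq> 0" if "Re s \<ge> 0" for s
      unfolding q using xz that W(2) by (intro stable) (auto simp: W(1))
    have mono: "e i v + b i v = card W \<longleftrightarrow> (\<forall>u\<in>W'. e i u = 0 \<and> b i u = 0)" if "i \<in> I" for i
      using homogeneous[OF that] W by (auto simp: sum.insert)
    \<comment> \<open>Setting x_v = 1 and all other variables to 0 detects a monomial in x_v alone.
      By homogeneity such monomials have degree \<open>card W\<close>, and their positive weights
      cannot cancel; this yields the positive degree of \<open>q\<close>.\<close>
    have "gen C e b I W (\<lambda>u. if u = v then 1 else 0 :: complex) (\<lambda>_. 0) \<noteq> 0"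
      using v by (intro stable) auto
    then obtain i where "i \<in> I" "(\<Prod>u\<in>W. (if u = v then 1 else 0 :: complex) ^ e i u * 0 ^ b i u) \<noteq> 0"
      unfolding gen_def by (metis (no_types, lifting) mult_zero_right sum.neutral)
    then have i: "i \<in> I" "\<forall>u\<in>W'. e i u = 0 \<and> b i u = 0"
      using finite_W W by (auto simp: prod_zero_iff power_0_left split: if_splits)
    have "coeff q (card W) = of_real (\<Sum>i\<in>{i\<in>I. e i v + b i v = card W}. C i)"
      unfolding cq of_real_sum by (intro sum.cong refl) (auto simp: K_def mono)
    moreover have "(\<Sum>i\<in>{i\<in>I. e i v + b i v = card W}. C i) > 0"
      using i mono finite_I C_pos by (intro sum_pos) auto
    ultimately have "coeff q (card W) \<noteq> 0" by (metis less_irrefl of_real_eq_0_iff)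
    then have "card W \<le> degree q" by (rule le_degree)
    then have "degree q > 0" using W by simp
    from coeff_1_nonzero_of_stable[OF nz this]
    show "gen C e b I' W' x z \<noteq> 0"
      by (simp add: cq gen_def K_def I'_def)
  qed
  then show ?thesis by (simp add: I'_def W'_def)
qed

end

lemma map_poly_of_real_monom_sum:
  "map_poly (of_real :: real \<Rightarrow> 'c::{comm_ring_1,real_algebra_1}) (\<Sum>i\<in>J. monom (K i) (n i))
    = (\<Sum>i\<in>J. monom (of_real (K i)) (n i))"
  by (rule poly_eqI) (auto simp: coeff_map_poly coeff_sum intro!: sum.cong)

lemma map_poly_of_real_mult:
  "map_poly (of_real :: real \<Rightarrow> 'c::{comm_ring_1,real_algebra_1}) (p * q)
    = map_poly of_real p * map_poly of_real q"
  by (rule poly_eqI) (simp add: coeff_map_poly coeff_mult)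

lemma map_poly_of_real_add:
  "map_poly (of_real :: real \<Rightarrow> 'c::{comm_ring_1,real_algebra_1}) (p + q)
    = map_poly of_real p + map_poly of_real q"
  by (rule poly_eqI) (simp add: coeff_map_poly)

lemma map_poly_of_real_minus:
  "map_poly (of_real :: real \<Rightarrow> 'c::{comm_ring_1,real_algebra_1}) (- q) = - map_poly of_real q"
  by (rule poly_eqI) (simp add: coeff_map_poly)

lemma map_poly_of_real_smult:
  "map_poly (of_real :: real \<Rightarrow> 'c::{comm_ring_1,real_algebra_1}) (Polynomial.smult r q)
    = Polynomial.smult (of_real r) (map_poly of_real q)"
  by (rule poly_eqI) (simp add: coeff_map_poly)

lemma cnj_poly_of_real:
  "cnj (poly (map_poly complex_of_real h) s) = poly (map_poly complex_of_real h) (cnj s)"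
  by (induction h) (auto simp: map_poly_pCons)

lemma poly_of_real_reflect:
  "poly (map_poly complex_of_real (h \<circ>\<^sub>p [:0, -1:])) s = poly (map_poly complex_of_real h) (- s)"
  by (induction h) (auto simp: map_poly_pCons pcompose_pCons map_poly_of_real_add map_poly_of_real_mult map_poly_of_real_minus)

context stable_family
begin

text \<open>
  As a function of \<open>s = x\<^sub>v\<close> and \<open>t = z\<^sub>v\<close> the generating polynomial is \<open>g(s) + t h(s)\<close>. Rotating the
  half-plane shows that it has only negative roots in \<open>s\<close>, hence grows at most exponentially, and
  that \<open>g\<^sub>0 h\<^sub>1 \<le> g\<^sub>1 h\<^sub>0\<close>: otherwise some purely imaginary \<open>s\<close> would give a root \<open>t\<close> with positive
  imaginary part.
\<close>

lemma capacity_step: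
  fixes \<alpha> :: "'a \<Rightarrow> real" and \<kappa> :: real
  assumes v: "v \<in> W" and \<alpha>: "0 < \<alpha> v" "\<alpha> v < 1" and \<kappa>: "\<kappa> \<ge> 0"
    and bound: "\<And>x z :: 'a \<Rightarrow> real. (\<And>u. u \<in> W \<Longrightarrow> x u > 0 \<and> z u > 0) \<Longrightarrow>
      \<kappa> * (\<Prod>u\<in>W. x u powr \<alpha> u * z u powr (1 - \<alpha> u)) \<le> gen C e b I W x z"
    and xz: "\<And>u. u \<in> W - {v} \<Longrightarrow> x u > 0 \<and> z u > 0"
  shows "\<kappa> * (\<alpha> v powr \<alpha> v * exp (- \<alpha> v)) * (\<Prod>u\<in>W-{v}. x u powr \<alpha> u * z u powr (1 - \<alpha> u))
      \<le> gen C e b {i\<in>I. e i v + b i v = 1} (W - {v}) x z"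
proof -
  define W' where "W' = W - {v}"
  define I' where "I' = {i\<in>I. e i v + b i v = 1}"
  have W: "W = insert v W'" "v \<notin> W'" "finite W'" using v finite_W by (auto simp: W'_def)
  define K where "K i = C i * (\<Prod>u\<in>W'. x u ^ e i u * z u ^ b i u)" for i
  have K: "K i > 0" if "i \<in> I" for i
    unfolding K_def using C_pos[OF that] xz by (intro mult_pos_pos prod_pos) (auto simp: W'_def)
  define I0 where "I0 = {i\<in>I. b i v = 0}"
  define I1 where "I1 = {i\<in>I. b i v = 1}"
  have I01: "I = I0 \<union> I1" "I0 \<inter> I1 = {}" "finite I0" "finite I1"
    using b_le v finite_I by (auto simp: I0_def I1_def le_Suc_eq)
  define g where "g = (\<Sum>i\<in>I0. monom (K i) (e i v))"
  define h where "h = (\<Sum>i\<in>I1. monom (K i) (e i v))"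
  define \<kappa>' where "\<kappa>' = \<kappa> * (\<Prod>u\<in>W'. x u powr \<alpha> u * z u powr (1 - \<alpha> u))"
  have \<kappa>': "\<kappa>' \<ge> 0" unfolding \<kappa>'_def using \<kappa> by (intro mult_nonneg_nonneg prod_nonneg) auto
  have ev: "gen C e b I W ((\<lambda>u. of_real (x u))(v := s)) ((\<lambda>u. of_real (z u))(v := t))
      = poly (map_poly of_real g) s + t * poly (map_poly of_real h) s" for s t :: "'c::real_field"
  proof -
    have "gen C e b I W ((\<lambda>u. of_real (x u))(v := s)) ((\<lambda>u. of_real (z u))(v := t))
      = (\<Sum>i\<in>I. of_real (K i) * (s ^ e i v * t ^ b i v))"
      unfolding W(1) gen_insert[OF W(3,2)] by (simp add: K_def)
    also have "\<dots> = (\<Sum>i\<in>I0. of_real (K i) * (s ^ e i v * t ^ b i v)) + (\<Sum>i\<in>I1. of_real (K i) * (s ^ e i v * t ^ b i v))"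
      using I01 by (simp add: sum.union_disjoint)
    also have "(\<Sum>i\<in>I0. of_real (K i) * (s ^ e i v * t ^ b i v)) = poly (map_poly of_real g) s"
      unfolding g_def map_poly_of_real_monom_sum by (auto simp: poly_sum poly_monom I0_def intro!: sum.cong)
    also have "(\<Sum>i\<in>I1. of_real (K i) * (s ^ e i v * t ^ b i v)) = t * poly (map_poly of_real h) s"
      unfolding h_def map_poly_of_real_monom_sum
      by (auto simp: poly_sum poly_monom I1_def sum_distrib_left intro!: sum.cong)
    finally show ?thesis .
  qed
  have evr: "gen C e b I W (x(v := s)) (z(v := t)) = poly g s + t * poly h s" for s t :: real
    using ev[of s t] by (simp add: map_poly_idI)
  have bound': "\<kappa>' * (s powr \<alpha> v * t powr (1 - \<alpha> v)) \<le> poly g s + t * poly h s" if "s > 0" "t > 0" for s t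
  proof -
    have "(\<Prod>u\<in>W. (x(v := s)) u powr \<alpha> u * (z(v := t)) u powr (1 - \<alpha> u)) =
      (\<Prod>u\<in>W'. x u powr \<alpha> u * z u powr (1 - \<alpha> u)) * (s powr \<alpha> v * t powr (1 - \<alpha> v))"
    proof -
      have "(\<Prod>u\<in>W'. (x(v := s)) u powr \<alpha> u * (z(v := t)) u powr (1 - \<alpha> u)) =
        (\<Prod>u\<in>W'. x u powr \<alpha> u * z u powr (1 - \<alpha> u))" using W(2) by (intro prod.cong) auto
      then show ?thesis using W by simp
    qed
    then show ?thesis
      using bound[of "x(v := s)" "z(v := t)"] xz that unfolding evr by (auto simp: \<kappa>'_def W'_def mult_ac)
  qed
  have gn: "coeff g n = (\<Sum>i\<in>{i\<in>I0. e i v = n}. K i)" and hn: "coeff h n = (\<Sum>i\<in>{i\<in>I1. e i v = n}. K i)" for n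
    using I01 by (simp_all add: g_def h_def coeff_sum sum.inter_filter)
  have g1: "coeff g 1 > 0"
  proof -
    obtain i where "i \<in> I0" "e i v = 1" using one_x[OF v] by (auto simp: I0_def)
    then show ?thesis unfolding gn using I01 K by (intro sum_pos) auto
  qed
  have h0: "coeff h 0 > 0"
  proof -
    obtain i where "i \<in> I1" "e i v = 0" using all_z v by (auto simp: I1_def)
    then show ?thesis unfolding hn using I01 K by (intro sum_pos) auto
  qed
  have hnn: "coeff h n \<ge> 0" and gnn: "coeff g n \<ge> 0" for n
    unfolding hn gn using I01 by (auto intro!: sum_nonneg less_imp_le[OF K])
  have goal: "gen C e b I' W' x z = coeff g 1 + coeff h 0"
  proof -
    have "I' = {i\<in>I0. e i v = 1} \<union> {i\<in>I1. e i v = 0}"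
      using b_le v by (auto simp: I'_def I0_def I1_def le_Suc_eq)
    then show ?thesis
      using I01 unfolding gn hn gen_def by (simp add: K_def, subst sum.union_disjoint) auto
  qed
  have "\<kappa>' * (\<alpha> v powr \<alpha> v * exp (- \<alpha> v)) \<le> coeff g 1 + coeff h 0"
  proof (cases "W' = {}")
    case True
    have "e i v + b i v = 1" if "i \<in> I" for i
      using homogeneous[OF that] W True by simp
    then have e01: "i \<in> I0 \<Longrightarrow> e i v = 1" "i \<in> I1 \<Longrightarrow> e i v = 0" for i
      by (force simp: I0_def I1_def)+
    have "g = monom (sum K I0) 1" "h = monom (sum K I1) 0"
      by (auto simp: g_def h_def e01 poly_eq_iff coeff_sum)
    then have "g = monom (coeff g 1) 1" "h = monom (coeff h 0) 0" by simp_all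
    then have gh: "poly g s = coeff g 1 * s" "poly h s = coeff h 0" for s
      by (metis poly_monom power_one_right, metis poly_monom power_0 mult.right_neutral)
    let ?a = "\<alpha> v" and ?g = "coeff g 1" and ?h = "coeff h 0"
    have "\<kappa>' * ((?a / ?g) powr ?a * ((1 - ?a) / ?h) powr (1 - ?a)) \<le> 1"
      using bound'[of "?a / ?g" "(1 - ?a) / ?h"] \<alpha> g1 h0 by (simp add: gh)
    moreover have "(?a / ?g) powr ?a * (?g / ?a) powr ?a = 1"
      using \<alpha> g1 by (subst powr_mult[symmetric]) auto
    moreover have "((1 - ?a) / ?h) powr (1 - ?a) * (?h / (1 - ?a)) powr (1 - ?a) = 1"
      using \<alpha> h0 by (subst powr_mult[symmetric]) auto
    moreover have "(?g / ?a) powr ?a * (?h / (1 - ?a)) powr (1 - ?a) \<le> ?g + ?h"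
      using Youngs_inequality_0[of ?a "1 - ?a" "?g / ?a" "?h / (1 - ?a)"] \<alpha> g1 h0 by simp
    ultimately have "\<kappa>' \<le> ?g + ?h"
    proof -
      define A B A' B' where d: "A = (?a / ?g) powr ?a" "B = ((1 - ?a) / ?h) powr (1 - ?a)"
        "A' = (?g / ?a) powr ?a" "B' = (?h / (1 - ?a)) powr (1 - ?a)"
      assume *: "\<kappa>' * ((?a / ?g) powr ?a * ((1 - ?a) / ?h) powr (1 - ?a)) \<le> 1"
        "(?a / ?g) powr ?a * (?g / ?a) powr ?a = 1"
        "((1 - ?a) / ?h) powr (1 - ?a) * (?h / (1 - ?a)) powr (1 - ?a) = 1"
        "(?g / ?a) powr ?a * (?h / (1 - ?a)) powr (1 - ?a) \<le> ?g + ?h"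
      have "\<kappa>' = \<kappa>' * (A * B) * (A' * B')"
        using *(2,3) unfolding d[symmetric] by (metis mult.assoc mult.left_commute mult.right_neutral)
      also have "\<dots> \<le> 1 * (A' * B')" using *(1) unfolding d by (intro mult_right_mono) auto
      also have "\<dots> \<le> ?g + ?h" using *(4) by (simp add: d)
      finally show ?thesis .
    qed
    moreover have "?a powr ?a * exp (- ?a) \<le> 1 * 1"
      using \<alpha> by (intro mult_mono) (auto intro: powr_le1)
    then have "\<kappa>' * (?a powr ?a * exp (- ?a)) \<le> \<kappa>'" using \<kappa>' mult_left_mono[of "?a powr ?a * exp (- ?a)" 1 \<kappa>'] by simp
    ultimately show ?thesis by linarith
  next
    case False
    then obtain y where y: "y \<in> W'" by auto
    have xpos: "x u > 0" "z u > 0" if "u \<in> W'" for u using that xz by (auto simp: W'_def)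
    have g0: "coeff g 0 > 0"
    proof -
      have "gen C e b I W ((\<lambda>u. complex_of_real (x u))(v := 0)) ((\<lambda>u. of_real (z u))(v := 0)) \<noteq> 0"
        using y xpos W(2) by (intro stable) (force simp: W(1) less_imp_le)+
      then have "coeff g 0 \<noteq> 0" unfolding ev by (simp add: poly_0_coeff_0 coeff_map_poly)
      then show ?thesis using gnn[of 0] by simp
    qed
    have neg_roots: "poly (map_poly complex_of_real (g + Polynomial.smult t h)) s \<noteq> 0"
      if t: "t > 0" and s: "s \<notin> \<real>\<^sub>\<le>\<^sub>0" for t s
    proof -
      \<comment> \<open>The argument of \<omega> is minus half that of s, so both s and the positive
        reals are rotated into the open right half-plane.\<close>
      define \<omega> where "\<omega> = cnj s + of_real (norm s)"
      have rs: "Re s + norm s > 0"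
      proof (cases "Re s > 0")
        case True
        then show ?thesis by (simp add: add_pos_nonneg)
      next
        case False
        then have "Im s \<noteq> 0" using s by (auto simp: complex_nonpos_Reals_iff)
        then have "\<bar>Re s\<bar>\<^sup>2 < (norm s)\<^sup>2" by (simp add: cmod_power2)
        then have "\<bar>Re s\<bar> < norm s" by (rule power2_less_imp_less) simp
        then show ?thesis by linarith
      qed
      then have "s \<noteq> 0" by auto
      have "\<omega> * s = of_real (norm s) * of_real (norm s) + of_real (norm s) * s"
        unfolding \<omega>_def by (simp add: ring_distribs complex_norm_square[symmetric] power2_eq_square mult.commute)
      then have "Re (\<omega> * s) = norm s * (norm s + Re s)" by (simp add: ring_distribs)
      then have "Re (\<omega> * s) > 0" using rs \<open>s \<noteq> 0\<close> by simp
      moreover have "Re (\<omega> * of_real r) > 0" if "r > 0" for r using rs that by (simp add: \<omega>_def)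
      ultimately have "gen C e b I W ((\<lambda>u. complex_of_real (x u))(v := s)) ((\<lambda>u. of_real (z u))(v := of_real t)) \<noteq> 0"
        using W(2) xpos t v by (intro stable_rotated[of \<omega>]) (auto simp: W(1) less_imp_le)
      then show ?thesis
        unfolding ev by (simp add: map_poly_of_real_add map_poly_of_real_smult)
    qed
    have le_exp: "poly g s + t * poly h s \<le> (coeff g 0 + t * coeff h 0) *
        exp (s * (coeff g 1 + t * coeff h 1) / (coeff g 0 + t * coeff h 0))" if "s > 0" "t > 0" for s t
    proof -
      have "poly (g + Polynomial.smult t h) 0 > 0" using g0 h0 that by (simp add: poly_0_coeff_0 add_pos_pos)
      from poly_le_exp_of_negative_roots[OF this, of s] neg_roots that
      show ?thesis by (auto simp: poly_0_coeff_0)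
    qed
    have rayleigh: "coeff g 0 * coeff h 1 \<le> coeff g 1 * coeff h 0"
    proof (rule ccontr)
      assume neg: "\<not> ?thesis"
      \<comment> \<open>On the imaginary axis h(-s) is the conjugate of h(s), so Q has the imaginary
        part that controls -g/h; its linear coefficient is the difference claimed to be
        nonnegative.\<close>
      define Q where "Q = g * (h \<circ>\<^sub>p [:0, -1:])"
      have hm: "coeff (h \<circ>\<^sub>p [:0, -1:]) n = (-1) ^ n * coeff h n" for n
        by (rule coeff_pcompose_linear)
      have "coeff Q (Suc 0) = coeff g 1 * coeff h 0 - coeff g 0 * coeff h 1"
        unfolding Q_def coeff_mult by (simp add: hm)
      then have "coeff Q (Suc 0) < 0" using neg by simp
      from Im_poly_imaginary_neg[OF this] obtain \<eta> where \<eta>: "\<eta> > 0"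
        "Im (poly (map_poly complex_of_real Q) (\<i> * of_real \<eta>)) < 0" .
      let ?s = "\<i> * complex_of_real \<eta>"
      let ?G = "poly (map_poly complex_of_real g) ?s" and ?H = "poly (map_poly complex_of_real h) ?s"
      have "poly (map_poly complex_of_real (h \<circ>\<^sub>p [:0, -1:])) ?s = cnj ?H"
        by (simp add: poly_of_real_reflect cnj_poly_of_real)
      then have "Im (?G * cnj ?H) < 0"
        using \<eta>(2) by (simp add: Q_def map_poly_of_real_mult del: times_complex.sel)
      then have "?H \<noteq> 0" by auto
      define t where "t = - ?G / ?H"
      have "t = - (?G * cnj ?H) / of_real ((norm ?H)\<^sup>2)"
        unfolding t_def complex_norm_square using \<open>?H \<noteq> 0\<close> by simp
      then have "Im t = - Im (?G * cnj ?H) / (norm ?H)\<^sup>2"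
        by (metis Im_divide_of_real uminus_complex.sel(2))
      then have "Im t > 0" using \<open>Im (?G * cnj ?H) < 0\<close> \<open>?H \<noteq> 0\<close> by (simp add: divide_neg_pos del: times_complex.sel)
      \<comment> \<open>For a slope \<open>c\<close> this large, multiplication by 1 - ic brings
        \<open>t\<close>, the point \<open>?s\<close> and the positive reals into the right
        half-plane at once.\<close>
      define c where "c = (\<bar>Re t\<bar> + 1) / Im t"
      have c: "c > 0" "c * Im t = \<bar>Re t\<bar> + 1" using \<open>Im t > 0\<close> by (auto simp: c_def)
      define \<omega> where "\<omega> = Complex 1 (- c)"
      have "Re (\<omega> * t) > 0" using c by (simp add: \<omega>_def)
      moreover have "Re (\<omega> * ?s) > 0" using c \<eta>(1) by (simp add: \<omega>_def)
      moreover have "Re (\<omega> * of_real r) = r" for r by (simp add: \<omega>_def)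
      ultimately have "gen C e b I W ((\<lambda>u. complex_of_real (x u))(v := ?s)) ((\<lambda>u. of_real (z u))(v := t)) \<noteq> 0"
        using W(2) xpos v by (intro stable_rotated[of \<omega>]) (auto simp: W(1) less_imp_le simp del: times_complex.sel)
      then show False unfolding ev using \<open>?H \<noteq> 0\<close> by (simp add: t_def)
    qed
    show ?thesis
      using capacity_step_real[OF \<alpha> \<kappa>' g0 g1 h0 rayleigh] bound' le_exp by (meson order_trans)
  qed
  then show ?thesis unfolding I'_def[symmetric] W'_def[symmetric] goal by (simp add: \<kappa>'_def mult_ac)
qed

end

text \<open>\<kappa> absorbs the loss of each eliminated vertex. When no vertex is left,
  \<open>gen\<close> is just the sum of the weights of the surviving monomials.\<close>

lemma stable_family_capacity:
  fixes \<alpha> :: "'a \<Rightarrow> real" and \<kappa> :: real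
  assumes "stable_family C e b I W" and "\<And>v. v \<in> W \<Longrightarrow> 0 < \<alpha> v \<and> \<alpha> v < 1" and "\<kappa> \<ge> 0"
    and "\<And>x z :: 'a \<Rightarrow> real. (\<And>u. u \<in> W \<Longrightarrow> x u > 0 \<and> z u > 0) \<Longrightarrow>
      \<kappa> * (\<Prod>u\<in>W. x u powr \<alpha> u * z u powr (1 - \<alpha> u)) \<le> gen C e b I W x z"
  shows "\<kappa> * (\<Prod>v\<in>W. \<alpha> v powr \<alpha> v * exp (- \<alpha> v)) \<le> (\<Sum>i\<in>{i\<in>I. \<forall>v\<in>W. e i v + b i v = 1}. C i)"
proof -
  have "finite W" using assms(1) by (rule stable_family.finite_W)
  then show ?thesis using assms
  proof (induction W arbitrary: I \<kappa> rule: finite_induct)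
    case empty
    show ?case using empty(4)[of "\<lambda>_. 1" "\<lambda>_. 1"] by (simp add: gen_def)
  next
    case (insert v W)
    interpret stable_family C e b I "insert v W" by fact
    have ins: "insert v W - {v} = W" using insert by auto
    let ?I = "{i\<in>I. e i v + b i v = 1}"
    have "\<kappa> * (\<alpha> v powr \<alpha> v * exp (- \<alpha> v)) * (\<Prod>v\<in>W. \<alpha> v powr \<alpha> v * exp (- \<alpha> v))
      \<le> (\<Sum>i\<in>{i\<in>?I. \<forall>v\<in>W. e i v + b i v = 1}. C i)"
    proof (rule insert.IH)
      show "stable_family C e b ?I W" using eliminate[of v] ins by simp
      show "\<kappa> * (\<alpha> v powr \<alpha> v * exp (- \<alpha> v)) * (\<Prod>u\<in>W. x u powr \<alpha> u * z u powr (1 - \<alpha> u))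
          \<le> gen C e b ?I W x z" if "\<And>u. u \<in> W \<Longrightarrow> x u > 0 \<and> z u > 0" for x z
        using capacity_step[of v \<alpha> \<kappa> x z] insert.prems(2,3,4) that unfolding ins by auto
    qed (use insert.prems in auto)
    moreover have "{i\<in>?I. \<forall>v\<in>W. e i v + b i v = 1} = {i\<in>I. \<forall>u\<in>insert v W. e i u + b i u = 1}"
      by auto
    ultimately show ?case using insert.hyps by (simp add: mult_ac)
  qed
qed

text \<open>
  A map \<open>f\<close> records that vertex \<open>u\<close> is left uncovered (\<open>f u = None\<close>) or is followed by
  \<open>v\<close> (\<open>f u = Some v\<close>).
\<close>

definition choices :: "'a set \<Rightarrow> ('a \<Rightarrow> 'a option) set" where
  "choices V = (\<Pi>\<^sub>E u\<in>V. insert None (Some ` V))"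

definition choice_weight :: "('a \<Rightarrow> 'a \<Rightarrow> real) \<Rightarrow> 'a set \<Rightarrow> ('a \<Rightarrow> 'a option) \<Rightarrow> real" where
  "choice_weight B V f = (\<Prod>u\<in>V. case f u of None \<Rightarrow> 1 | Some v \<Rightarrow> B u v)"

definition times_chosen :: "'a set \<Rightarrow> ('a \<Rightarrow> 'a option) \<Rightarrow> 'a \<Rightarrow> nat" where
  "times_chosen V f v = card {u\<in>V. f u = Some v}"

definition uncovered :: "('a \<Rightarrow> 'a option) \<Rightarrow> 'a \<Rightarrow> nat" where
  "uncovered f v = (if f v = None then 1 else 0)"

text \<open>Expanding the product picks from each row u either z_u or one term with x_v; collecting
  the factors by column gives the exponents.\<close>

lemma gen_choices:
  assumes "finite V"
  shows "gen (choice_weight B V) (times_chosen V) uncovered (choices V) V x z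
    = (\<Prod>u\<in>V. z u + (\<Sum>v\<in>V. of_real (B u v) * x v))"
proof -
  define h where "h u j = (case j of None \<Rightarrow> z u | Some v \<Rightarrow> of_real (B u v) * x v)" for u j
  have sumh: "z u + (\<Sum>v\<in>V. of_real (B u v) * x v) = (\<Sum>j\<in>insert None (Some ` V). h u j)" for u
    using assms by (simp add: h_def sum.reindex)
  have weight_eq: "(\<Prod>u\<in>V. h u (f u)) = of_real (choice_weight B V f) *
      (\<Prod>v\<in>V. x v ^ times_chosen V f v * z v ^ uncovered f v)" if "f \<in> choices V" for f
  proof -
    have fV: "f u = None \<or> (\<exists>v\<in>V. f u = Some v)" if "u \<in> V" for u
      using \<open>f \<in> choices V\<close> that by (auto simp: choices_def PiE_iff)
    have "(\<Prod>v\<in>V. x v ^ times_chosen V f v) = (\<Prod>v\<in>V. \<Prod>u\<in>V. if f u = Some v then x v else 1)"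
      using assms by (simp add: times_chosen_def prod.If_cases Int_def)
    also have "\<dots> = (\<Prod>u\<in>V. \<Prod>v\<in>V. if f u = Some v then x v else 1)" by (rule prod.swap)
    also have "\<dots> = (\<Prod>u\<in>V. case f u of None \<Rightarrow> 1 | Some v \<Rightarrow> x v)"
      using fV assms by (intro prod.cong refl) (force split: option.splits)
    finally have "(\<Prod>v\<in>V. x v ^ times_chosen V f v * z v ^ uncovered f v)
        = (\<Prod>u\<in>V. (case f u of None \<Rightarrow> 1 | Some v \<Rightarrow> x v) * z u ^ uncovered f u)"
      by (simp add: prod.distrib)
    then show ?thesis
      by (simp add: choice_weight_def prod.distrib[symmetric] del: prod.distrib)
        (auto intro!: prod.cong simp: h_def uncovered_def split: option.splits)
  qed
  have "(\<Prod>u\<in>V. z u + (\<Sum>v\<in>V. of_real (B u v) * x v)) = (\<Sum>f\<in>choices V. \<Prod>u\<in>V. h u (f u))"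
    unfolding sumh choices_def using assms by (intro prod_sum_PiE) auto
  then show ?thesis by (simp add: weight_eq gen_def)
qed

text \<open>With all entries positive, a single x of positive real part makes the real part of every
  row positive. A zero entry could spoil this, which is why the entries are perturbed below.\<close>

lemma stable_family_choices:
  assumes V: "finite V" and B: "\<And>u v. u \<in> V \<Longrightarrow> v \<in> V \<Longrightarrow> B u v > 0"
  shows "stable_family (choice_weight B V) (times_chosen V) uncovered (choices V) V"
proof
  show "finite V" "finite (choices V)" using V by (auto simp: choices_def intro: finite_PiE)
  show "choice_weight B V f > 0" if "f \<in> choices V" for f
  proof -
    have "(case f u of None \<Rightarrow> 1 | Some v \<Rightarrow> B u v) > 0" if "u \<in> V" for u
      using \<open>f \<in> choices V\<close> that B by (force simp: choices_def PiE_iff split: option.splits)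
    then show ?thesis unfolding choice_weight_def by (rule prod_pos)
  qed
  show "uncovered f v \<le> 1" for f v by (simp add: uncovered_def)
  show "(\<Sum>v\<in>V. times_chosen V f v + uncovered f v) = card V" if "f \<in> choices V" for f
  proof -
    have fV: "f u = None \<or> (\<exists>v\<in>V. f u = Some v)" if "u \<in> V" for u
      using \<open>f \<in> choices V\<close> that by (auto simp: choices_def PiE_iff)
    have "(\<Sum>v\<in>V. times_chosen V f v) = (\<Sum>v\<in>V. \<Sum>u\<in>V. if f u = Some v then 1 else 0)"
      using V by (simp add: times_chosen_def sum.If_cases Int_def)
    also have "\<dots> = (\<Sum>u\<in>V. \<Sum>v\<in>V. if f u = Some v then 1 else 0)" by (rule sum.swap)
    also have "\<dots> = (\<Sum>u\<in>V. if f u = None then 0 else 1)"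
      using fV V by (intro sum.cong refl) force
    finally have "(\<Sum>v\<in>V. times_chosen V f v + uncovered f v)
        = (\<Sum>u\<in>V. (if f u = None then 0 else 1) + uncovered f u)" by (simp add: sum.distrib)
    also have "\<dots> = (\<Sum>u\<in>V. 1)" by (intro sum.cong) (auto simp: uncovered_def)
    finally show ?thesis by simp
  qed
  show "\<exists>f\<in>choices V. \<forall>v\<in>V. times_chosen V f v = 0 \<and> uncovered f v = 1"
    by (rule bexI[of _ "\<lambda>u\<in>V. None"]) (auto simp: choices_def times_chosen_def uncovered_def)
  show "\<exists>f\<in>choices V. times_chosen V f v = 1 \<and> uncovered f v = 0 \<and>
      (\<forall>u\<in>V-{v}. times_chosen V f u = 0 \<and> uncovered f u = 1)" if v: "v \<in> V" for v
  proof -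
    \<comment> \<open>The witness is a loop at \<open>v\<close>, admissible because diagonal entries
      are positive too.\<close>
    let ?f = "\<lambda>u\<in>V. if u = v then Some v else None"
    have "{u\<in>V. ?f u = Some y} = (if y = v then {v} else {})" for y using v by auto
    then show ?thesis
      by (intro bexI[of _ ?f]) (use v in \<open>auto simp: choices_def times_chosen_def uncovered_def\<close>)
  qed
  fix x z :: "'a \<Rightarrow> complex"
  assume xz: "\<And>v. v \<in> V \<Longrightarrow> 0 \<le> Re (x v) \<and> 0 \<le> Re (z v)" and "\<exists>v\<in>V. 0 < Re (x v)"
  then obtain y where y: "y \<in> V" "0 < Re (x y)" by auto
  have "z u + (\<Sum>v\<in>V. of_real (B u v) * x v) \<noteq> 0" if u: "u \<in> V" for u
  proof -
    have "(\<Sum>v\<in>V. B u v * Re (x v)) > 0"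
    proof (rule sum_pos2[OF V y(1)])
      show "0 < B u y * Re (x y)" using y B u by simp
      show "0 \<le> B u v * Re (x v)" if "v \<in> V" for v using B[OF u that] xz[OF that] by simp
    qed
    then have "Re (z u + (\<Sum>v\<in>V. of_real (B u v) * x v)) > 0"
      using xz[OF u] by (simp add: Re_sum)
    then show ?thesis by force
  qed
  then show "gen (choice_weight B V) (times_chosen V) uncovered (choices V) V x z \<noteq> 0"
    using V by (simp add: gen_choices prod_zero_iff)
qed

text \<open>For finite \<open>V\<close> this is the permanent of the identity plus \<open>B\<close>,
  expanded by the set of rows in which \<open>B\<close> is chosen.\<close>

definition cover_sum :: "'a set \<Rightarrow> ('a \<Rightarrow> 'a \<Rightarrow> 'c::comm_semiring_1) \<Rightarrow> 'c" where
  "cover_sum V B = (\<Sum>S\<in>Pow V. \<Sum>\<sigma> | \<sigma> permutes S. \<Prod>u\<in>S. B u (\<sigma> u))"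

text \<open>The condition says that an uncovered vertex is never entered and a covered one exactly
  once, so a choice is a permutation of its set of covered vertices.\<close>

lemma sum_choices_eq_cover_sum:
  assumes V: "finite V"
  shows "(\<Sum>f\<in>{f\<in>choices V. \<forall>v\<in>V. times_chosen V f v + uncovered f v = 1}. choice_weight B V f)
    = cover_sum V B"
proof -
  let ?F = "{f\<in>choices V. \<forall>v\<in>V. times_chosen V f v + uncovered f v = 1}"
  let ?P = "SIGMA S:Pow V. {\<sigma>. \<sigma> permutes S}"
  define S where "S f = {u\<in>V. f u \<noteq> None}" for f :: "'a \<Rightarrow> 'a option"
  define p where "p f u = (if u \<in> V \<and> f u \<noteq> None then the (f u) else u)" for f :: "'a \<Rightarrow> 'a option" and u
  define F where "F = (\<lambda>(S, \<sigma>). \<lambda>u\<in>V. if u \<in> S then Some (\<sigma> u) else (None :: 'a option))"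
  have perm: "p f permutes S f" if f: "f \<in> ?F" for f
  proof -
    have fV: "f u = None \<or> (\<exists>v\<in>V. f u = Some v)" if "u \<in> V" for u
      using f that by (auto simp: choices_def PiE_iff)
    have one: "times_chosen V f v + uncovered f v = 1" if "v \<in> V" for v using f that by auto
    have fin: "finite {u\<in>V. f u = Some v}" for v using V by simp
    have into: "p f u \<in> S f" if u: "u \<in> S f" for u
    proof -
      obtain v where v: "v \<in> V" "f u = Some v" using u fV[of u] by (auto simp: S_def)
      then have "times_chosen V f v > 0"
        using u fin unfolding times_chosen_def S_def by (subst card_gt_0_iff) auto
      then have "f v \<noteq> None" using one[OF v(1)] by (cases "f v") (auto simp: uncovered_def)
      then show ?thesis using u v by (simp add: S_def p_def)
    qed
    have "inj_on (p f) (S f)"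
    proof (rule inj_onI)
      fix u u' assume u: "u \<in> S f" "u' \<in> S f" "p f u = p f u'"
      obtain v where v: "v \<in> V" "f u = Some v" using u fV[of u] by (auto simp: S_def)
      then have "f u' = Some v" using u by (auto simp: S_def p_def)
      moreover have "card {u\<in>V. f u = Some v} \<le> 1" using one[OF v(1)] by (simp add: times_chosen_def)
      ultimately show "u = u'" using u v fin[of v]
        by (auto simp: card_le_Suc0_iff_eq S_def)
    qed
    moreover have "finite (S f)" using V by (simp add: S_def)
    ultimately have "bij_betw (p f) (S f) (S f)"
      using into by (simp add: bij_betw_def endo_inj_surj image_subsetI)
    then show ?thesis by (rule bij_imp_permutes) (auto simp: p_def S_def)
  qed
  have "cover_sum V B = (\<Sum>(S, \<sigma>)\<in>?P. \<Prod>u\<in>S. B u (\<sigma> u))"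
    unfolding cover_sum_def using V by (subst sum.Sigma) (auto intro: finite_permutations finite_subset)
  also have "\<dots> = (\<Sum>f\<in>?F. choice_weight B V f)"
  proof (rule sum.reindex_bij_witness[where i = "\<lambda>f. (S f, p f)" and j = F])
    fix a assume "a \<in> ?P"
    then obtain T \<sigma> where a: "a = (T, \<sigma>)" and T: "T \<subseteq> V" and \<sigma>: "\<sigma> permutes T" by auto
    have FT: "F (T, \<sigma>) u = (if u \<in> T then Some (\<sigma> u) else None)" if "u \<in> V" for u
      using that by (simp add: F_def)
    have "S (F a) = T" using T by (auto simp: S_def a FT split: if_splits)
    moreover have "p (F a) = \<sigma>"
    proof
      show "p (F a) u = \<sigma> u" for u
        using T permutes_not_in[OF \<sigma>, of u] by (auto simp: p_def a FT)
    qed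
    ultimately show "(S (F a), p (F a)) = a" by (simp add: a)
    have "times_chosen V (F a) v + uncovered (F a) v = 1" if v: "v \<in> V" for v
    proof -
      have "{u\<in>V. F a u = Some v} = (if v \<in> T then {inv_into UNIV \<sigma> v} else {})"
        using T \<sigma> by (auto simp: a FT permutes_in_image permutes_inverses permutes_inv
          split: if_splits dest: permutes_in_image[OF permutes_inv[OF \<sigma>], THEN iffD2])
      then show ?thesis using v by (auto simp: times_chosen_def uncovered_def a FT)
    qed
    moreover have "F a \<in> choices V"
    proof -
      have "\<sigma> u \<in> V" if "u \<in> T" for u using T permutes_in_image[OF \<sigma>] that by blast
      then show ?thesis by (auto simp: a F_def choices_def)
    qed
    ultimately show "F a \<in> ?F" by blast
    have "choice_weight B V (F a) = (\<Prod>u\<in>V. if u \<in> T then B u (\<sigma> u) else 1)"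
      unfolding choice_weight_def by (intro prod.cong) (auto simp: a FT)
    also have "\<dots> = (\<Prod>u\<in>T. B u (\<sigma> u))"
      using T V by (simp add: prod.If_cases Int_absorb1 flip: Int_def)
    finally show "choice_weight B V (F a) = (case a of (S, \<sigma>) \<Rightarrow> \<Prod>u\<in>S. B u (\<sigma> u))"
      by (simp add: a)
  next
    fix f assume f: "f \<in> ?F"
    show "(S f, p f) \<in> ?P" using perm[OF f] by (auto simp: S_def)
    show "F (S f, p f) = f"
    proof
      show "F (S f, p f) u = f u" for u
        using f by (cases "u \<in> V") (auto simp: F_def S_def p_def choices_def PiE_iff extensional_def)
    qed
  qed
  finally show ?thesis ..
qed

section \<open>Lower bound for the sum over permutations of vertex sets\<close>

text \<open>The inequality ln x <= x - 1 is applied to each \<open>t i\<close> divided by the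
  weighted mean; the right-hand sides add up to 0.\<close>

lemma weighted_am_gm:
  fixes t w :: "'i \<Rightarrow> real"
  assumes "finite J" "J \<noteq> {}" "\<And>i. i \<in> J \<Longrightarrow> t i > 0" "\<And>i. i \<in> J \<Longrightarrow> w i > 0" "sum w J = 1"
  shows "(\<Prod>i\<in>J. t i powr w i) \<le> (\<Sum>i\<in>J. w i * t i)"
proof -
  let ?y = "\<Sum>i\<in>J. w i * t i"
  have y: "?y > 0" using assms by (intro sum_pos) auto
  have "(\<Sum>i\<in>J. w i * ln (t i / ?y)) \<le> (\<Sum>i\<in>J. w i * (t i / ?y - 1))"
  proof (rule sum_mono)
    fix i assume i: "i \<in> J"
    have "t i / ?y > 0" using assms(3)[OF i] y by simp
    then show "w i * ln (t i / ?y) \<le> w i * (t i / ?y - 1)"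
      using assms(4)[OF i] ln_le_minus_one[of "t i / ?y"] by (intro mult_left_mono) auto
  qed
  also have "\<dots> = ?y / ?y - 1" by (simp add: sum_subtractf right_diff_distrib assms(5) flip: sum_divide_distrib)
  finally have le0: "(\<Sum>i\<in>J. w i * ln (t i / ?y)) \<le> 0" using y by simp
  have "(\<Sum>i\<in>J. w i * ln (t i / ?y)) = (\<Sum>i\<in>J. w i * ln (t i) - w i * ln ?y)"
  proof (rule sum.cong[OF refl])
    show "w i * ln (t i / ?y) = w i * ln (t i) - w i * ln ?y" if "i \<in> J" for i
      using assms(3)[OF that] y by (simp add: ln_div right_diff_distrib)
  qed
  also have "\<dots> = (\<Sum>i\<in>J. w i * ln (t i)) - ln ?y"
    by (simp add: sum_subtractf assms(5) flip: sum_distrib_right)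
  finally have "(\<Sum>i\<in>J. w i * ln (t i)) \<le> ln ?y" using le0 by linarith
  then have "exp (\<Sum>i\<in>J. w i * ln (t i)) \<le> ?y" using y by (metis exp_le_cancel_iff exp_ln)
  moreover have "exp (\<Sum>i\<in>J. w i * ln (t i)) = (\<Prod>i\<in>J. t i powr w i)"
    unfolding exp_sum[OF assms(1)]
  proof (rule prod.cong[OF refl])
    show "exp (w i * ln (t i)) = t i powr w i" if "i \<in> J" for i
      using assms(3)[OF that] by (simp add: powr_def)
  qed
  ultimately show ?thesis by simp
qed

text \<open>AM-GM in row u uses weight 1 / M for each arc and 1 - \<alpha> u for z_u. Over all rows
  x_v collects 1 / M per arc entering v, which is \<alpha> v because in- and outdegree agree. The
  rows contribute (a M) powr \<alpha> and elimination \<alpha> powr \<alpha> * exp (-\<alpha>);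
  since M \<alpha> = d, they combine to the stated factor.\<close>

lemma cover_sum_lower_bound_positive:
  fixes adj :: "'a \<Rightarrow> 'a \<Rightarrow> bool" and d :: "'a \<Rightarrow> nat" and a M \<epsilon> :: real
  assumes V: "finite V" and a: "a > 0" and \<epsilon>: "\<epsilon> > 0"
    and d: "\<And>v. v \<in> V \<Longrightarrow> card {u\<in>V. adj v u} = d v \<and> card {u\<in>V. adj u v} = d v \<and> 0 < d v \<and> real (d v) < M"
  shows "(\<Prod>v\<in>V. (a * real (d v) / exp 1) powr (real (d v) / M))
    \<le> cover_sum V (\<lambda>u v. (if adj u v then a else 0) + \<epsilon>)"
proof (cases "V = {}")
  case True
  then show ?thesis by (simp add: cover_sum_def)
next
  case False
  then have M: "M > 0" using d by force
  define \<alpha> where "\<alpha> v = real (d v) / M" for v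
  have \<alpha>: "0 < \<alpha> v" "\<alpha> v < 1" if "v \<in> V" for v using d[OF that] M by (auto simp: \<alpha>_def)
  let ?B = "\<lambda>u v. (if adj u v then a else 0) + \<epsilon>"
  let ?\<kappa> = "\<Prod>v\<in>V. (a * M) powr \<alpha> v"
  interpret stable_family "choice_weight ?B V" "times_chosen V" uncovered "choices V" V
    using V a \<epsilon> by (intro stable_family_choices) (auto simp: add_pos_pos)
  have row: "z u powr (1 - \<alpha> u) * (a * M) powr \<alpha> u * (\<Prod>v\<in>V. if adj u v then x v powr (1 / M) else 1)
      \<le> z u + (\<Sum>v\<in>V. ?B u v * x v)"
    if xz: "\<And>v. v \<in> V \<Longrightarrow> x v > 0 \<and> z v > 0" and u: "u \<in> V" for x z :: "'a \<Rightarrow> real" and u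
  proof -
    let ?N = "{v\<in>V. adj u v}"
    have N: "finite ?N" using V by simp
    let ?J = "insert None (Some ` ?N)"
    \<comment> \<open>Each term is divided by its weight in advance, so that the weighted sum
      restores the entries of the row.\<close>
    define t where "t j = (case j of None \<Rightarrow> z u / (1 - \<alpha> u) | Some v \<Rightarrow> a * M * x v)" for j
    define w where "w j = (case j of None \<Rightarrow> 1 - \<alpha> u | Some v \<Rightarrow> 1 / M)" for j :: "'a option"
    have split: "sum h ?J = h None + (\<Sum>v\<in>?N. h (Some v))" "prod h ?J = h None * (\<Prod>v\<in>?N. h (Some v))"
      for h :: "'a option \<Rightarrow> real"
      using N by (auto simp: sum.reindex prod.reindex)
    have "(\<Prod>j\<in>?J. t j powr w j) \<le> (\<Sum>j\<in>?J. w j * t j)"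
    proof (rule weighted_am_gm)
      show "sum w ?J = 1" unfolding split using d[OF u] by (simp add: w_def \<alpha>_def)
    qed (use N \<alpha>[OF u] xz u a M in \<open>auto simp: t_def w_def\<close>)
    moreover have "(\<Sum>j\<in>?J. w j * t j) = z u + (\<Sum>v\<in>?N. a * x v)"
      unfolding split using \<alpha>[OF u] M by (simp add: w_def t_def)
    moreover have "(\<Sum>v\<in>?N. a * x v) \<le> (\<Sum>v\<in>V. ?B u v * x v)"
    proof -
      have "(\<Sum>v\<in>?N. a * x v) = (\<Sum>v\<in>V. if adj u v then a * x v else 0)"
        using V by (simp add: sum.If_cases Int_def)
      also have "\<dots> \<le> (\<Sum>v\<in>V. ?B u v * x v)"
        using xz \<epsilon> by (intro sum_mono) (auto simp: distrib_right less_imp_le)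
      finally show ?thesis .
    qed
    moreover have "z u powr (1 - \<alpha> u) * (a * M) powr \<alpha> u * (\<Prod>v\<in>V. if adj u v then x v powr (1 / M) else 1)
        \<le> (\<Prod>j\<in>?J. t j powr w j)"
    proof -
      have "(\<Prod>v\<in>?N. t (Some v) powr w (Some v)) = (\<Prod>v\<in>?N. (a * M) powr (1 / M)) * (\<Prod>v\<in>?N. x v powr (1 / M))"
        using a M xz by (simp add: t_def w_def powr_mult prod.distrib less_imp_le)
      also have "(\<Prod>v\<in>?N. (a * M) powr (1 / M)) = (a * M) powr \<alpha> u"
        using d[OF u] a M by (simp add: \<alpha>_def powr_power)
      also have "(\<Prod>v\<in>?N. x v powr (1 / M)) = (\<Prod>v\<in>V. if adj u v then x v powr (1 / M) else 1)"
        using V by (simp add: prod.If_cases Int_def)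
      finally have eq: "(\<Prod>j\<in>?J. t j powr w j) = (z u / (1 - \<alpha> u)) powr (1 - \<alpha> u) *
          ((a * M) powr \<alpha> u * (\<Prod>v\<in>V. if adj u v then x v powr (1 / M) else 1))"
        unfolding split by (simp add: t_def w_def)
      \<comment> \<open>A factor (1 - \<alpha>) powr -(1 - \<alpha>), at least 1, is given away
        here.\<close>
      have "z u powr (1 - \<alpha> u) \<le> (z u / (1 - \<alpha> u)) powr (1 - \<alpha> u)"
        using \<alpha>[OF u] xz[OF u] by (intro powr_mono2) (auto simp: divide_simps)
      then show ?thesis unfolding eq mult.assoc
        by (intro mult_right_mono) (auto intro!: mult_nonneg_nonneg prod_nonneg)
    qed
    ultimately show ?thesis by linarith
  qed
  have "?\<kappa> * (\<Prod>u\<in>V. x u powr \<alpha> u * z u powr (1 - \<alpha> u))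
      \<le> gen (choice_weight ?B V) (times_chosen V) uncovered (choices V) V x z"
    if xz: "\<And>v. v \<in> V \<Longrightarrow> x v > 0 \<and> z v > 0" for x z :: "'a \<Rightarrow> real"
  proof -
    have "(\<Prod>u\<in>V. \<Prod>v\<in>V. if adj u v then x v powr (1 / M) else 1)
        = (\<Prod>v\<in>V. \<Prod>u\<in>V. if adj u v then x v powr (1 / M) else 1)" by (rule prod.swap)
    also have "\<dots> = (\<Prod>v\<in>V. x v powr \<alpha> v)"
    proof (rule prod.cong[OF refl])
      fix v assume v: "v \<in> V"
      have "(\<Prod>u\<in>V. if adj u v then x v powr (1 / M) else 1) = (x v powr (1 / M)) ^ d v"
        using V d[OF v] by (simp add: prod.If_cases Int_def)
      then show "(\<Prod>u\<in>V. if adj u v then x v powr (1 / M) else 1) = x v powr \<alpha> v"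
        using xz[OF v] by (simp add: \<alpha>_def powr_power)
    qed
    finally have eq: "(\<Prod>u\<in>V. \<Prod>v\<in>V. if adj u v then x v powr (1 / M) else 1) = (\<Prod>v\<in>V. x v powr \<alpha> v)" .
    have "(\<Prod>u\<in>V. z u powr (1 - \<alpha> u) * (a * M) powr \<alpha> u * (\<Prod>v\<in>V. if adj u v then x v powr (1 / M) else 1))
        \<le> (\<Prod>u\<in>V. z u + (\<Sum>v\<in>V. ?B u v * x v))"
      using row[OF xz] by (intro prod_mono) (auto intro!: mult_nonneg_nonneg prod_nonneg)
    then show ?thesis by (simp add: gen_choices[OF V] prod.distrib eq mult_ac)
  qed
  then have "?\<kappa> * (\<Prod>v\<in>V. \<alpha> v powr \<alpha> v * exp (- \<alpha> v)) \<le> cover_sum V ?B"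
    unfolding sum_choices_eq_cover_sum[OF V, symmetric] using \<alpha>
    by (intro stable_family_capacity[OF stable_family_axioms]) (auto intro: prod_nonneg)
  moreover have "?\<kappa> * (\<Prod>v\<in>V. \<alpha> v powr \<alpha> v * exp (- \<alpha> v)) = (\<Prod>v\<in>V. (a * real (d v) / exp 1) powr \<alpha> v)"
    unfolding prod.distrib[symmetric]
  proof (rule prod.cong[OF refl])
    fix v assume v: "v \<in> V"
    have "(a * real (d v) / exp 1) powr \<alpha> v = (a * M) powr \<alpha> v * \<alpha> v powr \<alpha> v / exp 1 powr \<alpha> v"
    proof -
      have "a * real (d v) = (a * M) * \<alpha> v" using M by (simp add: \<alpha>_def)
      then show ?thesis by (simp only: powr_divide powr_mult)
    qed
    then show "(a * M) powr \<alpha> v * (\<alpha> v powr \<alpha> v * exp (- \<alpha> v)) = (a * real (d v) / exp 1) powr \<alpha> v"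
      by (simp add: powr_def exp_minus divide_inverse)
  qed
  ultimately show ?thesis by (simp add: \<alpha>_def)
qed

text \<open>\<open>cover_sum\<close> is a polynomial in the entries and the bound does not involve
  \<epsilon>, so the perturbation can tend to 0.\<close>

lemma cover_sum_lower_bound:
  fixes adj :: "'a \<Rightarrow> 'a \<Rightarrow> bool" and d :: "'a \<Rightarrow> nat" and a M :: real
  assumes V: "finite V" and a: "a > 0"
    and d: "\<And>v. v \<in> V \<Longrightarrow> card {u\<in>V. adj v u} = d v \<and> card {u\<in>V. adj u v} = d v \<and> 0 < d v \<and> real (d v) < M"
  shows "(\<Prod>v\<in>V. (a * real (d v) / exp 1) powr (real (d v) / M))
    \<le> cover_sum V (\<lambda>u v. if adj u v then a else 0)"
proof (rule tendsto_lowerbound)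
  show "((\<lambda>\<epsilon>. cover_sum V (\<lambda>u v. (if adj u v then a else 0) + \<epsilon>)) \<longlongrightarrow>
      cover_sum V (\<lambda>u v. if adj u v then a else 0)) (at_right 0)"
    unfolding cover_sum_def by (auto intro!: tendsto_eq_intros)
  show "\<forall>\<^sub>F \<epsilon> in at_right 0. (\<Prod>v\<in>V. (a * real (d v) / exp 1) powr (real (d v) / M))
      \<le> cover_sum V (\<lambda>u v. (if adj u v then a else 0) + \<epsilon>)"
    using cover_sum_lower_bound_positive[OF V a _ d] eventually_at_right_less[of "0::real"]
    by (auto elim!: eventually_mono)
qed simp

section \<open>Hadamard's inequality and extraction of coefficients\<close>

lemma det_cnj: 
  assumes "A \<in> carrier_mat n n"
  shows "det (mat n n (\<lambda>(i, j). cnj (A $$ (j, i)))) = cnj (det A)"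
proof -
  have "mat n n (\<lambda>(i, j). cnj (A $$ (j, i))) = transpose_mat (mat n n (\<lambda>(i, j). cnj (A $$ (i, j))))"
    by (intro eq_matI) auto
  then have "det (mat n n (\<lambda>(i, j). cnj (A $$ (j, i)))) = det (mat n n (\<lambda>(i, j). cnj (A $$ (i, j))))"
    by (simp add: det_transpose[of _ n])
  also have "\<dots> = (\<Sum>p\<in>{p. p permutes {0..<n}}. signof p * (\<Prod>i=0..<n. cnj (A $$ (i, p i))))"
    by (subst det_def'[of _ n]) (auto intro!: sum.cong prod.cong simp: permutes_in_image)
  also have "\<dots> = cnj (det A)"
    by (simp add: det_def'[OF assms])
  finally show ?thesis .
qed

text \<open>
  The rows of index at least \<open>k\<close> are already orthonormal. In the induction step row \<open>k\<close> is
  replaced by the normalised conjugate of its vector of cofactors, which is orthogonal to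
  all other rows and maximises the determinant among all unit vectors.
\<close>

lemma hadamard_partially_orthonormal:
  fixes A :: "complex mat"
  assumes "A \<in> carrier_mat n n" "k \<le> n"
    and "\<And>i j. k \<le> i \<Longrightarrow> i < n \<Longrightarrow> j < n \<Longrightarrow>
      (\<Sum>l<n. A $$ (i, l) * cnj (A $$ (j, l))) = (if i = j then 1 else 0)"
  shows "(norm (det A))\<^sup>2 \<le> (\<Prod>i<k. \<Sum>l<n. (norm (A $$ (i, l)))\<^sup>2)"
  using assms
proof (induction k arbitrary: A)
  case 0
  \<comment> \<open>All rows are orthonormal, so \<open>A\<close> is unitary with inverse
    \<open>?B\<close> and its determinant has modulus 1.\<close>
  let ?B = "mat n n (\<lambda>(i, j). cnj (A $$ (j, i)))"
  have "A * ?B = 1\<^sub>m n"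
    using 0 by (intro eq_matI) (auto simp: scalar_prod_def simp flip: lessThan_atLeast0)
  then have "det A * cnj (det A) = 1"
    using det_mult[OF 0(1), of ?B] det_cnj[OF 0(1)] by simp
  then have "complex_of_real ((norm (det A))\<^sup>2) = 1" by (simp only: complex_norm_square)
  then show ?case using of_real_eq_1_iff by fastforce
next
  case (Suc k)
  then have k: "k < n" by simp
  define c where "c j = cofactor A k j" for j
  define N where "N = (\<Sum>j<n. (norm (c j))\<^sup>2)"
  have detA: "det A = (\<Sum>j<n. A $$ (k, j) * c j)"
    unfolding c_def by (rule laplace_expansion_row[OF Suc.prems(1) k])
  show ?case
  proof (cases "det A = 0")
    case True
    then show ?thesis by (simp add: prod_nonneg sum_nonneg)
  next
    case False
    have "\<exists>j<n. c j \<noteq> 0"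
    proof (rule ccontr)
      assume "\<not> ?thesis"
      then have "det A = 0" unfolding detA by (intro sum.neutral) auto
      then show False using False by simp
    qed
    then obtain j0 where "j0 < n" "c j0 \<noteq> 0" by blast
    then have N: "N > 0" unfolding N_def by (intro sum_pos2[of _ j0]) auto
    define A' where "A' = mat n n (\<lambda>(i, j). if i = k then cnj (c j) / of_real (sqrt N) else A $$ (i, j))"
    have A': "A' \<in> carrier_mat n n" by (simp add: A'_def)
    \<comment> \<open>These sums are off-diagonal entries of the product of \<open>A\<close> with
      its adjugate.\<close>
    have orth: "(\<Sum>j<n. A $$ (i, j) * c j) = 0" if "i < n" "i \<noteq> k" for i
    proof -
      have "(A * adj_mat A) $$ (i, k) = 0"
        using adj_mat(2)[OF Suc.prems(1)] that k by simp
      moreover have "(A * adj_mat A) $$ (i, k) = (\<Sum>j<n. A $$ (i, j) * c j)"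
        using that k Suc.prems(1)
        by (auto simp: adj_mat_def scalar_prod_def c_def simp flip: lessThan_atLeast0 intro!: sum.cong)
      ultimately show ?thesis by simp
    qed
    have NC: "(\<Sum>j<n. cnj (c j) * c j) = of_real N"
      by (simp only: N_def of_real_sum complex_norm_square) (simp add: mult.commute)
    have "mat_delete A' k j = mat_delete A k j" for j
      using Suc.prems(1) by (intro eq_matI) (auto simp: mat_delete_def A'_def)
    then have cof: "cofactor A' k j = c j" for j by (simp add: cofactor_def c_def)
    have "det A' = (\<Sum>j<n. A' $$ (k, j) * c j)"
      using laplace_expansion_row[OF A' k] cof by simp
    also have "\<dots> = (\<Sum>j<n. cnj (c j) * c j) / of_real (sqrt N)"
      using k by (simp add: A'_def sum_divide_distrib)
    also have "\<dots> = of_real (sqrt N)"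
      unfolding NC using N by (metis of_real_divide real_div_sqrt less_imp_le)
    finally have detA': "(norm (det A'))\<^sup>2 = N" using N by simp
    have "(norm (det A'))\<^sup>2 \<le> (\<Prod>i<k. \<Sum>l<n. (norm (A' $$ (i, l)))\<^sup>2)"
    proof (rule Suc.IH[OF A'])
      show "k \<le> n" using k by simp
      fix i j assume ij: "k \<le> i" "i < n" "j < n"
      have row: "(\<Sum>l<n. A' $$ (i, l) * cnj (A' $$ (k, l))) = (if i = k then 1 else 0)" if "i < n" for i
      proof (cases "i = k")
        case True
        have "(\<Sum>l<n. A' $$ (i, l) * cnj (A' $$ (k, l))) = (\<Sum>j<n. cnj (c j) * c j) / of_real N"
          using k True N by (auto simp: A'_def sum_divide_distrib mult.commute intro!: sum.cong simp flip: of_real_mult)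
        then show ?thesis using True N by (simp add: NC)
      next
        case neq: False
        have "(\<Sum>l<n. A' $$ (i, l) * cnj (A' $$ (k, l))) = (\<Sum>j<n. A $$ (i, j) * c j) / of_real (sqrt N)"
          using k neq that by (auto simp: A'_def sum_divide_distrib)
        then show ?thesis using orth[OF that neq] neq by simp
      qed
      show "(\<Sum>l<n. A' $$ (i, l) * cnj (A' $$ (j, l))) = (if i = j then 1 else 0)"
      proof -
        consider "j = k" | "i = k" "j \<noteq> k" | "i \<noteq> k" "j \<noteq> k" by blast
        then show ?thesis
        proof cases
          case 1
          then show ?thesis using row[OF ij(2)] by simp
        next
          case 2
          have "(\<Sum>l<n. A' $$ (k, l) * cnj (A' $$ (j, l))) = cnj (\<Sum>l<n. A' $$ (j, l) * cnj (A' $$ (k, l)))"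
            by (simp add: mult.commute)
          then show ?thesis using row[OF ij(3)] 2 by simp
        next
          case 3
          then have "(\<Sum>l<n. A' $$ (i, l) * cnj (A' $$ (j, l))) = (\<Sum>l<n. A $$ (i, l) * cnj (A $$ (j, l)))"
            using ij by (auto simp: A'_def)
          then show ?thesis using Suc.prems(3)[of i j] ij 3 by simp
        qed
      qed
    qed
    also have "(\<Prod>i<k. \<Sum>l<n. (norm (A' $$ (i, l)))\<^sup>2) = (\<Prod>i<k. \<Sum>l<n. (norm (A $$ (i, l)))\<^sup>2)"
      using k by (intro prod.cong sum.cong refl) (auto simp: A'_def)
    finally have IH: "N \<le> (\<Prod>i<k. \<Sum>l<n. (norm (A $$ (i, l)))\<^sup>2)" unfolding detA' .
    \<comment> \<open>Cauchy-Schwarz separates row \<open>k\<close> from the cofactor vector, whose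
      squared norm \<open>N\<close> is the squared modulus of \<open>det A'\<close> and so falls
      under the induction hypothesis.\<close>
    have "norm (det A) \<le> (\<Sum>j<n. norm (A $$ (k, j)) * norm (c j))"
      unfolding detA by (rule order_trans[OF norm_sum]) (simp add: norm_mult)
    then have "(norm (det A))\<^sup>2 \<le> (\<Sum>j<n. norm (A $$ (k, j)) * norm (c j))\<^sup>2"
      by (intro power_mono) auto
    also have "\<dots> \<le> (\<Sum>j<n. (norm (A $$ (k, j)))\<^sup>2) * N"
      unfolding N_def by (rule Cauchy_Schwarz_ineq_sum)
    also have "\<dots> \<le> (\<Sum>j<n. (norm (A $$ (k, j)))\<^sup>2) * (\<Prod>i<k. \<Sum>l<n. (norm (A $$ (i, l)))\<^sup>2)"
      using IH by (intro mult_left_mono sum_nonneg) auto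
    finally show ?thesis by (simp add: mult.commute)
  qed
qed

lemma hadamard_inequality:
  fixes A :: "complex mat"
  assumes "A \<in> carrier_mat n n"
  shows "(norm (det A))\<^sup>2 \<le> (\<Prod>i<n. \<Sum>l<n. (norm (A $$ (i, l)))\<^sup>2)"
  using assms by (intro hadamard_partially_orthonormal) auto

section \<open>Determinants over arbitrary finite index sets\<close>

text \<open>Indexing by a set and not by matrix positions makes principal minors over subsets of
  \<open>V \<times> K\<close> directly available.\<close>

definition det_on :: "'i set \<Rightarrow> ('i \<Rightarrow> 'i \<Rightarrow> 'c::comm_ring_1) \<Rightarrow> 'c" where
  "det_on S M = (\<Sum>p | p permutes S. of_int (sign p) * (\<Prod>i\<in>S. M i (p i)))"

lemma det_on_reindex:
  assumes "finite S" "inj_on f S"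
  shows "det_on (f ` S) M = det_on S (\<lambda>i j. M (f i) (f j))"
proof -
  have bij: "bij_betw f S (f ` S)" using assms by (simp add: bij_betw_def)
  have inv: "bij_betw (inv_into S f) (f ` S) S" by (rule bij_betw_inv_into[OF bij])
  show ?thesis
    unfolding det_on_def
  proof (rule sum.reindex_bij_witness[where i = "map_permutation S f" and j = "map_permutation (f ` S) (inv_into S f)"])
    fix p assume "p \<in> {p. p permutes f ` S}"
    then have p: "p permutes f ` S" by simp
    let ?q = "map_permutation (f ` S) (inv_into S f) p"
    show q: "?q \<in> {q. q permutes S}" using map_permutation_permutes[OF inv p] by simp
    show eq: "map_permutation S f ?q = p"
      by (rule map_permutation_compose_inv) (use p inv assms in \<open>auto simp: f_inv_into_f\<close>)
    have "sign ?q = sign p" using p assms inv by (intro sign_map_permutation) (auto simp: bij_betw_def)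
    moreover have "p (f i) = f (?q i)" if "i \<in> S" for i
      using map_permutation_apply[OF assms(2) that, of ?q] eq by simp
    ultimately show "of_int (sign ?q) * (\<Prod>i\<in>S. M (f i) (f (?q i))) = of_int (sign p) * (\<Prod>i\<in>f ` S. M i (p i))"
      using assms by (simp add: prod.reindex)
  next
    fix q assume "q \<in> {q. q permutes S}"
    then have q: "q permutes S" by simp
    show "map_permutation S f q \<in> {p. p permutes f ` S}" using map_permutation_permutes[OF bij q] by simp
    show "map_permutation (f ` S) (inv_into S f) (map_permutation S f q) = q"
      by (rule map_permutation_compose_inv) (use q bij assms in auto)
  qed
qed

lemma det_on_hadamard:
  fixes M :: "'i \<Rightarrow> 'i \<Rightarrow> complex"
  assumes "finite S"
  shows "(norm (det_on S M))\<^sup>2 \<le> (\<Prod>i\<in>S. \<Sum>j\<in>S. (norm (M i j))\<^sup>2)"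
proof -
  obtain f where f: "bij_betw f {0..<card S} S" using ex_bij_betw_nat_finite[OF assms] by blast
  then have S: "S = f ` {0..<card S}" and inj: "inj_on f {0..<card S}" by (auto simp: bij_betw_def)
  let ?n = "card S"
  let ?A = "mat ?n ?n (\<lambda>(i, j). M (f i) (f j))"
  have "det_on S M = det_on {0..<?n} (\<lambda>i j. M (f i) (f j))"
    by (subst S, rule det_on_reindex) (use inj in auto)
  also have "\<dots> = det ?A"
    unfolding det_on_def by (subst det_def'[of _ ?n]) (auto intro!: sum.cong prod.cong simp: permutes_in_image)
  finally have "(norm (det_on S M))\<^sup>2 \<le> (\<Prod>i<?n. \<Sum>l<?n. (norm (?A $$ (i, l)))\<^sup>2)"
    using hadamard_inequality[of ?A ?n] by simp
  also have "\<dots> = (\<Prod>i\<in>{0..<?n}. \<Sum>l\<in>{0..<?n}. (norm (M (f i) (f l)))\<^sup>2)"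
    by (auto intro!: prod.cong sum.cong)
  also have "\<dots> = (\<Prod>i\<in>{0..<?n}. \<Sum>j\<in>S. (norm (M (f i) j))\<^sup>2)"
    by (intro prod.cong refl sum.reindex_bij_betw[OF f])
  also have "\<dots> = (\<Prod>i\<in>S. \<Sum>j\<in>S. (norm (M i j))\<^sup>2)"
    by (rule prod.reindex_bij_betw[OF f])
  finally show ?thesis .
qed

text \<open>Choosing the identity entry in the rows outside \<open>T\<close> forces the permutation
  to fix them, so it is a permutation of \<open>T\<close> with the same sign.\<close>

lemma det_on_identity_plus:
  fixes X :: "'i \<Rightarrow> 'i \<Rightarrow> 'c::comm_ring_1"
  assumes U: "finite U"
  shows "det_on U (\<lambda>i j. X i j + (if i = j then 1 else 0)) = (\<Sum>T\<in>Pow U. det_on T X)"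
proof -
  have perms: "{p. p permutes U \<and> (\<forall>i\<in>U-T. p i = i)} = {p. p permutes T}" if "T \<subseteq> U" for T
  proof (intro Collect_cong iffI)
    fix p assume p: "p permutes U \<and> (\<forall>i\<in>U-T. p i = i)"
    then have "\<forall>x. x \<notin> T \<longrightarrow> p x = x" by (metis DiffI permutes_not_in)
    then show "p permutes T" using p by (simp add: permutes_def)
  next
    fix p assume "p permutes T"
    then show "p permutes U \<and> (\<forall>i\<in>U-T. p i = i)"
      using that permutes_subset permutes_not_in by (metis DiffD2)
  qed
  have "det_on U (\<lambda>i j. X i j + (if i = j then 1 else 0)) =
      (\<Sum>p | p permutes U. \<Sum>T\<in>Pow U. of_int (sign p) * ((\<Prod>i\<in>T. X i (p i)) * (\<Prod>i\<in>U-T. if i = p i then 1 else 0)))"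
    unfolding det_on_def by (simp add: prod_add[OF U] sum_distrib_left)
  also have "\<dots> = (\<Sum>T\<in>Pow U. \<Sum>p | p permutes U. of_int (sign p) * ((\<Prod>i\<in>T. X i (p i)) * (\<Prod>i\<in>U-T. if i = p i then 1 else 0)))"
    by (rule sum.swap)
  also have "\<dots> = (\<Sum>T\<in>Pow U. det_on T X)"
  proof (rule sum.cong[OF refl])
    fix T assume "T \<in> Pow U"
    then have T: "T \<subseteq> U" by simp
    have "(\<Prod>i\<in>U-T. if i = p i then 1 else 0 :: 'c) = (if \<forall>i\<in>U-T. p i = i then 1 else 0)" for p
      using U by (cases "\<forall>i\<in>U-T. p i = i") (auto intro!: prod.neutral prod_zero, metis DiffI)
    then have "(\<Sum>p | p permutes U. of_int (sign p) * ((\<Prod>i\<in>T. X i (p i)) * (\<Prod>i\<in>U-T. if i = p i then 1 else 0)))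
       = (\<Sum>p | p permutes U. if \<forall>i\<in>U-T. p i = i then of_int (sign p) * (\<Prod>i\<in>T. X i (p i)) else 0)"
      by (intro sum.cong) auto
    also have "\<dots> = (\<Sum>p | p permutes U \<and> (\<forall>i\<in>U-T. p i = i). of_int (sign p) * (\<Prod>i\<in>T. X i (p i)))"
      using finite_permutations[OF U] by (subst sum.inter_filter[symmetric]) auto
    finally show "(\<Sum>p | p permutes U. of_int (sign p) * ((\<Prod>i\<in>T. X i (p i)) * (\<Prod>i\<in>U-T. if i = p i then 1 else 0)))
        = det_on T X"
      unfolding det_on_def perms[OF T] .
  qed
  finally show ?thesis .
qed

section \<open>Extraction of low-degree terms by averaging\<close>

lemma sum_powers_root_of_unity:
  assumes "q > 0"
  defines "\<omega> \<equiv> exp (2 * of_real pi * \<i> / of_nat q)"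
  shows "(\<Sum>j<q. \<omega> ^ (j * l)) = (if q dvd l then of_nat q else 0)"
proof -
  have pow: "\<omega> ^ l = exp (2 * of_real pi * \<i> * of_nat l / of_nat q)" for l
    by (simp add: \<omega>_def exp_of_nat_mult[symmetric] mult_ac)
  have one: "\<omega> ^ l = 1 \<longleftrightarrow> q dvd l" for l
    unfolding pow using complex_root_unity_eq_1[of q l] assms(1) by simp
  have "(\<Sum>j<q. \<omega> ^ (j * l)) = (\<Sum>j<q. (\<omega> ^ l) ^ j)"
    by (intro sum.cong refl) (metis mult.commute power_mult)
  also have "\<dots> = (if q dvd l then of_nat q else 0)"
  proof (cases "q dvd l")
    case False
    have "(\<omega> ^ l) ^ q = 1" by (metis dvd_triv_right one power_mult)
    then show ?thesis using False one[of l] by (simp add: sum_gp_strict)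
  qed (use one[of l] in simp)
  finally show ?thesis .
qed

text \<open>Averaging against the kernel 1 + \<beta>\<zeta>, where \<beta> = a / \<rho>, keeps
  degrees 0 and 1 and evaluates them at a. The mean modulus of the kernel is bounded through its
  mean square 1 + \<beta>^2, which is cheaper than the obvious 1 + \<beta>: for small \<beta> the
  cost is of second order.\<close>

lemma circle_extraction:
  fixes K :: "'i \<Rightarrow> complex" and m :: "'i \<Rightarrow> nat" and a \<rho> B :: real
  assumes I: "finite I" and m: "\<And>i. i \<in> I \<Longrightarrow> m i \<le> N" and "\<rho> > 0" and "a \<ge> 0"
    and bound: "\<And>s. norm s = \<rho> \<Longrightarrow> norm (\<Sum>i\<in>I. K i * s ^ m i) \<le> B"
  shows "norm (\<Sum>i\<in>{i\<in>I. m i \<le> 1}. K i * of_real a ^ m i) \<le> B * sqrt (1 + (a / \<rho>)\<^sup>2)"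
proof -
  \<comment> \<open>\<open>q\<close> is at least 2 and so large that no degree from 2 to
    \<open>N\<close> is congruent to 0 or 1 modulo \<open>q\<close>.\<close>
  define q where "q = N + 2"
  define \<omega> where "\<omega> = exp (2 * of_real pi * \<i> / of_nat q)"
  define \<beta> where "\<beta> = a / \<rho>"
  have q: "q > 1" by (simp add: q_def)
  have \<omega>: "(\<Sum>j<q. \<omega> ^ (j * l)) = (if q dvd l then of_nat q else 0)" for l
    unfolding \<omega>_def using q by (intro sum_powers_root_of_unity) auto
  have norm_\<omega>: "norm \<omega> = 1" by (simp add: \<omega>_def)
  define f where "f s = (\<Sum>i\<in>I. K i * s ^ m i)" for s
  \<comment> \<open>The exponent \<open>q - 1\<close> stands for -1 modulo \<open>q\<close>, so this
    is the inverse of \<open>\<omega> ^ j\<close>.\<close>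
  define \<zeta> where "\<zeta> j = \<omega> ^ (j * (q - 1))" for j
  have pw: "\<omega> ^ (j * (l + (q - 1))) = \<omega> ^ (j * l) * \<zeta> j" for j l
    by (simp only: \<zeta>_def distrib_left power_add)
  have "(\<Sum>j<q. f (of_real \<rho> * \<omega> ^ j) * (1 + of_real \<beta> * \<zeta> j)) =
      (\<Sum>i\<in>I. K i * of_real \<rho> ^ m i * (\<Sum>j<q. \<omega> ^ (j * m i) + of_real \<beta> * \<omega> ^ (j * (m i + (q - 1)))))"
    unfolding f_def sum_distrib_left sum_distrib_right
    unfolding pw by (subst sum.swap) (intro sum.cong refl,
      simp add: power_mult_distrib ring_distribs mult_ac flip: power_mult)
  also have "\<dots> = (\<Sum>i\<in>I. if m i \<le> 1 then of_nat q * (K i * of_real a ^ m i) else 0)"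
  proof (rule sum.cong[OF refl])
    fix i assume i: "i \<in> I"
    have gs: "(\<Sum>j<q. \<omega> ^ (j * l) + of_real \<beta> * \<omega> ^ (j * l')) =
        (if q dvd l then of_nat q else 0) + of_real \<beta> * (if q dvd l' then of_nat q else 0)" for l l'
      by (simp only: sum.distrib \<omega> sum_distrib_left[symmetric])
    consider "m i = 0" | "m i = 1" | "m i \<ge> 2" by linarith
    then show "K i * of_real \<rho> ^ m i * (\<Sum>j<q. \<omega> ^ (j * m i) + of_real \<beta> * \<omega> ^ (j * (m i + (q - 1)))) =
        (if m i \<le> 1 then of_nat q * (K i * of_real a ^ m i) else 0)"
    proof cases
      case 1
      have "\<not> q dvd (q - 1)" using q by (auto dest: dvd_imp_le)
      then show ?thesis unfolding gs using 1 by simp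
    next
      case 2
      have "\<not> q dvd 1" using q by simp
      then show ?thesis unfolding gs using 2 q \<open>\<rho> > 0\<close> by (simp add: \<beta>_def)
    next
      case 3
      have "\<not> q dvd m i" using 3 m[OF i] by (auto simp: q_def dest: dvd_imp_le)
      moreover have "\<not> q dvd (m i + (q - 1))"
      proof
        assume "q dvd (m i + (q - 1))"
        moreover have "m i + (q - 1) = (m i - 1) + q" using 3 q by simp
        ultimately have "q dvd (m i - 1)" by (metis dvd_add_left_iff dvd_refl)
        then show False using 3 m[OF i] by (auto simp: q_def dest: dvd_imp_le)
      qed
      ultimately show ?thesis unfolding gs using 3 by simp
    qed
  qed
  also have "\<dots> = of_nat q * (\<Sum>i\<in>{i\<in>I. m i \<le> 1}. K i * of_real a ^ m i)"
    using I by (simp add: sum_distrib_left flip: sum.inter_filter)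
  finally have avg: "(\<Sum>j<q. f (of_real \<rho> * \<omega> ^ j) * (1 + of_real \<beta> * \<zeta> j)) =
      of_nat q * (\<Sum>i\<in>{i\<in>I. m i \<le> 1}. K i * of_real a ^ m i)" .
  have B: "norm (f (of_real \<rho> * \<omega> ^ j)) \<le> B" for j
    unfolding f_def using \<open>\<rho> > 0\<close> norm_\<omega> by (intro bound) (simp add: norm_mult norm_power)
  have "B \<ge> 0" using B[of 0] norm_ge_zero order_trans by blast
  have avg_kernel: "(\<Sum>j<q. 1 * norm (1 + of_real \<beta> * \<zeta> j)) \<le> real q * sqrt (1 + \<beta>\<^sup>2)"
  proof -
    have "(norm (1 + of_real \<beta> * \<zeta> j))\<^sup>2 = 1 + \<beta>\<^sup>2 + 2 * \<beta> * Re (\<zeta> j)" for j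
    proof -
      have "(Re (\<zeta> j))\<^sup>2 + (Im (\<zeta> j))\<^sup>2 = 1"
        using norm_\<omega> by (simp add: cmod_power2[symmetric] \<zeta>_def norm_power)
      then have "\<beta>\<^sup>2 * (Re (\<zeta> j))\<^sup>2 + \<beta>\<^sup>2 * (Im (\<zeta> j))\<^sup>2 = \<beta>\<^sup>2" by (metis distrib_left mult.right_neutral)
      then show ?thesis by (simp add: cmod_power2 power2_sum power_mult_distrib)
    qed
    moreover have "(\<Sum>j<q. Re (\<zeta> j)) = 0"
    proof -
      have "\<not> q dvd (q - 1)" using q by (auto dest: dvd_imp_le)
      then have "(\<Sum>j<q. \<zeta> j) = 0" unfolding \<zeta>_def \<omega> by simp
      then show ?thesis by (metis Re_sum zero_complex.sel(1))
    qed
    ultimately have sq: "(\<Sum>j<q. (norm (1 + of_real \<beta> * \<zeta> j))\<^sup>2) = real q * (1 + \<beta>\<^sup>2)"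
      by (simp add: sum.distrib ring_distribs flip: sum_distrib_left)
    have "(\<Sum>j<q. 1 * norm (1 + of_real \<beta> * \<zeta> j))\<^sup>2 \<le> (\<Sum>j<q. 1\<^sup>2) * (\<Sum>j<q. (norm (1 + of_real \<beta> * \<zeta> j))\<^sup>2)"
      by (rule Cauchy_Schwarz_ineq_sum)
    also have "\<dots> = (real q * sqrt (1 + \<beta>\<^sup>2))\<^sup>2"
      unfolding sq by (simp add: power_mult_distrib power2_eq_square)
    finally show ?thesis by (rule power2_le_imp_le) simp
  qed
  have "real q * norm (\<Sum>i\<in>{i\<in>I. m i \<le> 1}. K i * of_real a ^ m i) \<le>
      (\<Sum>j<q. norm (f (of_real \<rho> * \<omega> ^ j) * (1 + of_real \<beta> * \<zeta> j)))"
    using norm_sum[of "\<lambda>j. f (of_real \<rho> * \<omega> ^ j) * (1 + of_real \<beta> * \<zeta> j)" "{..<q}"]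
    unfolding avg by (simp add: norm_mult)
  also have "\<dots> \<le> (\<Sum>j<q. B * norm (1 + of_real \<beta> * \<zeta> j))"
    using B by (intro sum_mono) (simp add: norm_mult mult_right_mono)
  also have "\<dots> = B * (\<Sum>j<q. 1 * norm (1 + of_real \<beta> * \<zeta> j))" by (simp add: sum_distrib_left)
  also have "\<dots> \<le> B * (real q * sqrt (1 + \<beta>\<^sup>2))"
    by (rule mult_left_mono[OF avg_kernel \<open>B \<ge> 0\<close>])
  finally have "real q * norm (\<Sum>i\<in>{i\<in>I. m i \<le> 1}. K i * of_real a ^ m i) \<le> real q * (B * sqrt (1 + \<beta>\<^sup>2))"
    by (simp add: mult_ac)
  then show ?thesis using q by (simp add: \<beta>_def)
qed

text \<open>One variable is extracted while the others stay fixed on the torus; its power of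
  \<open>a\<close> moves into \<open>K\<close>, and the enlarged bound holds on the remaining
  torus.\<close>

lemma torus_extraction:
  fixes K :: "'i \<Rightarrow> complex" and m :: "'i \<Rightarrow> 'a \<Rightarrow> nat" and a \<rho> B :: real
  assumes "finite V" and "finite I" and "\<And>i v. i \<in> I \<Longrightarrow> m i v \<le> N" and "\<rho> > 0" and "a \<ge> 0"
    and "\<And>y. (\<And>v. v \<in> V \<Longrightarrow> norm (y v) = \<rho>) \<Longrightarrow> norm (\<Sum>i\<in>I. K i * (\<Prod>v\<in>V. y v ^ m i v)) \<le> B"
  shows "norm (\<Sum>i\<in>{i\<in>I. \<forall>v\<in>V. m i v \<le> 1}. K i * (\<Prod>v\<in>V. of_real a ^ m i v))
    \<le> B * sqrt (1 + (a / \<rho>)\<^sup>2) ^ card V"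
  using assms
proof (induction V arbitrary: I K B rule: finite_induct)
  case empty
  then show ?case by simp
next
  case (insert v V)
  let ?I = "{i\<in>I. m i v \<le> 1}"
  let ?K = "\<lambda>i. K i * of_real a ^ m i v"
  have "norm (\<Sum>i\<in>{i\<in>?I. \<forall>v\<in>V. m i v \<le> 1}. ?K i * (\<Prod>v\<in>V. of_real a ^ m i v))
    \<le> (B * sqrt (1 + (a / \<rho>)\<^sup>2)) * sqrt (1 + (a / \<rho>)\<^sup>2) ^ card V"
  proof (rule insert.IH)
    fix y :: "'a \<Rightarrow> complex" assume y: "\<And>v. v \<in> V \<Longrightarrow> norm (y v) = \<rho>"
    let ?L = "\<lambda>i. K i * (\<Prod>v\<in>V. y v ^ m i v)"
    have "norm (\<Sum>i\<in>I. ?L i * s ^ m i v) \<le> B" if s: "norm s = \<rho>" for s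
    proof -
      have "(\<Prod>u\<in>V. (y(v := s)) u ^ m i u) = (\<Prod>u\<in>V. y u ^ m i u)" for i
        using insert.hyps by (intro prod.cong) auto
      then have "(\<Sum>i\<in>I. ?L i * s ^ m i v) = (\<Sum>i\<in>I. K i * (\<Prod>u\<in>insert v V. (y(v := s)) u ^ m i u))"
        using insert.hyps by (simp add: mult_ac)
      moreover have "norm ((y(v := s)) u) = \<rho>" if "u \<in> insert v V" for u using y s that by auto
      ultimately show ?thesis using insert.prems(5)[of "y(v := s)"] by simp
    qed
    from circle_extraction[OF insert.prems(1) insert.prems(2) insert.prems(3,4) this]
    have "norm (\<Sum>i\<in>?I. ?L i * of_real a ^ m i v) \<le> B * sqrt (1 + (a / \<rho>)\<^sup>2)" by simp
    then show "norm (\<Sum>i\<in>?I. ?K i * (\<Prod>v\<in>V. y v ^ m i v)) \<le> B * sqrt (1 + (a / \<rho>)\<^sup>2)"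
      by (simp add: mult_ac)
  qed (use insert.prems in auto)
  moreover have "{i\<in>?I. \<forall>v\<in>V. m i v \<le> 1} = {i\<in>I. \<forall>u\<in>insert v V. m i u \<le> 1}" by auto
  ultimately show ?case using insert.hyps by (simp add: mult_ac)
qed

section \<open>The multilinear part of the characteristic determinant\<close>

lemma of_real_det_on: "of_real (det_on S M) = det_on S (\<lambda>i j. of_real (M i j) :: complex)"
  by (simp add: det_on_def)

text \<open>A set with at most one point over each vertex is the graph of a function on its
  projection.\<close>

lemma sum_over_sections:
  fixes h :: "('a \<times> 'k) set \<Rightarrow> 'c::comm_monoid_add"
  assumes "finite V" "finite K"
  shows "(\<Sum>T\<in>{T\<in>Pow (V \<times> K). \<forall>v\<in>V. card {e\<in>T. fst e = v} \<le> 1}. h T)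
    = (\<Sum>S\<in>Pow V. \<Sum>c\<in>(\<Pi>\<^sub>E v\<in>S. K). h ((\<lambda>v. (v, c v)) ` S))"
proof -
  let ?T = "{T\<in>Pow (V \<times> K). \<forall>v\<in>V. card {e\<in>T. fst e = v} \<le> 1}"
  let ?P = "SIGMA S:Pow V. (\<Pi>\<^sub>E v\<in>S. K)"
  define c where "c T = (\<lambda>v\<in>fst ` T. THE k. (v, k) \<in> T)" for T :: "('a \<times> 'k) set"
  have c: "c T v = k" if T: "T \<in> ?T" and vk: "(v, k) \<in> T" for T v k
  proof -
    have "finite {e\<in>T. fst e = v}"
      using T assms by (auto intro: finite_subset[OF _ finite_cartesian_product])
    then have "k' = k" if "(v, k') \<in> T" for k'
      using T vk that by (force simp: card_le_Suc0_iff_eq)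
    then have "(THE k. (v, k) \<in> T) = k" using vk by blast
    then show ?thesis using vk by (force simp: c_def)
  qed
  have "(\<Sum>S\<in>Pow V. \<Sum>c\<in>(\<Pi>\<^sub>E v\<in>S. K). h ((\<lambda>v. (v, c v)) ` S)) = (\<Sum>(S, c)\<in>?P. h ((\<lambda>v. (v, c v)) ` S))"
    using assms by (intro sum.Sigma) (auto intro!: finite_PiE intro: finite_subset)
  also have "\<dots> = (\<Sum>T\<in>?T. h T)"
  proof (rule sum.reindex_bij_witness[where i = "\<lambda>T. (fst ` T, c T)" and j = "\<lambda>(S, c). (\<lambda>v. (v, c v)) ` S"])
    fix p assume "p \<in> ?P"
    then obtain S f where p: "p = (S, f)" and S: "S \<subseteq> V" and f: "f \<in> (\<Pi>\<^sub>E v\<in>S. K)" by auto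
    let ?g = "(\<lambda>v. (v, f v)) ` S"
    have "{e \<in> ?g. fst e = v} \<subseteq> {(v, f v)}" for v by auto
    then have "card {e \<in> ?g. fst e = v} \<le> card {(v, f v)}" for v by (intro card_mono) auto
    then have g: "?g \<in> ?T" using S f by auto
    then show "(case p of (S, c) \<Rightarrow> (\<lambda>v. (v, c v)) ` S) \<in> ?T" by (simp add: p)
    have "fst ` ?g = S" by force
    moreover have "c ?g = f"
    proof
      show "c ?g v = f v" for v
        using c[OF g, of v "f v"] f by (cases "v \<in> S") (force simp: c_def)+
    qed
    ultimately show "(fst ` (case p of (S, c) \<Rightarrow> (\<lambda>v. (v, c v)) ` S), c (case p of (S, c) \<Rightarrow> (\<lambda>v. (v, c v)) ` S)) = p"
      by (simp add: p)
    show "h (case p of (S, c) \<Rightarrow> (\<lambda>v. (v, c v)) ` S) = (case p of (S, c) \<Rightarrow> h ((\<lambda>v. (v, c v)) ` S))"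
      by (simp add: p)
  next
    fix T assume T: "T \<in> ?T"
    have "c T \<in> (\<Pi>\<^sub>E v\<in>fst ` T. K)"
    proof (rule PiE_I)
      fix v assume "v \<in> fst ` T"
      then obtain k where "(v, k) \<in> T" by auto
      then show "c T v \<in> K" using c[OF T] T by auto
    qed (simp add: c_def)
    then show "(fst ` T, c T) \<in> ?P" using T by auto
    show "(case (fst ` T, c T) of (S, c) \<Rightarrow> (\<lambda>v. (v, c v)) ` S) = T"
      using c[OF T] by (force simp: image_iff)
  qed
  finally show ?thesis ..
qed

text \<open>The left-hand side is the part of det(I - Y N) of degree at most 1 in each y_v, taken at
  y_v = a. As the diagonal of \<open>N\<close> vanishes, rows have squared norm at most 1 + \<rho>^2
  d(u), with no term linear in \<rho>; then 1 + x <= exp x makes Hadamard's product an exponential,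
  and the square root halves its exponent.\<close>

lemma section_sum_bound:
  fixes N :: "'a \<times> 'k \<Rightarrow> 'a \<times> 'k \<Rightarrow> real" and d :: "'a \<Rightarrow> real" and a \<rho> :: real
  assumes V: "finite V" and K: "finite K" and \<rho>: "\<rho> > 0" and a: "a \<ge> 0"
    and diag: "\<And>u p q. N (u, p) (u, q) = 0"
    and row: "\<And>u p. u \<in> V \<Longrightarrow> p \<in> K \<Longrightarrow> (\<Sum>f\<in>V \<times> K. (N (u, p) f)\<^sup>2) \<le> d u"
  shows "\<bar>\<Sum>S\<in>Pow V. \<Sum>c\<in>(\<Pi>\<^sub>E v\<in>S. K). (- a) ^ card S * det_on S (\<lambda>u v. N (u, c u) (v, c v))\<bar>
    \<le> exp (\<rho>\<^sup>2 * real (card K) * (\<Sum>v\<in>V. d v) / 2) * sqrt (1 + (a / \<rho>)\<^sup>2) ^ card V"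
proof -
  let ?U = "V \<times> K"
  have U: "finite ?U" using V K by simp
  let ?N = "\<lambda>e f. complex_of_real (N e f)"
  define m where "m T v = card {e\<in>T. fst e = v}" for T :: "('a \<times> 'k) set" and v
  define L where "L T = (- 1) ^ card T * det_on T ?N" for T
  let ?B = "exp (\<rho>\<^sup>2 * real (card K) * (\<Sum>v\<in>V. d v) / 2)"
  have prod_m: "(\<Prod>e\<in>T. y (fst e)) = (\<Prod>v\<in>V. y v ^ m T v)" if "T \<subseteq> ?U" for T and y :: "'a \<Rightarrow> complex"
  proof -
    have "finite T" using that U by (rule finite_subset)
    then have "(\<Prod>v\<in>V. \<Prod>e\<in>{e\<in>T. fst e = v}. y (fst e)) = (\<Prod>e\<in>T. y (fst e))"
      using that V by (intro prod.group) auto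
    then show ?thesis by (simp add: m_def)
  qed
  have expand: "(\<Sum>T\<in>Pow ?U. L T * (\<Prod>v\<in>V. y v ^ m T v)) =
      det_on ?U (\<lambda>e f. - y (fst e) * ?N e f + (if e = f then 1 else 0))" for y
  proof -
    have "det_on T (\<lambda>e f. - y (fst e) * ?N e f) = L T * (\<Prod>v\<in>V. y v ^ m T v)" if "T \<subseteq> ?U" for T
    proof -
      have "(\<Prod>e\<in>T. - y (fst e)) = (- 1) ^ card T * (\<Prod>e\<in>T. y (fst e))"
        by (simp add: prod_uminus)
      then have "(\<Prod>e\<in>T. - y (fst e) * ?N e (p e)) =
          (- 1) ^ card T * (\<Prod>v\<in>V. y v ^ m T v) * (\<Prod>e\<in>T. ?N e (p e))" for p
        unfolding prod.distrib prod_m[OF that] by simp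
      then show ?thesis
        unfolding det_on_def L_def sum_distrib_left sum_distrib_right
        by (intro sum.cong refl) (simp add: mult_ac)
    qed
    then show ?thesis unfolding det_on_identity_plus[OF U] by (intro sum.cong) auto
  qed
  have "norm (\<Sum>T\<in>Pow ?U. L T * (\<Prod>v\<in>V. y v ^ m T v)) \<le> ?B"
    if y: "\<And>v. v \<in> V \<Longrightarrow> norm (y v) = \<rho>" for y
  proof -
    let ?M = "\<lambda>e f. - y (fst e) * ?N e f + (if e = f then 1 else 0)"
    have "(norm (det_on ?U ?M))\<^sup>2 \<le> (\<Prod>e\<in>?U. \<Sum>f\<in>?U. (norm (?M e f))\<^sup>2)"
      by (rule det_on_hadamard[OF U])
    also have "\<dots> \<le> (\<Prod>e\<in>?U. exp (\<rho>\<^sup>2 * d (fst e)))"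
    proof (intro prod_mono conjI)
      fix e assume e: "e \<in> ?U"
      then obtain u p where up: "e = (u, p)" "u \<in> V" "p \<in> K" by auto
      have "(norm (?M e f))\<^sup>2 = \<rho>\<^sup>2 * (N e f)\<^sup>2 + (if f = e then 1 else 0)" for f
        using y[OF up(2)] diag up(1) by (auto simp: norm_mult power_mult_distrib)
      then have "(\<Sum>f\<in>?U. (norm (?M e f))\<^sup>2) = \<rho>\<^sup>2 * (\<Sum>f\<in>?U. (N e f)\<^sup>2) + 1"
        using U e by (simp add: sum.distrib sum_distrib_left)
      also have "\<dots> \<le> \<rho>\<^sup>2 * d u + 1"
        using row[OF up(2,3)] by (simp add: up(1) mult_left_mono)
      also have "\<dots> \<le> exp (\<rho>\<^sup>2 * d (fst e))"
        using exp_ge_add_one_self[of "\<rho>\<^sup>2 * d u"] by (simp add: up(1) add.commute)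
      finally show "(\<Sum>f\<in>?U. (norm (?M e f))\<^sup>2) \<le> exp (\<rho>\<^sup>2 * d (fst e))" .
    qed (auto intro: sum_nonneg)
    also have "\<dots> = exp (\<Sum>e\<in>?U. \<rho>\<^sup>2 * d (fst e))" by (simp add: exp_sum U)
    also have "(\<Sum>e\<in>?U. \<rho>\<^sup>2 * d (fst e)) = \<rho>\<^sup>2 * real (card K) * (\<Sum>v\<in>V. d v)"
      by (simp add: sum.cartesian_product' sum_distrib_left sum_distrib_right mult_ac)
    also have "exp \<dots> = ?B\<^sup>2" by (simp add: exp_double[symmetric])
    finally have "norm (det_on ?U ?M) \<le> ?B" by (rule power2_le_imp_le) simp
    then show ?thesis by (simp only: expand)
  qed
  then have "norm (\<Sum>T\<in>{T\<in>Pow ?U. \<forall>v\<in>V. m T v \<le> 1}. L T * (\<Prod>v\<in>V. of_real a ^ m T v))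
      \<le> ?B * sqrt (1 + (a / \<rho>)\<^sup>2) ^ card V"
    using V U \<rho> a
    by (intro torus_extraction[where N = "card ?U"]) (auto simp: m_def intro!: card_mono order_trans[OF card_mono[of ?U]])
  also have "(\<Sum>T\<in>{T\<in>Pow ?U. \<forall>v\<in>V. m T v \<le> 1}. L T * (\<Prod>v\<in>V. of_real a ^ m T v)) =
      (\<Sum>T\<in>{T\<in>Pow ?U. \<forall>v\<in>V. m T v \<le> 1}. of_real (- a) ^ card T * det_on T ?N)"
  proof (rule sum.cong[OF refl])
    fix T assume "T \<in> {T\<in>Pow ?U. \<forall>v\<in>V. m T v \<le> 1}"
    then have "(\<Prod>e\<in>T. of_real a) = (\<Prod>v\<in>V. complex_of_real a ^ m T v)" using prod_m[of T "\<lambda>_. of_real a"] by simp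
    then show "L T * (\<Prod>v\<in>V. of_real a ^ m T v) = of_real (- a) ^ card T * det_on T ?N"
      by (simp add: L_def power_minus[of "complex_of_real a"] mult_ac)
  qed
  also have "\<dots> = (\<Sum>S\<in>Pow V. \<Sum>c\<in>(\<Pi>\<^sub>E v\<in>S. K). of_real (- a) ^ card ((\<lambda>v. (v, c v)) ` S) * det_on ((\<lambda>v. (v, c v)) ` S) ?N)"
    unfolding m_def by (rule sum_over_sections[OF V K])
  also have "\<dots> = of_real (\<Sum>S\<in>Pow V. \<Sum>c\<in>(\<Pi>\<^sub>E v\<in>S. K). (- a) ^ card S * det_on S (\<lambda>u v. N (u, c u) (v, c v)))"
    unfolding of_real_sum
  proof (intro sum.cong refl)
    fix S and c :: "'a \<Rightarrow> 'k" assume "S \<in> Pow V"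
    then have "finite S" using V finite_subset by auto
    moreover have inj: "inj_on (\<lambda>v. (v, c v)) S" by (rule inj_onI) auto
    ultimately show "of_real (- a) ^ card ((\<lambda>v. (v, c v)) ` S) * det_on ((\<lambda>v. (v, c v)) ` S) ?N
        = of_real ((- a) ^ card S * det_on S (\<lambda>u v. N (u, c u) (v, c v)))"
      by (simp add: det_on_reindex card_image of_real_det_on)
  qed
  finally show ?thesis by (simp only: norm_of_real)
qed

section \<open>Cycles of group-labelled digraphs\<close>

lemma sum_PiE_insert:
  assumes "x \<notin> S"
  shows "(\<Sum>c\<in>(\<Pi>\<^sub>E v\<in>insert x S. K). h c) = (\<Sum>q\<in>K. \<Sum>c\<in>(\<Pi>\<^sub>E v\<in>S. K). h (c(x := q)))"
proof -
  have "inj_on (\<lambda>(y, g). g(x := y)) (K \<times> (\<Pi>\<^sub>E v\<in>S. K))"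
    using inj_combinator[OF assms, of "\<lambda>_. K"] by simp
  then show ?thesis
    by (simp add: PiE_insert_eq sum.reindex o_def case_prod_unfold sum.cartesian_product)
qed

text \<open>The factors depend on disjoint sets of coordinates. This is what separates the cycles of
  a permutation.\<close>

lemma sum_PiE_union:
  fixes f g :: "('a \<Rightarrow> 'k) \<Rightarrow> 'c::comm_semiring_0"
  assumes disj: "A \<inter> B = {}"
    and f: "\<And>c c'. (\<And>v. v \<in> A \<Longrightarrow> c v = c' v) \<Longrightarrow> f c = f c'"
    and g: "\<And>c c'. (\<And>v. v \<in> B \<Longrightarrow> c v = c' v) \<Longrightarrow> g c = g c'"
  shows "(\<Sum>c\<in>(\<Pi>\<^sub>E v\<in>A \<union> B. K). f c * g c) = (\<Sum>c\<in>(\<Pi>\<^sub>E v\<in>A. K). f c) * (\<Sum>c\<in>(\<Pi>\<^sub>E v\<in>B. K). g c)"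
proof -
  let ?P = "(\<Pi>\<^sub>E v\<in>A. K) \<times> (\<Pi>\<^sub>E v\<in>B. K)"
  have "(\<Sum>c\<in>(\<Pi>\<^sub>E v\<in>A. K). f c) * (\<Sum>c\<in>(\<Pi>\<^sub>E v\<in>B. K). g c) = (\<Sum>(c, c')\<in>?P. f c * g c')"
    by (simp add: sum_product sum.cartesian_product)
  also have "\<dots> = (\<Sum>c\<in>(\<Pi>\<^sub>E v\<in>A \<union> B. K). f c * g c)"
  proof (rule sum.reindex_bij_witness[where i = "\<lambda>c. (restrict c A, restrict c B)"
        and j = "\<lambda>(c, c') v. if v \<in> A then c v else c' v"])
    fix p assume "p \<in> ?P"
    then obtain c c' where p: "p = (c, c')" "c \<in> (\<Pi>\<^sub>E v\<in>A. K)" "c' \<in> (\<Pi>\<^sub>E v\<in>B. K)" by auto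
    let ?c = "\<lambda>v. if v \<in> A then c v else c' v"
    have "restrict ?c A = c" using p by (auto simp: PiE_iff extensional_def)
    moreover have "restrict ?c B = c'"
    proof
      show "restrict ?c B v = c' v" for v using p disj by (auto simp: PiE_iff extensional_def)
    qed
    ultimately show "(restrict (case p of (c, c') \<Rightarrow> \<lambda>v. if v \<in> A then c v else c' v) A,
        restrict (case p of (c, c') \<Rightarrow> \<lambda>v. if v \<in> A then c v else c' v) B) = p"
      by (simp add: p)
    show "(case p of (c, c') \<Rightarrow> \<lambda>v. if v \<in> A then c v else c' v) \<in> (\<Pi>\<^sub>E v\<in>A \<union> B. K)"
      using p by (auto simp: PiE_iff extensional_def)
    have "f ?c = f c" by (rule f) simp
    moreover have "g ?c = g c'" using disj by (intro g) auto
    ultimately show "f (case p of (c, c') \<Rightarrow> \<lambda>v. if v \<in> A then c v else c' v) *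
        g (case p of (c, c') \<Rightarrow> \<lambda>v. if v \<in> A then c v else c' v) = (case p of (c, c') \<Rightarrow> f c * g c')"
      by (simp add: p)
  next
    fix c assume "c \<in> (\<Pi>\<^sub>E v\<in>A \<union> B. K)"
    then show "(case (restrict c A, restrict c B) of (c, c') \<Rightarrow> \<lambda>v. if v \<in> A then c v else c' v) = c"
      "(restrict c A, restrict c B) \<in> ?P"
      by (auto simp: PiE_iff extensional_def)
  qed
  finally show ?thesis ..
qed

text \<open>In this form the power cancels against (-1) ^ |S|, leaving one factor -1 per
  cycle.\<close>

lemma sign_cycle_of_list:
  assumes "distinct cs" "cs \<noteq> []"
  shows "sign (cycle_of_list cs) = - ((-1) ^ length cs)"
  using assms
proof (induction cs rule: cycle_of_list.induct)
  case (1 i j cs)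
  have "sign (cycle_of_list (i # j # cs)) = sign (Transposition.transpose i j) * sign (cycle_of_list (j # cs))"
    by (simp add: sign_compose permutation_of_cycle permutation_swap_id)
  then show ?case using 1 by (simp add: sign_swap_id o_def)
qed auto

text \<open>
  The kernel represents \<open>g\<close> in \<open>n\<close> copies of the regular representation minus one trivial
  representation: right translation, minus the projection onto constants.
\<close>

context group
begin

definition index_set :: "nat \<Rightarrow> ('a \<times> nat) set" where
  "index_set n = carrier G \<times> {..<n}"

definition translation_kernel :: "nat \<Rightarrow> 'a \<Rightarrow> 'a \<times> nat \<Rightarrow> 'a \<times> nat \<Rightarrow> real" where
  "translation_kernel n g p q =
    (if q = (fst p \<otimes> g, snd p) then 1 else 0) - 1 / real (card (index_set n))"

lemma card_index_set: "card (index_set n) = order G * n"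
  by (simp add: index_set_def card_cartesian_product order_def)

context
  fixes n :: nat
  assumes fin: "finite (carrier G)" and n: "n > 0"
begin

lemma finite_index_set: "finite (index_set n)"
  using fin by (simp add: index_set_def)

lemma card_index_set_pos: "real (card (index_set n)) > 0"
  using n fin order_gt_0_iff_finite by (simp add: card_index_set)

lemma sum_indicator_translate:
  assumes "p \<in> index_set n" "g \<in> carrier G"
  shows "(\<Sum>q\<in>index_set n. if q = (fst p \<otimes> g, snd p) then f q else 0) = f (fst p \<otimes> g, snd p)"
  using assms finite_index_set by (auto simp: index_set_def)

text \<open>With R for right translation and J for the projection onto constants, R J = J R = J J =
  J, so (R_g - J)(R_h - J) = R_gh - J.\<close>

lemma translation_kernel_mult:
  assumes g: "g \<in> carrier G" and h: "h \<in> carrier G" and p: "p \<in> index_set n" and r: "r \<in> index_set n"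
  shows "(\<Sum>q\<in>index_set n. translation_kernel n g p q * translation_kernel n h q r)
    = translation_kernel n (g \<otimes> h) p r"
proof -
  let ?c = "1 / real (card (index_set n))"
  let ?g = "\<lambda>q. if q = (fst p \<otimes> g, snd p) then 1 else 0 :: real"
  let ?h = "\<lambda>q. if r = (fst q \<otimes> h, snd q) then 1 else 0 :: real"
  have "(\<Sum>q\<in>index_set n. ?g q * ?h q) = ?h (fst p \<otimes> g, snd p)"
    using sum_indicator_translate[OF p g, of ?h] by (simp add: if_distrib[of "\<lambda>x. x * _"] cong: if_cong)
  moreover have "?h (fst p \<otimes> g, snd p) = (if r = (fst p \<otimes> (g \<otimes> h), snd p) then 1 else 0)"
  proof -
    have "fst p \<otimes> (g \<otimes> h) = fst p \<otimes> g \<otimes> h" using p g h by (auto simp: index_set_def m_assoc)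
    then show ?thesis by simp
  qed
  moreover have "(\<Sum>q\<in>index_set n. ?g q) = 1" by (rule sum_indicator_translate[OF p g])
  moreover have "(\<Sum>q\<in>index_set n. ?h q) = 1"
  proof -
    have "r = (fst q \<otimes> h, snd q) \<longleftrightarrow> q = (fst r \<otimes> inv h, snd r)" if "q \<in> index_set n" for q
      using that r h by (auto simp: index_set_def m_assoc)
    then have "(\<Sum>q\<in>index_set n. ?h q) = (\<Sum>q\<in>index_set n. if q = (fst r \<otimes> inv h, snd r) then 1 else 0)"
      by (intro sum.cong) auto
    then show ?thesis using sum_indicator_translate[OF r inv_closed[OF h], of "\<lambda>_. 1"] by simp
  qed
  moreover have "(\<Sum>q\<in>index_set n. translation_kernel n g p q * translation_kernel n h q r) =
      (\<Sum>q\<in>index_set n. ?g q * ?h q) - ?c * (\<Sum>q\<in>index_set n. ?g q) - ?c * (\<Sum>q\<in>index_set n. ?h q)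
        + real (card (index_set n)) * ?c * ?c"
  proof -
    have "(x - ?c) * (y - ?c) = x * y - ?c * x - ?c * y + ?c * ?c" for x y by (simp add: algebra_simps)
    then show ?thesis
      unfolding translation_kernel_def
      by (simp only: sum.distrib sum_subtractf sum_distrib_left[symmetric] sum_constant) simp
  qed
  ultimately show ?thesis using card_index_set_pos by (simp add: translation_kernel_def)
qed

text \<open>Translation by g has no fixed index unless g is the identity, and the projection has
  trace 1.\<close>

lemma translation_kernel_trace:
  assumes g: "g \<in> carrier G"
  shows "(\<Sum>p\<in>index_set n. translation_kernel n g p p) = (if g = \<one> then real (card (index_set n)) else 0) - 1"
proof -
  have "p = (fst p \<otimes> g, snd p) \<longleftrightarrow> g = \<one>" if "p \<in> index_set n" for p
    using that g r_cancel_one by (cases p) (auto simp: index_set_def)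
  then have "(\<Sum>p\<in>index_set n. translation_kernel n g p p) =
      (\<Sum>p\<in>index_set n. (if g = \<one> then 1 else 0) - 1 / real (card (index_set n)))"
    unfolding translation_kernel_def by (intro sum.cong) auto
  then show ?thesis using card_index_set_pos by (simp add: right_diff_distrib)
qed

text \<open>A row is a unit vector minus its mean, which only shortens it.\<close>

lemma translation_kernel_row:
  assumes p: "p \<in> index_set n" and g: "g \<in> carrier G"
  shows "(\<Sum>q\<in>index_set n. (translation_kernel n g p q)\<^sup>2) \<le> 1"
proof -
  let ?c = "1 / real (card (index_set n))"
  let ?g = "\<lambda>q. if q = (fst p \<otimes> g, snd p) then 1 else 0 :: real"
  have "(translation_kernel n g p q)\<^sup>2 = ?g q * (1 - 2 * ?c) + ?c * ?c" for q
    by (auto simp: translation_kernel_def power2_eq_square algebra_simps)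
  then have "(\<Sum>q\<in>index_set n. (translation_kernel n g p q)\<^sup>2) =
      (\<Sum>q\<in>index_set n. ?g q) * (1 - 2 * ?c) + real (card (index_set n)) * ?c * ?c"
    by (simp add: sum.distrib sum_distrib_right)
  also have "(\<Sum>q\<in>index_set n. ?g q) = 1" by (rule sum_indicator_translate[OF p g])
  also have "real (card (index_set n)) * ?c = 1" using card_index_set_pos by simp
  finally have "(\<Sum>q\<in>index_set n. (translation_kernel n g p q)\<^sup>2) = 1 - ?c" by simp
  then show ?thesis using card_index_set_pos by simp
qed

end

section \<open>Products of kernels along paths and cycles\<close>

fun path_label :: "('v \<Rightarrow> 'v \<Rightarrow> 'a) \<Rightarrow> 'v \<Rightarrow> 'v list \<Rightarrow> 'v \<Rightarrow> 'a" where
  "path_label W u [] v = W u v"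
| "path_label W u (x # xs) v = W u x \<otimes> path_label W x xs v"

text \<open>One summand of a matrix product along a path. The end indices \<open>p\<close> and
  \<open>r\<close> are separate arguments, so that \<open>c\<close> matters only at inner vertices
  and the product can be peeled from the front.\<close>

fun path_weight :: "nat \<Rightarrow> ('v \<Rightarrow> 'v \<Rightarrow> 'a) \<Rightarrow> ('v \<Rightarrow> 'a \<times> nat) \<Rightarrow> 'a \<times> nat \<Rightarrow> 'v \<Rightarrow> 'v list \<Rightarrow> 'v \<Rightarrow> 'a \<times> nat \<Rightarrow> real" where
  "path_weight n W c p u [] v r = translation_kernel n (W u v) p r"
| "path_weight n W c p u (x # xs) v r =
    translation_kernel n (W u x) p (c x) * path_weight n W c (c x) x xs v r"

lemma path_weight_cong:
  "(\<And>x. x \<in> set xs \<Longrightarrow> c x = c' x) \<Longrightarrow> path_weight n W c p u xs v r = path_weight n W c' p u xs v r"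
  by (induction xs arbitrary: p u) auto

lemma path_weight_eq_prod_list:
  "path_weight n W c (c u) u xs v (c v)
    = prod_list (map2 (\<lambda>x y. translation_kernel n (W x y) (c x) (c y)) (u # xs) (xs @ [v]))"
  by (induction xs arbitrary: u) auto

lemma path_label_closed:
  assumes "\<forall>(x, y)\<in>set (zip (u # xs) (xs @ [v])). W x y \<in> carrier G"
  shows "path_label W u xs v \<in> carrier G"
  using assms by (induction xs arbitrary: u) auto

text \<open>Summing over the index of an inner vertex is matrix multiplication, so the kernels along
  the path merge into the kernel of the product of labels.\<close>

lemma sum_path_weight:
  assumes "finite (carrier G)" "n > 0" "distinct xs" "p \<in> index_set n" "r \<in> index_set n"
    and "\<forall>(x, y)\<in>set (zip (u # xs) (xs @ [v])). W x y \<in> carrier G"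
  shows "(\<Sum>c\<in>(\<Pi>\<^sub>E x\<in>set xs. index_set n). path_weight n W c p u xs v r)
    = translation_kernel n (path_label W u xs v) p r"
  using assms(3-)
proof (induction xs arbitrary: p u)
  case (Cons x xs)
  have cong: "path_weight n W (c(x := q)) q x xs v r = path_weight n W c q x xs v r" for c q
    using Cons.prems(1) by (intro path_weight_cong) auto
  have "(\<Sum>c\<in>(\<Pi>\<^sub>E x\<in>set (x # xs). index_set n). path_weight n W c p u (x # xs) v r) =
      (\<Sum>q\<in>index_set n. \<Sum>c\<in>(\<Pi>\<^sub>E x\<in>set xs. index_set n). translation_kernel n (W u x) p q * path_weight n W c q x xs v r)"
    using Cons.prems(1) by (simp add: sum_PiE_insert cong)
  also have "\<dots> = (\<Sum>q\<in>index_set n. translation_kernel n (W u x) p q * translation_kernel n (path_label W x xs v) q r)"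
    unfolding sum_distrib_left[symmetric] using Cons by (intro sum.cong refl) auto
  also have "\<dots> = translation_kernel n (W u x \<otimes> path_label W x xs v) p r"
    using Cons.prems path_label_closed[of x xs v W] assms(1,2) by (intro translation_kernel_mult) auto
  finally show ?case by simp
qed auto

text \<open>Cut at \<open>v\<close>, the cycle becomes a path whose two end indices agree; the sum
  over this index is the trace.\<close>

lemma sum_cycle_weight:
  assumes "finite (carrier G)" "n > 0" "distinct (v # xs)"
    and W: "\<And>u. u \<in> set (v # xs) \<Longrightarrow> W u (cycle_of_list (v # xs) u) \<in> carrier G"
  defines "\<sigma> \<equiv> cycle_of_list (v # xs)"
  shows "(\<Sum>c\<in>(\<Pi>\<^sub>E u\<in>set (v # xs). index_set n).
      \<Prod>u\<in>set (v # xs). translation_kernel n (W u (\<sigma> u)) (c u) (c (\<sigma> u)))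
    = (if path_label W v xs v = \<one> then real (order G * n) else 0) - 1"
proof -
  let ?I = "index_set n"
  have rot: "map \<sigma> (v # xs) = xs @ [v]"
    using cyclic_rotation[OF assms(3), of 1] by (simp add: \<sigma>_def)
  have zip: "zip (v # xs) (xs @ [v]) = map (\<lambda>u. (u, \<sigma> u)) (v # xs)"
    unfolding rot[symmetric] by (simp add: zip_map2 zip_same_conv_map)
  have W': "\<forall>(x, y)\<in>set (zip (v # xs) (xs @ [v])). W x y \<in> carrier G"
    unfolding zip using W by (auto simp: \<sigma>_def)
  have "(\<Prod>u\<in>set (v # xs). translation_kernel n (W u (\<sigma> u)) (c u) (c (\<sigma> u))) = path_weight n W c (c v) v xs v (c v)" for c
    unfolding path_weight_eq_prod_list zip prod.distinct_set_conv_list[OF assms(3)] by (simp add: o_def)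
  then have "(\<Sum>c\<in>(\<Pi>\<^sub>E u\<in>set (v # xs). ?I).
      \<Prod>u\<in>set (v # xs). translation_kernel n (W u (\<sigma> u)) (c u) (c (\<sigma> u)))
    = (\<Sum>c\<in>(\<Pi>\<^sub>E u\<in>insert v (set xs). ?I). path_weight n W c (c v) v xs v (c v))"
    by simp
  also have "\<dots> = (\<Sum>p\<in>?I. \<Sum>c\<in>(\<Pi>\<^sub>E u\<in>set xs. ?I). path_weight n W (c(v := p)) p v xs v p)"
    using assms(3) by (subst sum_PiE_insert) auto
  also have "\<dots> = (\<Sum>p\<in>?I. \<Sum>c\<in>(\<Pi>\<^sub>E u\<in>set xs. ?I). path_weight n W c p v xs v p)"
    using assms(3) by (intro sum.cong refl path_weight_cong) auto
  also have "\<dots> = (\<Sum>p\<in>?I. translation_kernel n (path_label W v xs v) p p)"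
    using assms(1-3) W' by (intro sum.cong refl sum_path_weight) auto
  also have "\<dots> = (if path_label W v xs v = \<one> then real (order G * n) else 0) - 1"
    using translation_kernel_trace[OF assms(1,2) path_label_closed[OF W']] by (simp add: card_index_set)
  finally show ?thesis .
qed

end

section \<open>Vertex-based labels and the contribution of a single permutation\<close>

locale group_labelled_digraph = D: digraph D + \<Gamma>: group \<Gamma>
  for D :: "('a, 'b) pre_digraph" and \<Gamma> :: "('g, 'm) monoid_scheme" (structure) +
  fixes w :: "'b \<Rightarrow> 'g"
  assumes labels: "w \<in> arcs D \<rightarrow> carrier \<Gamma>" and finite_group: "finite (carrier \<Gamma>)"
begin

definition arc_between :: "'a \<Rightarrow> 'a \<Rightarrow> 'b" where
  "arc_between u v = (THE e. e \<in> arcs D \<and> tail D e = u \<and> head D e = v)"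

definition label :: "'a \<Rightarrow> 'a \<Rightarrow> 'g" where
  "label u v = w (arc_between u v)"

lemma arc_between:
  assumes "(u, v) \<in> arcs_ends D"
  shows "arc_between u v \<in> arcs D" "tail D (arc_between u v) = u" "head D (arc_between u v) = v"
proof -
  obtain e where e: "e \<in> arcs D" "tail D e = u" "head D e = v"
    using assms by (auto simp: arcs_ends_def arc_to_ends_def)
  then have "\<exists>!e. e \<in> arcs D \<and> tail D e = u \<and> head D e = v"
    using D.no_multi_arcs by (auto simp: arc_to_ends_def)
  from theI'[OF this] show "arc_between u v \<in> arcs D" "tail D (arc_between u v) = u" "head D (arc_between u v) = v"
    by (simp_all add: arc_between_def)
qed

lemma label_closed: "(u, v) \<in> arcs_ends D \<Longrightarrow> label u v \<in> carrier \<Gamma>"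
  using labels arc_between(1) by (auto simp: label_def)

lemma arc_list_of_vertex_list:
  assumes "\<forall>(x, y)\<in>set (zip (u # xs) (xs @ [v])). (x, y) \<in> arcs_ends D"
  defines "p \<equiv> map2 arc_between (u # xs) (xs @ [v])"
  shows "pre_digraph.awalk D u p v" "pre_digraph.awalk_verts D u p = u # xs @ [v]"
    "label_product \<Gamma> w p = \<Gamma>.path_label label u xs v" "tail D ` set p = set (u # xs)"
  using assms(1) unfolding p_def
proof (induction xs arbitrary: u)
  case Nil
  {
    case 1
    then show ?case using arc_between[of u v] by (auto simp: D.awalk_simps)
  next
    case 2
    then show ?case using arc_between[of u v] by simp
  next
    case 3
    then show ?case using label_closed[of u v] by (simp add: label_product_def label_def)
  next
    case 4
    then show ?case using arc_between[of u v] by simp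
  }
next
  case (Cons x xs)
  {
    case 1
    then show ?case using arc_between[of u x] Cons.IH(1)[of x] by (auto simp: D.awalk_simps)
  next
    case 2
    then show ?case using arc_between[of u x] Cons.IH(2)[of x] by simp
  next
    case 3
    then show ?case using Cons.IH(3)[of x] by (simp add: label_product_def label_def)
  next
    case 4
    then show ?case using arc_between[of u x] Cons.IH(4)[of x] by simp
  }
qed

lemma zero_sum_cycle_of_vertex_list:
  assumes "\<forall>(x, y)\<in>set (zip (v # xs) (xs @ [v])). (x, y) \<in> arcs_ends D"
    and "distinct (v # xs)" and "\<Gamma>.path_label label v xs v = \<one>"
  defines "p \<equiv> map2 arc_between (v # xs) (xs @ [v])"
  shows "zero_sum_cycle \<Gamma> D w p" "cycle_verts D p = set (v # xs)"
  using arc_list_of_vertex_list[OF assms(1)] assms(2,3) unfolding p_def[symmetric]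
  by (auto simp: zero_sum_cycle_def D.cycle_def cycle_verts_def p_def)

text \<open>The sum over \<open>c\<close> factors over the cycles of \<sigma>. With its sign each
  cycle contributes minus a trace: 1, or \<open>1 - order \<Gamma> * n\<close> if it is zero-sum.
  The family is chosen before \<open>n\<close>, since interpolation in \<open>n\<close> needs a
  fixed exponent.\<close>

lemma permutation_zero_sum_cycles:
  assumes "\<sigma> permutes S" "finite S" "\<And>u. u \<in> S \<Longrightarrow> (u, \<sigma> u) \<in> arcs_ends D"
  shows "\<exists>\<C>. finite \<C> \<and> (\<forall>C\<in>\<C>. zero_sum_cycle \<Gamma> D w C \<and> cycle_verts D C \<subseteq> S)
    \<and> pairwise (\<lambda>C C'. disjnt (cycle_verts D C) (cycle_verts D C')) \<C>
    \<and> (\<forall>n>0. (- 1) ^ card S * of_int (sign \<sigma>) * (\<Sum>c\<in>(\<Pi>\<^sub>E u\<in>S. \<Gamma>.index_set n).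
          \<Prod>u\<in>S. \<Gamma>.translation_kernel n (label u (\<sigma> u)) (c u) (c (\<sigma> u)))
        = (1 - real (order \<Gamma> * n)) ^ card \<C>)"
proof -
  let ?k = "\<lambda>n \<sigma> S c. \<Prod>u\<in>S. \<Gamma>.translation_kernel n (label u (\<sigma> u)) (c u) (c (\<sigma> u))"
  define good where "good S \<sigma> \<C> \<longleftrightarrow> finite \<C> \<and> (\<forall>C\<in>\<C>. zero_sum_cycle \<Gamma> D w C \<and> cycle_verts D C \<subseteq> S)
    \<and> pairwise (\<lambda>C C'. disjnt (cycle_verts D C) (cycle_verts D C')) \<C>
    \<and> (\<forall>n>0. (- 1) ^ card S * of_int (sign \<sigma>) * (\<Sum>c\<in>(\<Pi>\<^sub>E u\<in>S. \<Gamma>.index_set n). ?k n \<sigma> S c)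
        = (1 - real (order \<Gamma> * n)) ^ card \<C>)" for S \<sigma> \<C>
  have "cycle_decomp S \<sigma>" using assms(1,2) by (rule cycle_decomposition)
  then have "\<sigma> permutes S \<and> finite S \<and> ((\<forall>u\<in>S. (u, \<sigma> u) \<in> arcs_ends D) \<longrightarrow> (\<exists>\<C>. good S \<sigma> \<C>))"
  proof (induction rule: cycle_decomp.induct)
    case empty
    have "good {} id {}" by (simp add: good_def)
    then show ?case using permutes_id by blast
  next
    case (comp S \<sigma> cs)
    have cyc: "cycle_of_list cs permutes set cs" by (rule cycle_permutes)
    have \<sigma>: "\<sigma> permutes S" and S: "finite S" using comp.IH by auto
    let ?\<tau> = "cycle_of_list cs \<circ> \<sigma>"
    have on_cs: "?\<tau> u = cycle_of_list cs u" if "u \<in> set cs" for u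
    proof -
      have "u \<notin> S" using that comp.hyps(3) by blast
      then show ?thesis by (simp add: permutes_not_in[OF \<sigma>])
    qed
    have on_S: "?\<tau> u = \<sigma> u" if "u \<in> S" for u
      using that comp.hyps(3) permutes_in_image[OF \<sigma>, of u] id_outside_supp[of "\<sigma> u" cs] by auto
    have perm: "?\<tau> permutes set cs \<union> S"
      using permutes_subset[OF cyc, of "set cs \<union> S"] permutes_subset[OF \<sigma>, of "set cs \<union> S"]
      by (intro permutes_compose) auto
    moreover have "\<exists>\<C>. good (set cs \<union> S) ?\<tau> \<C>"
      if arcs: "\<forall>u\<in>set cs \<union> S. (u, ?\<tau> u) \<in> arcs_ends D"
    proof -
      have "\<forall>u\<in>S. (u, \<sigma> u) \<in> arcs_ends D" using arcs on_S by (metis UnCI)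
      then obtain \<C> where "good S \<sigma> \<C>" using comp.IH by blast
      then have \<C>: "finite \<C>" "\<And>C. C \<in> \<C> \<Longrightarrow> zero_sum_cycle \<Gamma> D w C \<and> cycle_verts D C \<subseteq> S"
        "pairwise (\<lambda>C C'. disjnt (cycle_verts D C) (cycle_verts D C')) \<C>"
        "\<And>n. n > 0 \<Longrightarrow> (- 1) ^ card S * of_int (sign \<sigma>) * (\<Sum>c\<in>(\<Pi>\<^sub>E u\<in>S. \<Gamma>.index_set n). ?k n \<sigma> S c)
          = (1 - real (order \<Gamma> * n)) ^ card \<C>"
        unfolding good_def by simp_all
      show ?thesis
      proof (cases cs)
        \<comment> \<open>The decomposition admits empty cycles, which change nothing.\<close>
        case Nil
        then have "?\<tau> = \<sigma>" "set cs \<union> S = S" by auto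
        then show ?thesis using \<open>good S \<sigma> \<C>\<close> by auto
      next
        case (Cons v xs)
        let ?z = "\<Gamma>.path_label label v xs v = \<one>"
        define p where "p = map2 arc_between (v # xs) (xs @ [v])"
        have dist: "distinct (v # xs)" using comp.hyps(2) Cons by simp
        have rot: "map (cycle_of_list cs) (v # xs) = xs @ [v]"
          using cyclic_rotation[OF comp.hyps(2), of 1] Cons by simp
        have cyc_arcs: "\<forall>u\<in>set cs. (u, cycle_of_list cs u) \<in> arcs_ends D" using arcs on_cs by (metis UnI1)
        have ends: "\<forall>(x, y)\<in>set (zip (v # xs) (xs @ [v])). (x, y) \<in> arcs_ends D"
          using cyc_arcs unfolding rot[symmetric] unfolding Cons
          by (simp add: zip_map2 zip_same_conv_map)
        have split: "(- 1) ^ card (set cs \<union> S) * of_int (sign ?\<tau>) *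
            (\<Sum>c\<in>(\<Pi>\<^sub>E u\<in>set cs \<union> S. \<Gamma>.index_set n). ?k n ?\<tau> (set cs \<union> S) c)
          = (if ?z then 1 - real (order \<Gamma> * n) else 1) * (1 - real (order \<Gamma> * n)) ^ card \<C>"
          if n: "n > 0" for n
        proof -
          have "(\<Sum>c\<in>(\<Pi>\<^sub>E u\<in>set cs \<union> S. \<Gamma>.index_set n). ?k n ?\<tau> (set cs \<union> S) c) =
              (\<Sum>c\<in>(\<Pi>\<^sub>E u\<in>set cs \<union> S. \<Gamma>.index_set n). ?k n (cycle_of_list cs) (set cs) c * ?k n \<sigma> S c)"
          proof (intro sum.cong refl)
            fix c
            have "?k n ?\<tau> (set cs \<union> S) c = ?k n ?\<tau> (set cs) c * ?k n ?\<tau> S c"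
              using comp.hyps(3) S by (intro prod.union_disjoint) auto
            moreover have "?k n ?\<tau> (set cs) c = ?k n (cycle_of_list cs) (set cs) c"
              using on_cs by (intro prod.cong) auto
            moreover have "?k n ?\<tau> S c = ?k n \<sigma> S c" using on_S by (intro prod.cong) auto
            ultimately show "?k n ?\<tau> (set cs \<union> S) c = ?k n (cycle_of_list cs) (set cs) c * ?k n \<sigma> S c"
              by simp
          qed
          also have "\<dots> = (\<Sum>c\<in>(\<Pi>\<^sub>E u\<in>set cs. \<Gamma>.index_set n). ?k n (cycle_of_list cs) (set cs) c) *
              (\<Sum>c\<in>(\<Pi>\<^sub>E u\<in>S. \<Gamma>.index_set n). ?k n \<sigma> S c)"
            using comp.hyps(3) permutes_in_image[OF cyc] permutes_in_image[OF \<sigma>]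
            by (intro sum_PiE_union prod.cong) auto
          also have "(\<Sum>c\<in>(\<Pi>\<^sub>E u\<in>set cs. \<Gamma>.index_set n). ?k n (cycle_of_list cs) (set cs) c)
              = (if ?z then real (order \<Gamma> * n) else 0) - 1"
          proof -
            have "label u (cycle_of_list (v # xs) u) \<in> carrier \<Gamma>" if "u \<in> set (v # xs)" for u
              using cyc_arcs that Cons by (intro label_closed) blast
            from \<Gamma>.sum_cycle_weight[where W = label, OF finite_group n dist this] show ?thesis using Cons by simp
          qed
          finally have sum: "(\<Sum>c\<in>(\<Pi>\<^sub>E u\<in>set cs \<union> S. \<Gamma>.index_set n). ?k n ?\<tau> (set cs \<union> S) c) =
              ((if ?z then real (order \<Gamma> * n) else 0) - 1) * (\<Sum>c\<in>(\<Pi>\<^sub>E u\<in>S. \<Gamma>.index_set n). ?k n \<sigma> S c)" .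
          have "card (set cs \<union> S) = length cs + card S"
            using comp.hyps S by (simp add: card_Un_disjoint distinct_card)
          moreover have "sign ?\<tau> = - ((- 1) ^ length cs) * sign \<sigma>"
            using sign_cycle_of_list[OF comp.hyps(2)] Cons
            by (simp add: sign_compose permutation_of_cycle permutes_imp_permutation[OF S \<sigma>] del: cycle_of_list.simps)
          \<comment> \<open>The length of the cycle cancels; the single sign left over turns the
            trace -1 into the contribution 1.\<close>
          ultimately have "(- 1) ^ card (set cs \<union> S) * of_int (sign ?\<tau>) = - ((- 1) ^ card S * real_of_int (sign \<sigma>))"
            by (simp add: power_add flip: power_mult_distrib)
          then show ?thesis unfolding sum using \<C>(4)[OF n] by (auto simp: algebra_simps)
        qed
        show ?thesis
        proof (cases ?z)
          case False
          have "good (set cs \<union> S) ?\<tau> \<C>"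
            unfolding good_def using \<C>(1-3) split False by auto
          then show ?thesis ..
        next
          case True
          note p = zero_sum_cycle_of_vertex_list[OF ends dist True, folded p_def]
          have sep: "disjnt (cycle_verts D p) (cycle_verts D C)" if "C \<in> \<C>" for C
            using \<C>(2)[OF that] comp.hyps(3) p(2) Cons by (auto simp: disjnt_def)
          \<comment> \<open>A cycle with a vertex is not disjoint from itself, so adding
            \<open>p\<close> really raises the cardinality.\<close>
          then have "p \<notin> \<C>" using p(2) by (force simp: disjnt_def)
          have "pairwise (\<lambda>C C'. disjnt (cycle_verts D C) (cycle_verts D C')) (insert p \<C>)"
            using \<C>(3) sep by (auto simp: pairwise_insert disjnt_sym)
          moreover have "\<forall>C\<in>insert p \<C>. zero_sum_cycle \<Gamma> D w C \<and> cycle_verts D C \<subseteq> set cs \<union> S"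
            using \<C>(2) p Cons by auto
          ultimately have "good (set cs \<union> S) ?\<tau> (insert p \<C>)"
            unfolding good_def using \<C>(1) split True \<open>p \<notin> \<C>\<close> by simp
          then show ?thesis ..
        qed
      qed
    qed
    moreover have "finite (set cs \<union> S)" using S by simp
    ultimately show ?case by blast
  qed
  then show ?thesis using assms(3) unfolding good_def by simp
qed

end

section \<open>Interpolation by finite differences\<close>

text \<open>This is an r-fold finite difference: p(x) - p(x + 1) has smaller degree, and Pascal's
  rule splits one difference off the sum.\<close>

lemma alternating_binomial_sum_poly:
  fixes p :: "'c::idom poly"
  assumes "p = 0 \<or> degree p < r"
  shows "(\<Sum>j\<le>r. (- 1) ^ j * of_nat (r choose j) * poly p (of_nat j)) = 0"
  using assms
proof (induction r arbitrary: p)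
  case 0
  then show ?case by simp
next
  case (Suc r)
  define q where "q = p - p \<circ>\<^sub>p [:1, 1:]"
  have q: "q = 0 \<or> degree q < r"
  proof (cases "p = 0 \<or> degree p = 0")
    case True
    then have "q = 0" by (auto simp: q_def elim!: degree_eq_zeroE)
    then show ?thesis by simp
  next
    case False
    have deg: "degree (p \<circ>\<^sub>p [:1, 1:]) = degree p" by (simp add: degree_pcompose)
    have "coeff (p \<circ>\<^sub>p [:1, 1:]) (degree p) = lead_coeff p"
      using lead_coeff_comp[of "[:1, 1 :: 'c:]" p] deg by simp
    then have "coeff q (degree p) = 0" by (simp add: q_def)
    moreover have "degree q \<le> degree p" unfolding q_def using deg by (intro degree_diff_le) auto
    ultimately have "degree q < degree p" using False
      by (metis le_neq_implies_less leading_coeff_0_iff degree_0 not_gr_zero)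
    then show ?thesis using Suc.prems False by auto
  qed
  let ?f = "\<lambda>j. poly p (of_nat j)"
  have "(\<Sum>j\<le>Suc r. (- 1) ^ j * of_nat (Suc r choose j) * ?f j) =
      ?f 0 + (\<Sum>j\<le>r. (- 1) ^ Suc j * of_nat (r choose Suc j) * ?f (Suc j))
        - (\<Sum>j\<le>r. (- 1) ^ j * of_nat (r choose j) * ?f (Suc j))"
    by (subst sum.atMost_Suc_shift) (simp add: sum.distrib ring_distribs sum_negf sum_subtractf algebra_simps)
  also have "?f 0 + (\<Sum>j\<le>r. (- 1) ^ Suc j * of_nat (r choose Suc j) * ?f (Suc j)) =
      (\<Sum>j\<le>Suc r. (- 1) ^ j * of_nat (r choose j) * ?f j)"
    by (subst sum.atMost_Suc_shift) simp
  also have "\<dots> = (\<Sum>j\<le>r. (- 1) ^ j * of_nat (r choose j) * ?f j)"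
    by (simp add: binomial_eq_0)
  also have "\<dots> - (\<Sum>j\<le>r. (- 1) ^ j * of_nat (r choose j) * ?f (Suc j)) =
      (\<Sum>j\<le>r. (- 1) ^ j * of_nat (r choose j) * poly q (of_nat j))"
    by (simp add: q_def poly_pcompose sum_subtractf ring_distribs)
  also have "\<dots> = 0" by (rule Suc.IH[OF q])
  finally show ?case .
qed

text \<open>The term j = 0 equals 1 and is moved to the right, because the kernels require at least
  one copy of the regular representation.\<close>

lemma alternating_binomial_sum_power:
  fixes k :: real
  assumes "z < r"
  shows "(\<Sum>j=1..r. (- 1) ^ j * real (r choose j) * (1 - k * real j) ^ z) = - 1"
proof -
  let ?p = "[:1, - k:] ^ z"
  have "degree ?p \<le> z" using degree_power_le[of "[:1, - k:]" z] by (simp split: if_splits)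
  then have "(\<Sum>j\<le>r. (- 1) ^ j * real (r choose j) * poly ?p (real j)) = 0"
    using assms alternating_binomial_sum_poly[of ?p r] by simp
  moreover have "poly ?p (real j) = (1 - k * real j) ^ z" for j by (simp add: mult.commute)
  moreover have "{..r} = insert 0 {1..r}" by auto
  ultimately show ?thesis by simp
qed

section \<open>Upper bound under the assumption of few disjoint zero-sum cycles\<close>

context group_labelled_digraph
begin

lemma cover_sum_upper_bound:
  fixes a \<rho> :: real and r :: nat
  assumes \<rho>: "\<rho> > 0" and a: "a \<ge> 0"
    and few: "\<And>\<C>. finite \<C> \<Longrightarrow> (\<forall>C\<in>\<C>. zero_sum_cycle \<Gamma> D w C) \<Longrightarrow>
      pairwise (\<lambda>C C'. disjnt (cycle_verts D C) (cycle_verts D C')) \<C> \<Longrightarrow> card \<C> < r"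
  shows "cover_sum (verts D) (\<lambda>u v. if (u, v) \<in> arcs_ends D then a else 0) \<le>
    2 ^ r * (exp (\<rho>\<^sup>2 * real (order \<Gamma> * r) * (\<Sum>v\<in>verts D. real (card {u\<in>verts D. (v, u) \<in> arcs_ends D})) / 2)
      * sqrt (1 + (a / \<rho>)\<^sup>2) ^ card (verts D))"
proof -
  let ?V = "verts D"
  let ?d = "\<lambda>v. real (card {u\<in>?V. (v, u) \<in> arcs_ends D})"
  let ?m = "\<Sum>v\<in>?V. ?d v"
  define B where "B = exp (\<rho>\<^sup>2 * real (order \<Gamma> * r) * ?m / 2) * sqrt (1 + (a / \<rho>)\<^sup>2) ^ card ?V"
  define P where "P S = {\<sigma>. \<sigma> permutes S \<and> (\<forall>u\<in>S. (u, \<sigma> u) \<in> arcs_ends D)}" for S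
  have fin: "finite ?V" by (rule D.finite_verts)
  have finS: "finite S" if "S \<in> Pow ?V" for S using that finite_subset[OF _ fin] by blast
  \<comment> \<open>Of the family of cycles only its size is kept, together with the identity valid
    for all \<open>n\<close> simultaneously.\<close>
  define Q where "Q S \<sigma> z \<longleftrightarrow> z < r \<and> (\<forall>n>0. (- 1) ^ card S * of_int (sign \<sigma>) * (\<Sum>c\<in>(\<Pi>\<^sub>E u\<in>S. \<Gamma>.index_set n).
          \<Prod>u\<in>S. \<Gamma>.translation_kernel n (label u (\<sigma> u)) (c u) (c (\<sigma> u)))
        = (1 - real (order \<Gamma>) * real n) ^ z)" for S \<sigma> z
  have ex: "\<exists>z. Q S \<sigma> z" if "S \<in> Pow ?V" "\<sigma> \<in> P S" for S \<sigma>
  proof -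
    have "\<sigma> permutes S" "\<And>u. u \<in> S \<Longrightarrow> (u, \<sigma> u) \<in> arcs_ends D" using that(2) by (auto simp: P_def)
    from permutation_zero_sum_cycles[OF this(1) finS[OF that(1)] this(2)]
    obtain \<C> where \<C>: "finite \<C>" "\<forall>C\<in>\<C>. zero_sum_cycle \<Gamma> D w C"
      "pairwise (\<lambda>C C'. disjnt (cycle_verts D C) (cycle_verts D C')) \<C>"
      "\<forall>n>0. (- 1) ^ card S * of_int (sign \<sigma>) * (\<Sum>c\<in>(\<Pi>\<^sub>E u\<in>S. \<Gamma>.index_set n).
          \<Prod>u\<in>S. \<Gamma>.translation_kernel n (label u (\<sigma> u)) (c u) (c (\<sigma> u)))
        = (1 - real (order \<Gamma> * n)) ^ card \<C>" by blast
    then show ?thesis using few[OF \<C>(1-3)] unfolding Q_def by (intro exI[of _ "card \<C>"]) simp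
  qed
  define z where "z S \<sigma> = (SOME z. Q S \<sigma> z)" for S \<sigma>
  have "Q S \<sigma> (z S \<sigma>)" if "S \<in> Pow ?V" "\<sigma> \<in> P S" for S \<sigma>
    unfolding z_def by (rule someI_ex[OF ex[OF that]])
  then have z: "\<And>S \<sigma>. S \<in> Pow ?V \<Longrightarrow> \<sigma> \<in> P S \<Longrightarrow> z S \<sigma> < r"
    "\<And>S \<sigma> n. S \<in> Pow ?V \<Longrightarrow> \<sigma> \<in> P S \<Longrightarrow> n > 0 \<Longrightarrow>
      (- 1) ^ card S * of_int (sign \<sigma>) * (\<Sum>c\<in>(\<Pi>\<^sub>E u\<in>S. \<Gamma>.index_set n).
          \<Prod>u\<in>S. \<Gamma>.translation_kernel n (label u (\<sigma> u)) (c u) (c (\<sigma> u)))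
        = (1 - real (order \<Gamma>) * real n) ^ z S \<sigma>"
    by (simp_all only: Q_def)
  \<comment> \<open>Kernels sit in the blocks of arcs. Diagonal blocks vanish because there are no
    loops, and a row over u has squared norm at most the outdegree of u.\<close>
  define N where "N n e f = (if (fst e, fst f) \<in> arcs_ends D
      then \<Gamma>.translation_kernel n (label (fst e) (fst f)) (snd e) (snd f) else 0)" for n e f
  define p where "p n = (\<Sum>S\<in>Pow ?V. \<Sum>\<sigma>\<in>P S. a ^ card S * (1 - real (order \<Gamma>) * real n) ^ z S \<sigma>)" for n
  have p_eq: "p n = (\<Sum>S\<in>Pow ?V. \<Sum>c\<in>(\<Pi>\<^sub>E v\<in>S. \<Gamma>.index_set n).
      (- a) ^ card S * det_on S (\<lambda>u v. N n (u, c u) (v, c v)))" if n: "n > 0" for n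
    unfolding p_def
  proof (rule sum.cong[OF refl])
    fix S assume S: "S \<in> Pow ?V"
    let ?Q = "{\<sigma>. \<sigma> permutes S}"
    have Q: "finite ?Q" using finite_permutations[OF finS[OF S]] .
    have "(\<Sum>c\<in>(\<Pi>\<^sub>E v\<in>S. \<Gamma>.index_set n). (- a) ^ card S * det_on S (\<lambda>u v. N n (u, c u) (v, c v))) =
        (\<Sum>\<sigma>\<in>?Q. (- a) ^ card S * of_int (sign \<sigma>) *
          (\<Sum>c\<in>(\<Pi>\<^sub>E v\<in>S. \<Gamma>.index_set n). \<Prod>u\<in>S. N n (u, c u) (\<sigma> u, c (\<sigma> u))))"
      unfolding det_on_def sum_distrib_left by (subst sum.swap) (simp add: mult.assoc)
    also have "\<dots> = (\<Sum>\<sigma>\<in>P S. (- a) ^ card S * of_int (sign \<sigma>) *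
          (\<Sum>c\<in>(\<Pi>\<^sub>E v\<in>S. \<Gamma>.index_set n). \<Prod>u\<in>S. N n (u, c u) (\<sigma> u, c (\<sigma> u))))"
    proof (rule sum.mono_neutral_right[OF Q])
      show "P S \<subseteq> ?Q" by (auto simp: P_def)
      show "\<forall>\<sigma>\<in>?Q - P S. (- a) ^ card S * of_int (sign \<sigma>) *
          (\<Sum>c\<in>(\<Pi>\<^sub>E v\<in>S. \<Gamma>.index_set n). \<Prod>u\<in>S. N n (u, c u) (\<sigma> u, c (\<sigma> u))) = 0"
      proof
        fix \<sigma> assume "\<sigma> \<in> ?Q - P S"
        then obtain u where "u \<in> S" "(u, \<sigma> u) \<notin> arcs_ends D" by (auto simp: P_def)
        then have "(\<Prod>u\<in>S. N n (u, c u) (\<sigma> u, c (\<sigma> u))) = 0" for c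
          using finS[OF S] by (intro prod_zero) (auto simp: N_def)
        then show "(- a) ^ card S * of_int (sign \<sigma>) *
          (\<Sum>c\<in>(\<Pi>\<^sub>E v\<in>S. \<Gamma>.index_set n). \<Prod>u\<in>S. N n (u, c u) (\<sigma> u, c (\<sigma> u))) = 0" by simp
      qed
    qed
    also have "\<dots> = (\<Sum>\<sigma>\<in>P S. a ^ card S * (1 - real (order \<Gamma>) * real n) ^ z S \<sigma>)"
    proof (rule sum.cong[OF refl])
      fix \<sigma> assume \<sigma>: "\<sigma> \<in> P S"
      have "(\<Prod>u\<in>S. N n (u, c u) (\<sigma> u, c (\<sigma> u))) =
          (\<Prod>u\<in>S. \<Gamma>.translation_kernel n (label u (\<sigma> u)) (c u) (c (\<sigma> u)))" for c
        using \<sigma> by (intro prod.cong) (auto simp: N_def P_def)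
      then show "(- a) ^ card S * of_int (sign \<sigma>) *
          (\<Sum>c\<in>(\<Pi>\<^sub>E v\<in>S. \<Gamma>.index_set n). \<Prod>u\<in>S. N n (u, c u) (\<sigma> u, c (\<sigma> u)))
        = a ^ card S * (1 - real (order \<Gamma>) * real n) ^ z S \<sigma>"
        unfolding z(2)[OF S \<sigma> n, symmetric] by (simp add: power_minus[of a] mult_ac)
    qed
    finally show "(\<Sum>\<sigma>\<in>P S. a ^ card S * (1 - real (order \<Gamma>) * real n) ^ z S \<sigma>) =
        (\<Sum>c\<in>(\<Pi>\<^sub>E v\<in>S. \<Gamma>.index_set n). (- a) ^ card S * det_on S (\<lambda>u v. N n (u, c u) (v, c v)))" ..
  qed
  have p_bound: "\<bar>p n\<bar> \<le> B" if n: "n > 0" "n \<le> r" for n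
  proof -
    have "\<bar>p n\<bar> \<le> exp (\<rho>\<^sup>2 * real (card (\<Gamma>.index_set n)) * ?m / 2) * sqrt (1 + (a / \<rho>)\<^sup>2) ^ card ?V"
      unfolding p_eq[OF n(1)]
    proof (rule section_sum_bound[OF fin \<Gamma>.finite_index_set[OF finite_group] \<rho> a])
      show "n > 0" by fact
      show "N n (u, p) (u, q) = 0" for u p q
        using D.no_loops by (auto simp: N_def arcs_ends_def arc_to_ends_def)
      fix u p assume u: "u \<in> ?V" and p: "p \<in> \<Gamma>.index_set n"
      have "(\<Sum>f\<in>?V \<times> \<Gamma>.index_set n. (N n (u, p) f)\<^sup>2) =
          (\<Sum>v\<in>?V. \<Sum>q\<in>\<Gamma>.index_set n. (N n (u, p) (v, q))\<^sup>2)"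
        by (simp add: sum.cartesian_product')
      also have "\<dots> \<le> (\<Sum>v\<in>?V. if (u, v) \<in> arcs_ends D then 1 else 0)"
        using \<Gamma>.translation_kernel_row[OF finite_group n(1) p label_closed]
        by (intro sum_mono) (auto simp: N_def)
      also have "\<dots> = ?d u" using fin by (simp add: sum.If_cases Int_def)
      finally show "(\<Sum>f\<in>?V \<times> \<Gamma>.index_set n. (N n (u, p) f)\<^sup>2) \<le> ?d u" .
    qed
    \<comment> \<open>The bound grows with the number of copies, so its value for \<open>r\<close>
      copies serves every interpolation point.\<close>
    also have "\<dots> \<le> B"
    proof -
      have "real (card (\<Gamma>.index_set n)) \<le> real (order \<Gamma> * r)"
        using n(2) by (simp only: \<Gamma>.card_index_set of_nat_le_iff mult_le_mono2)
      then have "\<rho>\<^sup>2 * real (card (\<Gamma>.index_set n)) * ?m \<le> \<rho>\<^sup>2 * real (order \<Gamma> * r) * ?m"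
        by (intro mult_right_mono mult_left_mono sum_nonneg) auto
      then show ?thesis unfolding B_def by (intro mult_right_mono) auto
    qed
    finally show ?thesis .
  qed
  have "cover_sum ?V (\<lambda>u v. if (u, v) \<in> arcs_ends D then a else 0) = (\<Sum>S\<in>Pow ?V. \<Sum>\<sigma>\<in>P S. a ^ card S)"
    unfolding cover_sum_def
  proof (rule sum.cong[OF refl])
    fix S assume S: "S \<in> Pow ?V"
    have "(\<Prod>u\<in>S. if (u, \<sigma> u) \<in> arcs_ends D then a else 0) =
        (if \<forall>u\<in>S. (u, \<sigma> u) \<in> arcs_ends D then a ^ card S else 0)" for \<sigma>
      using finS[OF S] by (auto intro!: prod_zero)
    then show "(\<Sum>\<sigma> | \<sigma> permutes S. \<Prod>u\<in>S. if (u, \<sigma> u) \<in> arcs_ends D then a else 0) = (\<Sum>\<sigma>\<in>P S. a ^ card S)"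
      using finite_permutations[OF finS[OF S]]
      by (simp add: P_def Collect_conj_eq flip: sum.inter_restrict) (simp add: sum.If_cases Int_def)
  qed
  \<comment> \<open>Interpolation is applied to each permutation separately, which is possible
    because every exponent is below \<open>r\<close>.\<close>
  also have "\<dots> = (\<Sum>S\<in>Pow ?V. \<Sum>\<sigma>\<in>P S. \<Sum>j=1..r. - ((- 1) ^ j * real (r choose j) *
      (a ^ card S * (1 - real (order \<Gamma>) * real j) ^ z S \<sigma>)))"
  proof (intro sum.cong refl)
    fix S \<sigma> assume "S \<in> Pow ?V" "\<sigma> \<in> P S"
    then have "a ^ card S = - (a ^ card S * (\<Sum>j=1..r. (- 1) ^ j * real (r choose j) * (1 - real (order \<Gamma>) * real j) ^ z S \<sigma>))"
      using alternating_binomial_sum_power[OF z(1)] by simp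
    then show "a ^ card S = (\<Sum>j=1..r. - ((- 1) ^ j * real (r choose j) *
      (a ^ card S * (1 - real (order \<Gamma>) * real j) ^ z S \<sigma>)))"
      by (simp add: sum_distrib_left sum_negf mult_ac)
  qed
  also have "\<dots> = (\<Sum>S\<in>Pow ?V. \<Sum>j=1..r. \<Sum>\<sigma>\<in>P S. - ((- 1) ^ j * real (r choose j) *
      (a ^ card S * (1 - real (order \<Gamma>) * real j) ^ z S \<sigma>)))"
    by (intro sum.cong refl sum.swap)
  also have "\<dots> = (\<Sum>j=1..r. - ((- 1) ^ j * real (r choose j) * p j))"
    by (subst sum.swap) (simp add: p_def sum_distrib_left sum_negf)
  also have "\<dots> \<le> (\<Sum>j=1..r. real (r choose j) * B)"
  proof (rule sum_mono)
    fix j assume j: "j \<in> {1..r}"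
    have "- ((- 1) ^ j * real (r choose j) * p j) \<le> \<bar>(- 1) ^ j * real (r choose j) * p j\<bar>" by simp
    also have "\<dots> = real (r choose j) * \<bar>p j\<bar>" by (simp add: abs_mult power_abs)
    also have "\<dots> \<le> real (r choose j) * B" using p_bound[of j] j by (intro mult_left_mono) auto
    finally show "- ((- 1) ^ j * real (r choose j) * p j) \<le> real (r choose j) * B" .
  qed
  also have "\<dots> \<le> (\<Sum>j\<le>r. real (r choose j) * B)"
    by (intro sum_mono2) (auto simp: B_def intro!: mult_nonneg_nonneg)
  also have "\<dots> = 2 ^ r * B"
  proof -
    have "(\<Sum>j\<le>r. real (r choose j)) = 2 ^ r"
      using choose_row_sum[of r] by (metis of_nat_sum of_nat_power of_nat_numeral)
    then show ?thesis by (simp flip: sum_distrib_right)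
  qed
  finally show ?thesis by (simp only: B_def)
qed

end

text \<open>
  Here \<open>n\<close> and \<open>m\<close> are the numbers of vertices and arcs, and \<open>s = 1 / \<rho>\<^sup>2\<close>. The factor \<open>4 / 5\<close> is
  close to the optimal value \<open>sqrt e / 2\<close>, which balances the last two terms.
\<close>

lemma cycle_count_numerics:
  fixes \<delta> \<Delta> k r m n a s :: real
  assumes pos: "0 < \<delta>" "\<delta> \<le> \<Delta>" and k: "k \<ge> 2" and r: "r \<ge> 1"
    and rk: "r \<le> \<delta> ^ 3 / (4 * exp 1 ^ 3 * k * \<Delta> ^ 2)"
    and n: "n \<ge> \<Delta> + 1" and m: "m \<ge> n * \<delta>"
  defines "a \<equiv> exp 2 / \<delta>"
  defines "s \<equiv> 4 / 5 * m / (n * \<Delta> * a\<^sup>2)"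
  shows "r + k * r * m / (2 * s) + n * a\<^sup>2 * s / 2 < m / (\<Delta> + 1)"
proof -
  have \<Delta>: "\<Delta> > 0" and n0: "n > 0" using pos n by linarith+
  have m0: "m > 0" using m n0 pos by (meson less_le_trans mult_pos_pos)
  have a: "a > 0" using pos by (simp add: a_def)
  define e where "e = exp (1::real)"
  have e: "e \<ge> 2" "e < 272 / 100" using exp_ge_add_one_self[of 1] e_less_272 by (auto simp: e_def)
  have a2: "a\<^sup>2 = e ^ 4 / \<delta>\<^sup>2"
    by (simp add: a_def e_def power_divide exp_of_nat_mult[symmetric] flip: exp_of_nat_mult)
  have rk': "k * r * (4 * e ^ 3 * \<Delta>\<^sup>2) \<le> \<delta> ^ 3"
    using rk k \<Delta> e by (simp add: e_def[symmetric] field_simps)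
  \<comment> \<open>The 64 is 4 * 2 * 2^3, from k >= 2 and e >= 2. It makes both the term
    \<open>r\<close> and the passage between \<Delta> and \<Delta> + 1 cheap.\<close>
  have r64: "64 * r \<le> \<delta>"
  proof -
    have "e ^ 3 \<ge> 2 ^ 3" using e by (intro power_mono) auto
    then have "k * e ^ 3 \<ge> 2 * 8" using k by (intro mult_mono) auto
    then have "r * \<Delta>\<^sup>2 * (64) \<le> r * \<Delta>\<^sup>2 * (4 * (k * e ^ 3))" using r by (intro mult_left_mono) auto
    also have "\<dots> \<le> \<delta> ^ 3" using rk' by (simp add: mult_ac)
    also have "\<delta> ^ 3 = \<delta> * \<delta>\<^sup>2" by (simp add: power3_eq_cube power2_eq_square)
    also have "\<dots> \<le> \<delta> * \<Delta>\<^sup>2" using pos by (intro mult_left_mono power_mono) auto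
    finally show ?thesis using \<Delta> by (simp add: mult_ac)
  qed
  define T where "T = m / (\<Delta> + 1)"
  have T: "T > 0" using m0 \<Delta> by (simp add: T_def)
  have "\<delta> * (\<Delta> + 1) \<le> n * \<delta>" using n pos by (simp add: mult.commute)
  then have "\<delta> \<le> T" using m \<Delta> by (simp add: T_def pos_le_divide_eq)
  then have r_le: "r \<le> T / 64" using r64 by simp
  have "\<Delta> \<ge> 64" using r64 r pos by linarith
  then have mT: "m / \<Delta> \<le> 65 / 64 * T" using m0 \<Delta> by (simp add: T_def divide_simps)
  have third: "n * a\<^sup>2 * s / 2 = 2 / 5 * (m / \<Delta>)"
    using n0 a \<Delta> by (simp add: s_def)
  have "k * r * m / (2 * s) = 5 / 8 * (k * r * n * \<Delta> * a\<^sup>2)"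
    using m0 by (simp add: s_def)
  also have "k * r * n * \<Delta> * a\<^sup>2 = (k * r * (4 * e ^ 3 * \<Delta>\<^sup>2)) * (n * e / (4 * \<Delta> * \<delta>\<^sup>2))"
    unfolding a2 using \<Delta> by (simp add: power2_eq_square power3_eq_cube power4_eq_xxxx)
  also have "\<dots> \<le> \<delta> ^ 3 * (n * e / (4 * \<Delta> * \<delta>\<^sup>2))"
    using rk' n0 \<Delta> e by (intro mult_right_mono) auto
  also have "\<dots> = e / 4 * (n * \<delta> / \<Delta>)" using pos by (simp add: power3_eq_cube power2_eq_square)
  \<comment> \<open>From e < 2.72 follows e / 4 < 68 / 100; times 5 / 8 this gives 425 /
    1000.\<close>
  also have "\<dots> \<le> (68 / 100) * (m / \<Delta>)"
    using e m \<Delta> n0 pos by (intro mult_mono divide_right_mono) auto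
  finally have second: "k * r * m / (2 * s) \<le> 425 / 1000 * (m / \<Delta>)" by simp
  \<comment> \<open>The 825 / 1000 adds the 2 / 5 of the third term. Together with the factor 65 /
    64 and the extra 1 / 64 the total stays below 0.86 T.\<close>
  have "r + k * r * m / (2 * s) + n * a\<^sup>2 * s / 2 \<le> T / 64 + 825 / 1000 * (m / \<Delta>)"
    using r_le second unfolding third by linarith
  also have "\<dots> < T" using mT T by linarith
  finally show ?thesis by (simp add: T_def)
qed

section \<open>Comparison of the two bounds\<close>

theorem theorem5p5:
  fixes \<Gamma> :: "('g, 'm) monoid_scheme"
    and D :: "('a, 'b) pre_digraph"
    and w :: "'b \<Rightarrow> 'g"
    and k \<delta> \<Delta> :: nat
  assumes "group \<Gamma>" and "finite (carrier \<Gamma>)" and "order \<Gamma> = k" and "k \<ge> 2"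
    and "eulerian_digraph D"
    and "w \<in> arcs D \<rightarrow> carrier \<Gamma>"
    and "\<delta> = min_degree D" and "\<Delta> = max_degree D" and "\<Delta> > 0"
  shows "\<exists>\<C>. finite \<C> \<and> (\<forall>C\<in>\<C>. zero_sum_cycle \<Gamma> D w C)
           \<and> pairwise (\<lambda>C C'. disjnt (cycle_verts D C) (cycle_verts D C')) \<C>
           \<and> int (card \<C>) \<ge> \<lfloor>real \<delta> ^ 3 / (4 * exp 1 ^ 3 * real k * real \<Delta> ^ 2)\<rfloor>"
proof (rule ccontr)
  assume none: "\<not> ?thesis"
  let ?q = "real \<delta> ^ 3 / (4 * exp 1 ^ 3 * real k * real \<Delta> ^ 2)"
  let ?V = "verts D"
  interpret eulerian_digraph D by fact
  interpret group \<Gamma> by fact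
  interpret L: group_labelled_digraph D \<Gamma> w
    using assms by unfold_locales
  define r where "r = nat \<lfloor>?q\<rfloor>"
  have few: "card \<C> < r" if "finite \<C>" "\<forall>C\<in>\<C>. zero_sum_cycle \<Gamma> D w C"
    "pairwise (\<lambda>C C'. disjnt (cycle_verts D C) (cycle_verts D C')) \<C>" for \<C>
    using none that unfolding r_def by (meson not_le zless_nat_eq_int_zless)
  \<comment> \<open>Under the negated claim even the empty family is too small, so the claimed
    number is positive; this also excludes \<delta> = 0.\<close>
  have "r \<ge> 1" using few[of "{}"] by simp
  have r_le: "real r \<le> ?q" unfolding r_def by simp
  have "\<delta> > 0"
  proof (rule ccontr)
    assume "\<not> \<delta> > 0"
    then have "\<delta> = 0" by simp
    then have "?q = 0" by simp
    then show False using r_le \<open>r \<ge> 1\<close> by linarith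
  qed
  have finV: "finite ?V" by simp
  define d where "d v = out_degree D v" for v
  have d_out: "card {u\<in>?V. (v, u) \<in> arcs_ends D} = d v" for v
  proof -
    have "bij_betw (head D) (out_arcs D v) {u\<in>?V. (v, u) \<in> arcs_ends D}"
      unfolding bij_betw_def
      by (auto simp: inj_on_def out_arcs_def arcs_ends_def arc_to_ends_def intro: no_multi_arcs)
    then show ?thesis by (simp add: d_def out_degree_def bij_betw_same_card)
  qed
  have d_in: "card {u\<in>?V. (u, v) \<in> arcs_ends D} = d v" if v: "v \<in> ?V" for v
  proof -
    have "bij_betw (tail D) (in_arcs D v) {u\<in>?V. (u, v) \<in> arcs_ends D}"
      unfolding bij_betw_def
      by (auto simp: inj_on_def in_arcs_def arcs_ends_def arc_to_ends_def intro: no_multi_arcs)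
    then show ?thesis using balanced[OF v] by (simp add: d_def in_degree_def bij_betw_same_card)
  qed
  have \<delta>_le: "\<delta> \<le> d v" and le_\<Delta>: "d v \<le> \<Delta>" if "v \<in> ?V" for v
    using that assms(7,8) by (auto simp: d_def min_degree_def max_degree_def)
  have "\<Delta> \<in> d ` ?V"
    unfolding assms(8) max_degree_def d_def by (rule Max_in) (simp_all add: verts_nonempty)
  then obtain v0 where v0: "v0 \<in> ?V" "d v0 = \<Delta>" by auto
  have "\<delta> \<le> \<Delta>" using \<delta>_le[OF v0(1)] v0(2) by simp
  define m where "m = (\<Sum>v\<in>?V. real (d v))"
  \<comment> \<open>A vertex of degree \<Delta> and its outneighbours are \<Delta> + 1 distinct
    vertices.\<close>
  have n_ge: "real (card ?V) \<ge> real \<Delta> + 1"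
  proof -
    have "v0 \<notin> {u\<in>?V. (v0, u) \<in> arcs_ends D}"
      using no_loops by (auto simp: arcs_ends_def arc_to_ends_def)
    then have "card (insert v0 {u\<in>?V. (v0, u) \<in> arcs_ends D}) = \<Delta> + 1"
      using d_out[of v0] v0 by simp
    moreover have "card (insert v0 {u\<in>?V. (v0, u) \<in> arcs_ends D}) \<le> card ?V"
      using v0 by (intro card_mono) auto
    ultimately show ?thesis by linarith
  qed
  have m_ge: "m \<ge> real (card ?V) * real \<delta>"
    unfolding m_def using \<delta>_le sum_mono[of ?V "\<lambda>_. real \<delta>" "\<lambda>v. real (d v)"] by simp
  define a where "a = exp 2 / real \<delta>"
  define s where "s = 4 / 5 * m / (real (card ?V) * real \<Delta> * a\<^sup>2)"
  have a: "a > 0" using \<open>\<delta> > 0\<close> by (simp add: a_def)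
  have "m > 0" using m_ge n_ge \<open>\<delta> > 0\<close> by (smt (verit) mult_pos_pos of_nat_0_less_iff of_nat_0_le_iff)
  then have s: "s > 0" using n_ge \<open>\<Delta> > 0\<close> a by (simp add: s_def)
  let ?B = "\<lambda>u v. if (u, v) \<in> arcs_ends D then a else 0"
  have "exp (m / (real \<Delta> + 1)) = (\<Prod>v\<in>?V. exp (real (d v) / (real \<Delta> + 1)))"
    by (simp add: m_def exp_sum sum_divide_distrib)
  also have "\<dots> \<le> (\<Prod>v\<in>?V. (a * real (d v) / exp 1) powr (real (d v) / (real \<Delta> + 1)))"
  proof (intro prod_mono conjI)
    fix v assume v: "v \<in> ?V"
    \<comment> \<open>By the choice of \<open>a\<close>, each base \<open>a * d v / e\<close> is at
      least e, so the lower bound becomes the exponential of the number of arcs over \<Delta> +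
      1.\<close>
    have "exp 1 * exp 1 * real \<delta> \<le> exp 2 * real (d v)"
      using \<delta>_le[OF v] by (simp flip: exp_add)
    then have "exp 1 \<le> a * real (d v) / exp 1"
      using \<open>\<delta> > 0\<close> by (simp add: a_def field_simps)
    then have "exp 1 powr (real (d v) / (real \<Delta> + 1)) \<le> (a * real (d v) / exp 1) powr (real (d v) / (real \<Delta> + 1))"
      by (intro powr_mono2) auto
    then show "exp (real (d v) / (real \<Delta> + 1)) \<le> (a * real (d v) / exp 1) powr (real (d v) / (real \<Delta> + 1))"
      by (simp add: powr_def)
  qed auto
  also have "\<dots> \<le> cover_sum ?V ?B"
  proof (rule cover_sum_lower_bound[where adj = "\<lambda>u v. (u, v) \<in> arcs_ends D", OF finV a])
    fix v assume v: "v \<in> ?V"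
    show "card {u\<in>?V. (v, u) \<in> arcs_ends D} = d v \<and> card {u\<in>?V. (u, v) \<in> arcs_ends D} = d v
        \<and> 0 < d v \<and> real (d v) < real \<Delta> + 1"
      using d_out d_in[OF v] \<delta>_le[OF v] le_\<Delta>[OF v] \<open>\<delta> > 0\<close> by auto
  qed
  \<comment> \<open>A smaller radius shrinks Hadamard's factor but raises the extraction cost; the
    radius 1 / sqrt s balances them.\<close>
  also have "\<dots> \<le> 2 ^ r * (exp ((1 / sqrt s)\<^sup>2 * real (order \<Gamma> * r) * m / 2)
      * sqrt (1 + (a / (1 / sqrt s))\<^sup>2) ^ card ?V)"
    using L.cover_sum_upper_bound[of "1 / sqrt s" a r] few s a by (simp add: d_out m_def)
  also have "\<dots> \<le> exp (real r) * (exp (real k * real r * m / (2 * s)) * exp (real (card ?V) * a\<^sup>2 * s / 2))"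
  proof (intro mult_mono)
    have "(2::real) ^ r \<le> exp 1 ^ r" using exp_ge_add_one_self[of 1] by (intro power_mono) auto
    then show "(2::real) ^ r \<le> exp (real r)" by (simp flip: exp_of_nat_mult)
    show "exp ((1 / sqrt s)\<^sup>2 * real (order \<Gamma> * r) * m / 2) \<le> exp (real k * real r * m / (2 * s))"
      using s by (simp add: assms(3) power_divide)
    have "sqrt (1 + (a / (1 / sqrt s))\<^sup>2) \<le> sqrt (exp (a\<^sup>2 * s))"
      using s exp_ge_add_one_self[of "a\<^sup>2 * s"] by (simp add: power_mult_distrib)
    also have "\<dots> = exp (a\<^sup>2 * s / 2)" by (rule real_sqrt_unique) (simp_all add: exp_double[symmetric])
    finally have "sqrt (1 + (a / (1 / sqrt s))\<^sup>2) ^ card ?V \<le> exp (a\<^sup>2 * s / 2) ^ card ?V"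
      by (intro power_mono) auto
    then show "sqrt (1 + (a / (1 / sqrt s))\<^sup>2) ^ card ?V \<le> exp (real (card ?V) * a\<^sup>2 * s / 2)"
      by (simp add: mult.assoc flip: exp_of_nat_mult)
  qed auto
  also have "\<dots> = exp (real r + real k * real r * m / (2 * s) + real (card ?V) * a\<^sup>2 * s / 2)"
    by (simp add: exp_add)
  finally have "m / (real \<Delta> + 1) \<le> real r + real k * real r * m / (2 * s) + real (card ?V) * a\<^sup>2 * s / 2"
    by (simp only: exp_le_cancel_iff)
  moreover have "real r + real k * real r * m / (2 * s) + real (card ?V) * a\<^sup>2 * s / 2 < m / (real \<Delta> + 1)"
    unfolding s_def a_def
    using \<open>\<delta> > 0\<close> \<open>\<delta> \<le> \<Delta>\<close> \<open>k \<ge> 2\<close> \<open>r \<ge> 1\<close> r_le n_ge m_ge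
    by (intro cycle_count_numerics) auto
  ultimately show False by linarith
qed

end
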